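(* Let $d<0$ be a square-free integer such that $\mathcal O_d$ is a principal ideal domain, and let $N\ge 3$. If $d\equiv1\pmod4$ assume also that $N$ is even. Then the set of real points $X_{\mathbb R}$ of $X=\Gamma_N\backslash\mathfrak h_2$ is the disjoint union $$X_{\mathbb R}=\coprod_g {}^g\phi(W)$$ of finitely many copies of $W=\Lambda_N\backslash\mathbf H_3$, indexed by (representatives of) elements $$g\in\Gamma_N\backslash\widetilde\Gamma_N/\phi(\Lambda)=H^1(\mathbb C/\mathbb R,\Gamma_N).$$ The copy indexed by $g\in\widetilde\Gamma_N$ corresponds to the cohomology class $f_\gamma$ where $\gamma=\widehat g g^{-1}\in\Gamma_N$.
   Context: Transpose is written ${}^tA$. $\mathcal O_d$ is the ring of integers of $\mathbb Q(\sqrt d)$; $\Lambda=\mathbf{SL}(2,\mathcal O_d)$; $\Lambda_N\subset\Lambda$ and $\Gamma(N)\subset\mathbf{Sp}(4,\mathbb Z)$ are the principal congruence subgroups of level $N$. Matrices: if $d\not\equiv1\pmod 4$ put $\beta=\begin{pmatrix}0&1\\ d&0\end{pmatrix}$, $\sigma=I_2$, $M=I_4$. If $d=4m+1$ put $\beta=\begin{pmatrix}1&2\\ 2m&-1\end{pmatrix}$, $\sigma=\begin{pmatrix}2&0\\ -1&1\end{pmatrix}$, $M=\begin{pmatrix}\sigma&0\\ 0&2\,{}^t\sigma^{-1}\end{pmatrix}$. Put $N_\beta=\begin{pmatrix}\beta&0\\ 0&{}^t\beta\end{pmatrix}$. $\mathbf{Sp}(4,\mathbb R)$ consists of real block matrices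 $\begin{pmatrix}A&B\\ C&D\end{pmatrix}$ with ${}^tAD-{}^tCB=I$ and ${}^tAC$, ${}^tBD$ symmetric, acting on the Siegel space $\mathfrak h_2$ (symmetric $2\times2$ complex $Z$ with $\mathrm{Im}\,Z>0$) by $(AZ+B)(CZ+D)^{-1}$. Involutions: $\widehat g=N_\beta gN_\beta^{-1}$ on $\mathbf{Sp}(4,\mathbb R)$ and $\widehat Z=\beta\overline Z\,{}^t\beta^{-1}$ on $\mathfrak h_2$; $\widehat{gZ}=\widehat g\widehat Z$. Hyperbolic 3-space: $\mathbf H_3=\{(z,r)\in\mathbb C\times\mathbb R:\mathrm{Im}(z)>0\}$, embedded by $\phi(z,r)=\sigma\begin{pmatrix}z&r\\ r&d\bar z\end{pmatrix}{}^t\sigma\in\mathfrak h_2$. Writing entries of elements of $\mathbf{SL}(2,\mathbb C)$ as $a_i+b_i\sqrt d$ with $a_i,b_i\in\mathbb R$, the embedding $\phi:\mathbf{SL}(2,\mathbb C)\to\mathbf{Sp}(4,\mathbb R)$ is $$\phi\begin{pmatrix}a_1+b_1\sqrt d&a_2+b_2\sqrt d\\ a_3+b_3\sqrt d&a_4+b_4\sqrt d\end{pmatrix}=M\begin{pmatrix}a_1&b_1&b_2&a_2\\ b_1d&a_1&a_2&b_2d\\ b_3d&a_3&a_4&b_4d\\ a_3&b_3&b_4&a_4\end{pmatrix}M^{-1}.$$ $\mathbf{SL}(2,\mathbb C)$ acts on $\mathbf H_3$ by the unique action with $\phi(gx)=\phi(g)\cdot\phi(x)$. $\Gamma_N=\Gamma(N)\cap\widehat{\Gamma(N)}$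 where $\widehat{\Gamma(N)}=\{\widehat\gamma:\gamma\in\Gamma(N)\}$. $\widetilde\Gamma_N=\{g\in\mathbf{Sp}(4,\mathbb Z):\widehat gg^{-1}\in\Gamma_N\}$, a group containing $\Gamma_N$ as a normal subgroup. For $g\in\widetilde\Gamma_N$, the map ${}^g\phi:W\to X$ is $\Lambda_Nw\mapsto\Gamma_Ng\phi(w)$; its image depends only on the double coset of $g$, and saying that ${}^g\phi(W)$ is a copy of $W$ means that ${}^g\phi$ is injective. $X_{\mathbb R}$ is the fixed point set of the anti-holomorphic involution of $X$ induced by $Z\mapsto\widehat Z$. For $\gamma\in\mathbf{Sp}(4,\mathbb R)$, $f_\gamma:\mathrm{Gal}(\mathbb C/\mathbb R)=\{1,\widehat{\ }\}\to\mathbf{Sp}(4,\mathbb R)$ is $f_\gamma(1)=I$, $f_\gamma(\widehat{\ })=\gamma$; it is a 1-cocycle iff $\gamma\widehat\gamma=I$. For a $\widehat{\ }$-stable subgroup $G$, $H^1(\mathbb C/\mathbb R,G)$ is the set of 1-cocycles $f_\gamma$ with $\gamma\in G$, modulo $\gamma\sim\widehat h\gamma h^{-1}$, $h\in G$. The identification $\Gamma_N\backslash\widetilde\Gamma_N/\phi(\Lambda)=H^1(\mathbb C/\mathbb R,\Gamma_N)$ sends the double coset of $g$ to the class of $f_{\widehat gg^{-1}}$. *)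

theory Defs
  imports
    "HOL-Analysis.Analysis"
    "HOL-Computational_Algebra.Squarefree"
    "HOL-Algebra.Ring_Divisibility"
    "HOL-Library.Disjoint_Sets"
begin

text \<open>
  Real 4 by 4 matrices are indexed by the sum type \<open>2 + 2\<close>, so that the four
  2 by 2 blocks of a matrix are indexed by \<open>Inl\<close>/\<open>Inr\<close>.
\<close>

type_synonym mat4 = "real^(2+2)^(2+2)"

definition mat22 :: "'a::zero \<Rightarrow> 'a \<Rightarrow> 'a \<Rightarrow> 'a \<Rightarrow> 'a^2^2" where
  "mat22 a b c e = vector [vector [a, b], vector [c, e]]"

definition blk :: "real^2^2 \<Rightarrow> real^2^2 \<Rightarrow> real^2^2 \<Rightarrow> real^2^2 \<Rightarrow> mat4" where
  "blk A B C D = (\<chi> i j. case i of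
       Inl k \<Rightarrow> (case j of Inl l \<Rightarrow> A $ k $ l | Inr l \<Rightarrow> B $ k $ l)
     | Inr k \<Rightarrow> (case j of Inl l \<Rightarrow> C $ k $ l | Inr l \<Rightarrow> D $ k $ l))"

definition blkA :: "mat4 \<Rightarrow> real^2^2" where "blkA g = (\<chi> k l. g $ Inl k $ Inl l)"
definition blkB :: "mat4 \<Rightarrow> real^2^2" where "blkB g = (\<chi> k l. g $ Inl k $ Inr l)"
definition blkC :: "mat4 \<Rightarrow> real^2^2" where "blkC g = (\<chi> k l. g $ Inr k $ Inl l)"
definition blkD :: "mat4 \<Rightarrow> real^2^2" where "blkD g = (\<chi> k l. g $ Inr k $ Inr l)"

definition cmat :: "real^2^2 \<Rightarrow> complex^2^2" where
  "cmat A = (\<chi> i j. complex_of_real (A $ i $ j))"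

definition conj_mat :: "complex^2^2 \<Rightarrow> complex^2^2" where
  "conj_mat Z = (\<chi> i j. cnj (Z $ i $ j))"

definition Sp4R :: "mat4 set" where
  "Sp4R = {g. transpose (blkA g) ** blkD g - transpose (blkC g) ** blkB g = mat 1
            \<and> transpose (transpose (blkA g) ** blkC g) = transpose (blkA g) ** blkC g
            \<and> transpose (transpose (blkB g) ** blkD g) = transpose (blkB g) ** blkD g}"

definition Sp4Z :: "mat4 set" where
  "Sp4Z = {g \<in> Sp4R. \<forall>i j. g $ i $ j \<in> \<int>}"

definition GammaSp :: "nat \<Rightarrow> mat4 set" where
  "GammaSp N = {g \<in> Sp4Z. \<forall>i j. \<exists>k::int. g $ i $ j - mat 1 $ i $ j = real N * of_int k}"

definition siegel :: "(complex^2^2) set" where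
  "siegel = {Z. transpose Z = Z \<and>
      (\<forall>v::real^2. v \<noteq> 0 \<longrightarrow> v \<bullet> ((\<chi> i j. Im (Z $ i $ j)) *v v) > 0)}"

definition sp_act :: "mat4 \<Rightarrow> complex^2^2 \<Rightarrow> complex^2^2" where
  "sp_act g Z = (cmat (blkA g) ** Z + cmat (blkB g))
                  ** matrix_inv (cmat (blkC g) ** Z + cmat (blkD g))"

definition sigma :: "int \<Rightarrow> real^2^2" where
  "sigma d = (if d mod 4 = 1 then mat22 2 0 (- 1) 1 else mat 1)"

definition beta :: "int \<Rightarrow> real^2^2" where
  "beta d = (if d mod 4 = 1 then mat22 1 2 (of_int (2 * ((d - 1) div 4))) (- 1)
             else mat22 0 1 (of_int d) 0)"

definition Mmat :: "int \<Rightarrow> mat4" where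
  "Mmat d = (if d mod 4 = 1
             then blk (sigma d) 0 0 (2 *\<^sub>R transpose (matrix_inv (sigma d)))
             else mat 1)"

definition Nbeta :: "int \<Rightarrow> mat4" where
  "Nbeta d = blk (beta d) 0 0 (transpose (beta d))"

definition hat :: "int \<Rightarrow> mat4 \<Rightarrow> mat4" where
  "hat d g = Nbeta d ** g ** matrix_inv (Nbeta d)"

definition hatZ :: "int \<Rightarrow> complex^2^2 \<Rightarrow> complex^2^2" where
  "hatZ d Z = cmat (beta d) ** conj_mat Z ** cmat (matrix_inv (transpose (beta d)))"

text \<open>For \<open>d < 0\<close>, \<open>csqrt (of_int d)\<close> is the square root with positive imaginary part.\<close>

definition quad_ints :: "int \<Rightarrow> complex set" where
  "quad_ints d = {x. algebraic_int x \<and> (\<exists>a\<in>\<rat>. \<exists>b\<in>\<rat>. x = a + b * csqrt (of_int d))}"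

definition quad_int_ring :: "int \<Rightarrow> complex ring" where
  "quad_int_ring d = \<lparr>carrier = quad_ints d, mult = (*), one = 1, zero = 0, add = (+)\<rparr>"

definition SL2C :: "(complex^2^2) set" where
  "SL2C = {g. det g = 1}"

definition Lambda :: "int \<Rightarrow> (complex^2^2) set" where
  "Lambda d = {g \<in> SL2C. \<forall>i j. g $ i $ j \<in> quad_ints d}"

definition LambdaN :: "int \<Rightarrow> nat \<Rightarrow> (complex^2^2) set" where
  "LambdaN d N = {g \<in> Lambda d. \<forall>i j. \<exists>t\<in>quad_ints d. g $ i $ j - mat 1 $ i $ j = of_nat N * t}"

text \<open>The coordinates of a complex number in the real basis $1, \sqrt d$ (for \<open>d < 0\<close>).\<close>

definition coord_a :: "complex \<Rightarrow> real" where "coord_a x = Re x"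
definition coord_b :: "int \<Rightarrow> complex \<Rightarrow> real" where "coord_b d x = Im x / sqrt (- of_int d)"

lemma coord_decomp:
  assumes "d < 0"
  shows "x = of_real (coord_a x) + of_real (coord_b d x) * csqrt (of_int d)"
proof -
  have "csqrt (of_int d) = \<i> * of_real (sqrt (- of_int d))"
    using assms csqrt_of_real_nonpos[of "complex_of_real (of_int d)"] by simp
  then show ?thesis
    using assms by (simp add: coord_a_def coord_b_def complex_eq_iff)
qed

definition phiSL :: "int \<Rightarrow> complex^2^2 \<Rightarrow> mat4" where
  "phiSL d g =
    (let a1 = coord_a (g $ 1 $ 1); b1 = coord_b d (g $ 1 $ 1);
         a2 = coord_a (g $ 1 $ 2); b2 = coord_b d (g $ 1 $ 2);
         a3 = coord_a (g $ 2 $ 1); b3 = coord_b d (g $ 2 $ 1);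
         a4 = coord_a (g $ 2 $ 2); b4 = coord_b d (g $ 2 $ 2);
         e = real_of_int d
     in Mmat d ** blk (mat22 a1 b1 (b1 * e) a1) (mat22 b2 a2 a2 (b2 * e))
                      (mat22 (b3 * e) a3 a3 b3) (mat22 a4 (b4 * e) b4 a4)
          ** matrix_inv (Mmat d))"

definition H3 :: "(complex \<times> real) set" where
  "H3 = {(z, r). Im z > 0}"

definition phiH :: "int \<Rightarrow> complex \<times> real \<Rightarrow> complex^2^2" where
  "phiH d = (\<lambda>(z, r). cmat (sigma d)
      ** mat22 z (of_real r) (of_real r) (of_int d * cnj z) ** transpose (cmat (sigma d)))"

definition h3_act :: "int \<Rightarrow> complex^2^2 \<Rightarrow> complex \<times> real \<Rightarrow> complex \<times> real" where
  "h3_act d g x = (THE y. y \<in> H3 \<and> phiH d y = sp_act (phiSL d g) (phiH d x))"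

definition orbit_rel :: "'g set \<Rightarrow> ('g \<Rightarrow> 'x \<Rightarrow> 'x) \<Rightarrow> 'x set \<Rightarrow> ('x \<times> 'x) set" where
  "orbit_rel G act S = {(x, y). x \<in> S \<and> y \<in> S \<and> (\<exists>g\<in>G. y = act g x)}"

definition Gamma_N :: "int \<Rightarrow> nat \<Rightarrow> mat4 set" where
  "Gamma_N d N = GammaSp N \<inter> hat d ` GammaSp N"

definition X_rel :: "int \<Rightarrow> nat \<Rightarrow> ((complex^2^2) \<times> (complex^2^2)) set" where
  "X_rel d N = orbit_rel (Gamma_N d N) sp_act siegel"

definition X_space :: "int \<Rightarrow> nat \<Rightarrow> (complex^2^2) set set" where
  "X_space d N = siegel // X_rel d N"

definition W_space :: "int \<Rightarrow> nat \<Rightarrow> (complex \<times> real) set set" where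
  "W_space d N = H3 // orbit_rel (LambdaN d N) (h3_act d) H3"

text \<open>
  The involution of \<open>X_space\<close> induced by \<open>hatZ\<close> sends an orbit, as a set of points, to its image
  under \<open>hatZ\<close>.
\<close>

definition X_real :: "int \<Rightarrow> nat \<Rightarrow> (complex^2^2) set set" where
  "X_real d N = {x \<in> X_space d N. hatZ d ` x = x}"

definition GammaTilde :: "int \<Rightarrow> nat \<Rightarrow> mat4 set" where
  "GammaTilde d N = {g \<in> Sp4Z. hat d g ** matrix_inv g \<in> Gamma_N d N}"

text \<open>
  The map $\Lambda_N w \mapsto \Gamma_N g \phi(w)$ on orbits: the union below, over the points
  \<open>w\<close> of an orbit, is a single \<open>Gamma_N\<close>-orbit exactly when the map is well defined there.
\<close>

definition gphi :: "int \<Rightarrow> nat \<Rightarrow> mat4 \<Rightarrow> (complex \<times> real) set \<Rightarrow> (complex^2^2) set" where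
  "gphi d N g \<omega> = (\<Union>w\<in>\<omega>. X_rel d N `` {sp_act g (phiH d w)})"

definition dc_rel :: "int \<Rightarrow> nat \<Rightarrow> (mat4 \<times> mat4) set" where
  "dc_rel d N = {(g, g'). g \<in> GammaTilde d N \<and> g' \<in> GammaTilde d N \<and>
      (\<exists>\<gamma>\<in>Gamma_N d N. \<exists>\<mu>\<in>Lambda d. g' = \<gamma> ** g ** phiSL d \<mu>)}"

definition double_cosets :: "int \<Rightarrow> nat \<Rightarrow> mat4 set set" where
  "double_cosets d N = GammaTilde d N // dc_rel d N"

datatype gal = GalId | GalConj

fun gal_mult :: "gal \<Rightarrow> gal \<Rightarrow> gal" where
  "gal_mult GalId t = t"
| "gal_mult GalConj GalId = GalConj"
| "gal_mult GalConj GalConj = GalId"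

fun gal_act :: "int \<Rightarrow> gal \<Rightarrow> mat4 \<Rightarrow> mat4" where
  "gal_act d GalId g = g"
| "gal_act d GalConj g = hat d g"

fun cochain :: "mat4 \<Rightarrow> gal \<Rightarrow> mat4" where
  "cochain \<gamma> GalId = mat 1"
| "cochain \<gamma> GalConj = \<gamma>"

text \<open>
  The order of the factors is the one for which the coboundaries \<open>s(h) h\<^sup>-\<^sup>1\<close> are cocycles,
  matching the equivalence relation used for \<open>H1\<close>.
\<close>

definition cocycle :: "int \<Rightarrow> (gal \<Rightarrow> mat4) \<Rightarrow> bool" where
  "cocycle d f \<longleftrightarrow> (\<forall>s t. f (gal_mult s t) = gal_act d s (f t) ** f s)"

definition Z1 :: "int \<Rightarrow> mat4 set \<Rightarrow> (gal \<Rightarrow> mat4) set" where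
  "Z1 d G = {cochain \<gamma> |\<gamma>. \<gamma> \<in> G \<and> cocycle d (cochain \<gamma>)}"

definition cohom_rel :: "int \<Rightarrow> mat4 set \<Rightarrow> ((gal \<Rightarrow> mat4) \<times> (gal \<Rightarrow> mat4)) set" where
  "cohom_rel d G = {(f, f'). f \<in> Z1 d G \<and> f' \<in> Z1 d G \<and>
      (\<exists>h\<in>G. \<forall>s. f' s = gal_act d s h ** f s ** matrix_inv h)}"

definition H1 :: "int \<Rightarrow> mat4 set \<Rightarrow> (gal \<Rightarrow> mat4) set set" where
  "H1 d G = Z1 d G // cohom_rel d G"

lemma blk_mult:
  "blk A B C D ** blk A' B' C' D' =
   blk (A ** A' + B ** C') (A ** B' + B ** D') (C ** A' + D ** C') (C ** B' + D ** D')"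
proof -
  have UNIV_split: "(UNIV :: (2+2) set) = range Inl \<union> range Inr"
    by (simp add: UNIV_sum)
  have s: "sum f (UNIV :: (2+2) set) = (\<Sum>k\<in>UNIV. f (Inl k)) + (\<Sum>k\<in>UNIV. f (Inr k))"
    for f :: "2+2 \<Rightarrow> real"
    unfolding UNIV_split by (subst sum.union_disjoint) (auto simp: sum.reindex inj_def)
  show ?thesis
    by (auto simp: vec_eq_iff blk_def matrix_matrix_mult_def s split: sum.split)
qed

lemma beta_square:
  "beta d ** beta d = of_int d *\<^sub>R mat 1"
proof (cases "d mod 4 = 1")
  case True
  then have "d = 1 + 4 * ((d - 1) div 4)" by presburger
  then have "real_of_int d = 1 + 4 * of_int ((d - 1) div 4)" by linarith
  with True show ?thesis
    by (simp add: beta_def mat22_def vec_eq_iff forall_2 matrix_matrix_mult_def sum_2 mat_def)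
qed (simp add: beta_def mat22_def vec_eq_iff forall_2 matrix_matrix_mult_def sum_2 mat_def)

lemma Nbeta_square: "Nbeta d ** Nbeta d = of_int d *\<^sub>R mat 1"
proof -
  have t: "transpose (beta d) ** transpose (beta d) = of_int d *\<^sub>R mat 1"
    by (metis beta_square matrix_transpose_mul transpose_mat transpose_scalar)
  show ?thesis
    unfolding Nbeta_def blk_mult beta_square t
    by (auto simp: vec_eq_iff blk_def mat_def split: sum.split)
qed

lemma invertible_Nbeta:
  assumes "d \<noteq> 0" shows "invertible (Nbeta d)"
  unfolding invertible_def
  by (rule exI[of _ "(1 / of_int d) *\<^sub>R Nbeta d"])
     (simp add: assms Nbeta_square scalar_matrix_assoc[symmetric] matrix_scalar_ac)

lemma cocycle_cochain_iff:
  assumes "d \<noteq> 0"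
  shows "cocycle d (cochain \<gamma>) \<longleftrightarrow> \<gamma> ** hat d \<gamma> = mat 1"
proof -
  have h1: "hat d (mat 1) = mat 1"
    using someI_ex[OF invertible_Nbeta[OF assms, unfolded invertible_def]]
    by (simp add: hat_def matrix_inv_def)
  have all: "(\<forall>s. P s) \<longleftrightarrow> P GalId \<and> P GalConj" for P
    by (metis (full_types) gal.exhaust)
  have "cocycle d (cochain \<gamma>) \<longleftrightarrow> mat 1 = hat d \<gamma> ** \<gamma>"
    unfolding cocycle_def all by (simp add: h1)
  then show ?thesis by (metis matrix_left_right_inverse)
qed

end

theory Submission
  imports Defs
begin

text \<open>
  A real point of \<open>X\<close> is the orbit of some \<open>Z\<close> with \<open>hat Z = \<gamma> Z\<close>. Since \<open>\<Gamma>(N)\<close> acts freely for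
  \<open>N \<ge> 3\<close> (powers of a stabilizing element are bounded, so \<open>(g - 1) / N\<close> is an integral matrix
  whose powers tend to 0), \<open>\<gamma>\<close> is a cocycle, and \<open>P = N\<^sub>\<beta> \<gamma>\<close> satisfies \<open>P\<^sup>2 = d\<close> and is self-adjoint
  for the symplectic form. When \<open>d \<equiv> 1 (mod 4)\<close>, evenness of \<open>N\<close> makes \<open>(1 + P) / 2\<close> integral. In
  both cases \<open>\<int>\<^sup>4\<close> becomes a module of rank 2 over the principal ideal domain \<open>\<O>\<^sub>d\<close> with a
  unimodular alternating form, and any two of these are isomorphic. Comparing \<open>P\<close> with \<open>N\<^sub>\<beta>\<close> gives
  \<open>\<gamma> = hat g g\<^sup>-\<^sup>1\<close> with \<open>g\<close> integral, so \<open>g\<^sup>-\<^sup>1 Z\<close> is fixed by the involution and hence lies in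
  the image of \<open>H\<^sub>3\<close>. Disjointness and injectivity follow from freeness again, and finiteness holds
  since \<open>\<Gamma>\<^sub>N\<close> contains the principal congruence subgroup of level \<open>N \<bar>d\<bar>\<close>.
\<close>

subsection \<open>Block matrices and the integral symplectic group\<close>

text \<open>For \<open>d mod 4 = 1\<close> the relation \<open>P ** P = d\<close> alone gives a
  module over Z[sqrt d], which is smaller than the ring of integers. The missing endomorphism (1 +
  P)/2 is integral because (1 + \<open>Nbeta d\<close>)/2 is and \<open>\<gamma>\<close> is
  congruent to 1 modulo the even number \<open>N\<close>.

  Modules are compared through a normal form. Dividing a vector by a generator of the ideal of its
  pairings gives a unimodular pair, and from it a symplectic basis in which the ring generator acts
  by a matrix depending on \<open>d\<close> only. For \<open>P\<close> and for
  \<open>Nbeta d\<close> (the cocycle 1) this yields \<open>C\<close>, \<open>C0\<close> in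
  \<open>Sp4Z\<close> with P C = C K and \<open>Nbeta d\<close> C0 = C0 K, so h = C C0^-1 satisfies
  P h = h \<open>Nbeta d\<close>. As the inverse of \<open>Nbeta d\<close> is a multiple of it, this
  says \<open>hat d h = \<gamma> ** h\<close>.

  Freeness settles injectivity and disjointness in one stroke: if \<open>h\<close> in
  \<open>GammaTilde\<close> carries one point of the image of \<open>H3\<close> to another, then
  hat(h) h^-1 lies in \<open>\<Gamma>\<close> and fixes a point, so hat(h) = h and \<open>h\<close>
  comes from \<open>Lambda\<close>.\<close>

lemma matrix_add_rdistrib: "(A + B) ** C = A ** C + B ** C"
  for A B :: "'a::semiring_1^'n^'m"
  by (simp add: matrix_matrix_mult_def vec_eq_iff sum.distrib distrib_right)

lemma matrix_diff_ldistrib: "A ** (B - C) = A ** B - A ** C"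
  for A :: "'a::ring_1^'n^'m"
  by (simp add: matrix_matrix_mult_def vec_eq_iff sum_subtractf right_diff_distrib)

lemma matrix_diff_rdistrib: "(A - B) ** C = A ** C - B ** C"
  for A B :: "'a::ring_1^'n^'m"
  by (simp add: matrix_matrix_mult_def vec_eq_iff sum_subtractf left_diff_distrib)

lemma matrix_minus_left: "(- A) ** B = - (A ** B)"
  for A :: "'a::ring_1^'n^'m"
  by (simp add: matrix_matrix_mult_def vec_eq_iff sum_negf)

lemma matrix_minus_right: "A ** (- B) = - (A ** B)"
  for A :: "'a::ring_1^'n^'m"
  by (simp add: matrix_matrix_mult_def vec_eq_iff sum_negf)

lemma matrix_zero_left: "0 ** A = 0"
  for A :: "'a::semiring_1^'n^'m"
  by (simp add: matrix_matrix_mult_def vec_eq_iff)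

lemma matrix_zero_right: "A ** 0 = 0"
  for A :: "'a::semiring_1^'n^'m"
  by (simp add: matrix_matrix_mult_def vec_eq_iff)

lemma matrix_scaleR_left: "(k *\<^sub>R A) ** B = k *\<^sub>R (A ** B)"
  for A :: "'a::real_algebra_1^'n^'m"
  by (simp add: scalar_matrix_assoc)

lemma transpose_add: "transpose (A + B) = transpose A + transpose B"
  by (simp add: transpose_def vec_eq_iff)

lemma transpose_diff: "transpose (A - B) = transpose A - transpose B"
  by (simp add: transpose_def vec_eq_iff)

lemma transpose_minus: "transpose (- A) = - transpose A"
  by (simp add: transpose_def vec_eq_iff)

lemma transpose_zero: "transpose 0 = 0"
  by (simp add: transpose_def vec_eq_iff)

lemmas mat_ring_simps =
  matrix_add_ldistrib matrix_add_rdistrib matrix_diff_ldistrib matrix_diff_rdistrib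
  matrix_minus_left matrix_minus_right matrix_zero_left matrix_zero_right
  matrix_scaleR_left matrix_scalar_ac transpose_add transpose_diff transpose_minus
  transpose_zero transpose_scalar matrix_transpose_mul

lemma mult_matrix_inv:
  fixes A :: "'a::field^'n^'n"
  assumes "invertible A"
  shows "A ** matrix_inv A = mat 1" "matrix_inv A ** A = mat 1"
  using someI_ex[OF assms[unfolded invertible_def]] by (auto simp: matrix_inv_def)

lemma matrix_inv_eqI:
  fixes A :: "'a::field^'n^'n"
  assumes "B ** A = mat 1"
  shows "matrix_inv A = B"
proof -
  have "A ** B = mat 1" using assms by (simp add: matrix_left_right_inverse)
  then have "invertible A" using assms by (auto simp: invertible_def)
  then show ?thesis
    by (metis assms matrix_mul_assoc matrix_mul_lid matrix_mul_rid mult_matrix_inv(1))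
qed

lemma matrix_mult_left_cancel:
  fixes A :: "'a::field^'n^'n"
  assumes "B ** A = mat 1" "A ** X = A ** Y"
  shows "X = Y"
  by (metis assms matrix_mul_assoc matrix_mul_lid)

lemma matrix_mult_right_cancel:
  fixes A :: "'a::field^'n^'n"
  assumes "A ** B = mat 1" "X ** A = Y ** A"
  shows "X = Y"
  by (metis assms matrix_mul_assoc matrix_mul_rid)

lemma sum_UNIV_sum22: "sum f (UNIV :: (2+2) set) = f (Inl 1) + f (Inl 2) + (f (Inr 1) + f (Inr 2))"
  for f :: "2+2 \<Rightarrow> 'a::comm_monoid_add"
proof -
  have split: "(UNIV :: (2+2) set) = range Inl \<union> range Inr"
    by (simp add: UNIV_sum)
  show ?thesis
    unfolding split by (subst sum.union_disjoint) (auto simp: sum.reindex inj_def sum_2)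
qed

lemma forall_sum22: "(\<forall>i::2+2. P i) \<longleftrightarrow> P (Inl 1) \<and> P (Inl 2) \<and> P (Inr 1) \<and> P (Inr 2)"
proof
  assume *: "P (Inl 1) \<and> P (Inl 2) \<and> P (Inr 1) \<and> P (Inr 2)"
  show "\<forall>i::2+2. P i"
  proof
    fix i :: "2+2"
    show "P i"
    proof (cases i)
      case (Inl k)
      then show ?thesis using * exhaust_2[of k] by auto
    next
      case (Inr k)
      then show ?thesis using * exhaust_2[of k] by auto
    qed
  qed
qed auto

lemma mat22_component [simp]:
  "mat22 a b c e $ 1 $ 1 = a" "mat22 a b c e $ 1 $ 2 = b"
  "mat22 a b c e $ 2 $ 1 = c" "mat22 a b c e $ 2 $ 2 = e"
  by (simp_all add: mat22_def)

lemma matrix22_eq_iff: "A = B \<longleftrightarrow> A $ 1 $ 1 = B $ 1 $ 1 \<and> A $ 1 $ 2 = B $ 1 $ 2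
    \<and> A $ 2 $ 1 = B $ 2 $ 1 \<and> A $ 2 $ 2 = B $ 2 $ 2"
  for A :: "'a^2^2"
  by (auto simp: vec_eq_iff forall_2)

lemma matrix22_mult_component: "(A ** B) $ i $ j = A $ i $ 1 * B $ 1 $ j + A $ i $ 2 * B $ 2 $ j"
  for A :: "'a::semiring_1^2^2"
  by (simp add: matrix_matrix_mult_def sum_2)

lemma transpose_component [simp]: "transpose A $ i $ j = A $ j $ i"
  by (simp add: transpose_def)

lemma mat_one_22 [simp]:
  "(mat 1 :: 'a::zero_neq_one^2^2) $ 1 $ 1 = 1" "(mat 1 :: 'a^2^2) $ 1 $ 2 = 0"
  "(mat 1 :: 'a^2^2) $ 2 $ 1 = 0" "(mat 1 :: 'a^2^2) $ 2 $ 2 = 1"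
  by (simp_all add: mat_def)

lemmas mat22_simps = matrix22_eq_iff matrix22_mult_component

lemma blk_component [simp]:
  "blk A B C D $ Inl i $ Inl j = A $ i $ j" "blk A B C D $ Inl i $ Inr j = B $ i $ j"
  "blk A B C D $ Inr i $ Inl j = C $ i $ j" "blk A B C D $ Inr i $ Inr j = D $ i $ j"
  by (simp_all add: blk_def)

lemma blk_blocks [simp]:
  "blkA (blk A B C D) = A" "blkB (blk A B C D) = B"
  "blkC (blk A B C D) = C" "blkD (blk A B C D) = D"
  by (simp_all add: blkA_def blkB_def blkC_def blkD_def vec_eq_iff)

lemma blk_eta: "blk (blkA g) (blkB g) (blkC g) (blkD g) = g"
  by (auto simp: blkA_def blkB_def blkC_def blkD_def vec_eq_iff forall_sum22 forall_2)

lemma blk_cases: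
  obtains A B C D where "g = blk A B C D"
  by (metis blk_eta)

lemma blk_eq_iff: "blk A B C D = blk A' B' C' D' \<longleftrightarrow> A = A' \<and> B = B' \<and> C = C' \<and> D = D'"
  by (metis blk_blocks)

lemma transpose_blk:
  "transpose (blk A B C D) = blk (transpose A) (transpose C) (transpose B) (transpose D)"
  by (simp add: vec_eq_iff forall_sum22 forall_2)

lemma blk_scaleR: "k *\<^sub>R blk A B C D = blk (k *\<^sub>R A) (k *\<^sub>R B) (k *\<^sub>R C) (k *\<^sub>R D)"
  by (simp add: vec_eq_iff forall_sum22 forall_2)

lemma blk_add: "blk A B C D + blk A' B' C' D' = blk (A + A') (B + B') (C + C') (D + D')"
  by (simp add: vec_eq_iff forall_sum22 forall_2)

lemma mat_eq_blk: "mat k = blk (mat k) 0 0 (mat k)"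
  by (simp add: vec_eq_iff forall_sum22 forall_2 mat_def)

section \<open>The symplectic form, the integral symplectic group and its congruence
  subgroups\<close>

definition Jm :: mat4 where
  "Jm = blk 0 (mat 1) (- mat 1) 0"

lemma Jm_square: "Jm ** Jm = - mat 1"
  by (simp add: Jm_def blk_mult mat_ring_simps mat_eq_blk[of "- 1"] mat_eq_blk[of 1])
     (simp add: vec_eq_iff forall_sum22 forall_2)

lemma transpose_Jm: "transpose Jm = - Jm"
  by (simp add: Jm_def vec_eq_iff forall_sum22 forall_2 mat_def)

text \<open>The diagonal blocks of \<open>transpose g ** Jm ** g\<close> are the skew parts of A^t C
  and B^t D. The upper right block is A^t D - C^t B, and the lower left one is its negative
  transpose, so it repeats the same condition.\<close>

lemma Sp4R_iff: "g \<in> Sp4R \<longleftrightarrow> transpose g ** Jm ** g = Jm"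
proof -
  obtain A B C D where g: "g = blk A B C D" by (rule blk_cases)
  have "(transpose D ** A - transpose B ** C = mat 1)
    \<longleftrightarrow> transpose A ** D - transpose C ** B = mat 1"
    by (metis (no_types) matrix_transpose_mul transpose_diff transpose_mat transpose_transpose)
  then show ?thesis
    unfolding g Sp4R_def Jm_def transpose_blk blk_mult blk_eq_iff mem_Collect_eq blk_blocks
    by (auto simp: mat_ring_simps algebra_simps)
qed

lemma Sp4R_mult: "g \<in> Sp4R \<Longrightarrow> h \<in> Sp4R \<Longrightarrow> g ** h \<in> Sp4R"
proof -
  assume *: "g \<in> Sp4R" "h \<in> Sp4R"
  have "transpose (g ** h) ** Jm ** (g ** h) = transpose h ** (transpose g ** Jm ** g) ** h"
    by (simp add: matrix_transpose_mul matrix_mul_assoc)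
  with * show ?thesis by (simp add: Sp4R_iff)
qed

lemma Sp4R_one: "mat 1 \<in> Sp4R"
  by (simp add: Sp4R_iff)

text \<open>An inverse without determinants: up to sign its entries are entries of \<open>g\<close>,
  so integrality of the inverse is immediate.\<close>

lemma Sp4R_left_inverse:
  assumes "g \<in> Sp4R"
  shows "(- (Jm ** transpose g ** Jm)) ** g = mat 1"
  using assms by (simp add: Sp4R_iff matrix_minus_left matrix_mul_assoc[symmetric] Jm_square)

lemma Sp4R_inv:
  assumes "g \<in> Sp4R"
  shows "matrix_inv g = - (Jm ** transpose g ** Jm)" "matrix_inv g ** g = mat 1"
    "g ** matrix_inv g = mat 1" "matrix_inv g \<in> Sp4R"
proof -
  show *: "matrix_inv g = - (Jm ** transpose g ** Jm)"
    by (rule matrix_inv_eqI[OF Sp4R_left_inverse[OF assms]])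
  show 1: "matrix_inv g ** g = mat 1"
    unfolding * by (rule Sp4R_left_inverse[OF assms])
  then show 2: "g ** matrix_inv g = mat 1"
    by (simp add: matrix_left_right_inverse)
  have 3: "transpose (matrix_inv g) ** transpose g = mat 1"
    by (simp only: 2 transpose_mat flip: matrix_transpose_mul)
  have "transpose (matrix_inv g) ** (transpose g ** Jm ** g) ** matrix_inv g
      = (transpose (matrix_inv g) ** transpose g) ** Jm ** (g ** matrix_inv g)"
    by (simp only: matrix_mul_assoc)
  also have "\<dots> = Jm"
    by (simp add: 2 3)
  finally have "transpose (matrix_inv g) ** (transpose g ** Jm ** g) ** matrix_inv g = Jm" .
  with assms show "matrix_inv g \<in> Sp4R"
    by (simp add: Sp4R_iff)
qed

definition int_mats :: "mat4 set" where
  "int_mats = {A. \<forall>i j. A $ i $ j \<in> \<int>}"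

lemma int_mats_mult: "A \<in> int_mats \<Longrightarrow> B \<in> int_mats \<Longrightarrow> A ** B \<in> int_mats"
  by (auto simp: int_mats_def matrix_matrix_mult_def)

lemma int_mats_add: "A \<in> int_mats \<Longrightarrow> B \<in> int_mats \<Longrightarrow> A + B \<in> int_mats"
  and int_mats_minus: "A \<in> int_mats \<Longrightarrow> - A \<in> int_mats"
  and int_mats_transpose: "A \<in> int_mats \<Longrightarrow> transpose A \<in> int_mats"
  and int_mats_scale: "A \<in> int_mats \<Longrightarrow> k \<in> \<int> \<Longrightarrow> k *\<^sub>R A \<in> int_mats"
  and int_mats_one: "mat 1 \<in> int_mats"
  by (auto simp: int_mats_def mat_def)

lemma int_mats_Jm: "Jm \<in> int_mats"
  by (simp add: int_mats_def Jm_def forall_sum22 forall_2 mat_def)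

lemma Sp4Z_iff: "g \<in> Sp4Z \<longleftrightarrow> g \<in> Sp4R \<and> g \<in> int_mats"
  by (auto simp: Sp4Z_def int_mats_def)

lemma Sp4Z_mult: "g \<in> Sp4Z \<Longrightarrow> h \<in> Sp4Z \<Longrightarrow> g ** h \<in> Sp4Z"
  by (simp add: Sp4Z_iff Sp4R_mult int_mats_mult)

lemma Sp4Z_one: "mat 1 \<in> Sp4Z"
  by (simp add: Sp4Z_iff Sp4R_one int_mats_one)

lemma Sp4Z_inv: "g \<in> Sp4Z \<Longrightarrow> matrix_inv g \<in> Sp4Z"
  by (simp add: Sp4Z_iff Sp4R_inv(4))
     (simp add: Sp4R_inv(1) int_mats_minus int_mats_mult int_mats_Jm int_mats_transpose)

lemma Sp4R_inv_mult:
  assumes "g \<in> Sp4R" "h \<in> Sp4R"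
  shows "matrix_inv (g ** h) = matrix_inv h ** matrix_inv g"
proof (rule matrix_inv_eqI)
  have "matrix_inv h ** matrix_inv g ** (g ** h) = matrix_inv h ** (matrix_inv g ** g) ** h"
    by (simp only: matrix_mul_assoc)
  then show "matrix_inv h ** matrix_inv g ** (g ** h) = mat 1"
    by (simp add: Sp4R_inv(2) assms)
qed

lemma Sp4R_inv_inv: "g \<in> Sp4R \<Longrightarrow> matrix_inv (matrix_inv g) = g"
  by (rule matrix_inv_eqI) (rule Sp4R_inv(3))

text \<open>Turns the entrywise congruence into the single equation g = 1 + N Y, after which the
  group laws are identities in the matrix ring.\<close>

lemma GammaSp_iff:
  "g \<in> GammaSp N \<longleftrightarrow> g \<in> Sp4R \<and> (\<exists>Y\<in>int_mats. g = mat 1 + real N *\<^sub>R Y)"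
proof
  assume g: "g \<in> GammaSp N"
  then obtain k :: "2+2 \<Rightarrow> 2+2 \<Rightarrow> int"
    where k: "\<And>i j. g $ i $ j - mat 1 $ i $ j = real N * of_int (k i j)"
    unfolding GammaSp_def mem_Collect_eq by metis
  have "g = mat 1 + real N *\<^sub>R (\<chi> i j. of_int (k i j))"
    using k by (simp add: vec_eq_iff algebra_simps)
  moreover have "(\<chi> i j. of_int (k i j)) \<in> int_mats"
    by (simp add: int_mats_def)
  ultimately show "g \<in> Sp4R \<and> (\<exists>Y\<in>int_mats. g = mat 1 + real N *\<^sub>R Y)"
    using g by (auto simp: GammaSp_def Sp4Z_iff)
next
  assume "g \<in> Sp4R \<and> (\<exists>Y\<in>int_mats. g = mat 1 + real N *\<^sub>R Y)"
  then obtain Y where Y: "g \<in> Sp4R" "Y \<in> int_mats" "g = mat 1 + real N *\<^sub>R Y" by blast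
  then have "g \<in> Sp4Z"
    by (simp add: Sp4Z_iff int_mats_add int_mats_one int_mats_scale)
  then show "g \<in> GammaSp N"
    using Y(2,3) by (auto simp: GammaSp_def int_mats_def Ints_def)
qed

lemma GammaSp_subset: "GammaSp N \<subseteq> Sp4Z"
  by (auto simp: GammaSp_def)

lemma GammaSp_one: "mat 1 \<in> GammaSp N"
proof -
  have "0 \<in> int_mats" "mat 1 = mat 1 + real N *\<^sub>R (0 :: mat4)"
    by (simp_all add: int_mats_def)
  then show ?thesis
    unfolding GammaSp_iff using Sp4R_one by blast
qed

lemma GammaSp_mult:
  assumes "g \<in> GammaSp N" "h \<in> GammaSp N"
  shows "g ** h \<in> GammaSp N"
proof -
  obtain Y Z where *: "Y \<in> int_mats" "g = mat 1 + real N *\<^sub>R Y"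
    "Z \<in> int_mats" "h = mat 1 + real N *\<^sub>R Z"
    using assms by (auto simp: GammaSp_iff)
  have "g ** h = mat 1 + real N *\<^sub>R (Y + Z + real N *\<^sub>R (Y ** Z))"
    by (simp add: * mat_ring_simps algebra_simps)
  then show ?thesis
    using assms * Sp4R_mult[of g h] unfolding GammaSp_iff
    by (metis int_mats_add int_mats_scale int_mats_mult Ints_of_nat)
qed

lemma GammaSp_inv:
  assumes "g \<in> GammaSp N"
  shows "matrix_inv g \<in> GammaSp N"
proof -
  obtain Y where Y: "Y \<in> int_mats" "g = mat 1 + real N *\<^sub>R Y"
    using assms by (auto simp: GammaSp_iff)
  have g: "g \<in> Sp4Z" using assms GammaSp_subset by blast
  then have gR: "g \<in> Sp4R" by (simp add: Sp4Z_iff)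
  have "mat 1 = matrix_inv g + real N *\<^sub>R (matrix_inv g ** Y)"
    using Sp4R_inv(2)[OF gR] by (subst (asm) (2) Y(2)) (simp add: mat_ring_simps)
  then have "matrix_inv g = mat 1 + real N *\<^sub>R (- (matrix_inv g ** Y))"
    by (simp add: algebra_simps)
  moreover have "- (matrix_inv g ** Y) \<in> int_mats"
    using Sp4Z_inv[OF g] Y(1) by (simp add: Sp4Z_iff int_mats_minus int_mats_mult)
  ultimately show ?thesis
    using Sp4R_inv(4)[OF gR] unfolding GammaSp_iff by blast
qed

lemma GammaSp_conj:
  assumes "g \<in> Sp4Z" "h \<in> GammaSp N"
  shows "g ** h ** matrix_inv g \<in> GammaSp N"
proof -
  obtain Y where Y: "Y \<in> int_mats" "h = mat 1 + real N *\<^sub>R Y"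
    using assms by (auto simp: GammaSp_iff)
  have gi: "matrix_inv g \<in> Sp4Z" by (rule Sp4Z_inv[OF assms(1)])
  have "g ** h ** matrix_inv g = mat 1 + real N *\<^sub>R (g ** Y ** matrix_inv g)"
    using Sp4R_inv(3) assms(1) by (simp add: Y mat_ring_simps Sp4Z_iff)
  moreover have "g ** Y ** matrix_inv g \<in> int_mats"
    using assms(1) gi Y(1) by (simp add: Sp4Z_iff int_mats_mult)
  moreover have "g ** h ** matrix_inv g \<in> Sp4R"
    using assms gi GammaSp_iff by (simp add: Sp4Z_iff Sp4R_mult)
  ultimately show ?thesis unfolding GammaSp_iff by blast
qed

subsection \<open>The action on the Siegel space\<close>

definition mat_pow :: "'a::semiring_1^'n^'n \<Rightarrow> nat \<Rightarrow> 'a^'n^'n" where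
  "mat_pow A k = (((**) A) ^^ k) (mat 1)"

lemma mat_pow_0 [simp]: "mat_pow A 0 = mat 1"
  by (simp add: mat_pow_def)

lemma mat_pow_Suc: "mat_pow A (Suc k) = A ** mat_pow A k"
  by (simp add: mat_pow_def)

lemma mat_pow_Suc2: "mat_pow A (Suc k) = mat_pow A k ** A"
proof (induction k)
  case (Suc k)
  then show ?case
    by (metis mat_pow_Suc matrix_mul_assoc)
qed (simp add: mat_pow_def)

text \<open>Boundedness of the powers of \<open>g\<close> forces the entries of Y^k below (2/N)^k B.
  They are integers, so some power of \<open>Y\<close> vanishes and \<open>g\<close> is unipotent. A
  unipotent matrix other than 1 has unbounded powers, hence \<open>Y = 0\<close>.\<close>

lemma minkowski_congruence:
  fixes g Y :: "real^'n^'n"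
  assumes N: "N \<ge> 3" and Y: "\<And>i j. Y $ i $ j \<in> \<int>"
    and g: "g = mat 1 + real N *\<^sub>R Y"
    and bd: "\<And>k i j. \<bar>mat_pow g k $ i $ j\<bar> \<le> B"
  shows "g = mat 1"
proof -
  have step: "real N *\<^sub>R (X ** Y) = X ** g - X" for X
    by (simp add: g mat_ring_simps)
  \<comment> \<open>Each factor \<open>Y\<close> is traded for 1/N times a difference of two
    neighbouring exponents \<open>j\<close>, which costs a factor 2/N. The induction therefore has
    to run over all \<open>j\<close> at once.\<close>
  have bound: "\<bar>(mat_pow Y k ** mat_pow g j) $ a $ b\<bar> \<le> (2 / real N) ^ k * B" for k j a b
  proof (induction k arbitrary: j)
    case (Suc k)
    have "real N *\<^sub>R (mat_pow Y (Suc k) ** mat_pow g j)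
        = (mat_pow Y k ** g - mat_pow Y k) ** mat_pow g j"
      by (simp only: mat_pow_Suc2 flip: step) (simp add: mat_ring_simps)
    also have "\<dots> = mat_pow Y k ** mat_pow g (Suc j) - mat_pow Y k ** mat_pow g j"
      by (simp add: matrix_diff_rdistrib mat_pow_Suc matrix_mul_assoc)
    finally have "real N * (mat_pow Y (Suc k) ** mat_pow g j) $ a $ b
        = (mat_pow Y k ** mat_pow g (Suc j)) $ a $ b - (mat_pow Y k ** mat_pow g j) $ a $ b"
      by (simp add: vec_eq_iff)
    then have "\<bar>real N * (mat_pow Y (Suc k) ** mat_pow g j) $ a $ b\<bar> \<le> 2 * ((2 / real N) ^ k * B)"
      using Suc.IH[of "Suc j"] Suc.IH[of j] by linarith
    then show ?case
      using N by (simp add: abs_mult field_simps)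
  qed (use bd in simp)
  have ints: "mat_pow Y k $ i $ j \<in> \<int>" for k i j
  proof (induction k arbitrary: i j)
    case 0
    then show ?case by (simp add: mat_def)
  next
    case (Suc k)
    then show ?case
      using Y by (auto simp: mat_pow_Suc matrix_matrix_mult_def)
  qed
  have B0: "B \<ge> 0"
    using bd[of 0 undefined undefined] by linarith
  \<comment> \<open>\<open>N \<ge> 3\<close> enters here: it gives 2/N \<le> 2/3 < 1.\<close>
  have "(\<lambda>k. (2/3::real) ^ k * B) \<longlonglongrightarrow> 0"
    by (intro tendsto_mult_left_zero LIMSEQ_power_zero) simp
  then have "\<forall>\<^sub>F k in sequentially. (2/3::real) ^ k * B < 1"
    by (rule order_tendstoD) simp
  then obtain k where k: "(2/3::real) ^ k * B < 1"
    by (auto simp: eventually_sequentially)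
  have "mat_pow Y k $ a $ b = 0" for a b
  proof -
    have "(2 / real N) ^ k * B \<le> (2/3) ^ k * B"
      using N B0 by (intro mult_right_mono power_mono divide_left_mono) auto
    then have "\<bar>mat_pow Y k $ a $ b\<bar> < 1"
      using bound[of k 0 a b] k by simp
    then show ?thesis
      using ints[of k a b] by (simp add: Ints_nonzero_abs_less1)
  qed
  then have "\<exists>k. mat_pow Y k = 0"
    by (metis vec_eq_iff zero_index)
  define m where "m = (LEAST k. mat_pow Y k = 0)"
  have m: "mat_pow Y m = 0"
    unfolding m_def by (rule LeastI_ex) fact
  have least: "mat_pow Y l \<noteq> 0" if "l < m" for l
    using that not_less_Least unfolding m_def by blast
  consider "m = 0" | "m = 1" | l where "m = Suc (Suc l)"
    by (metis One_nat_def not0_implies_Suc)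
  then show ?thesis
  proof cases
    case 1
    then have "(mat 1 :: real^'n^'n) $ undefined $ undefined = 0" using m by simp
    then show ?thesis by (simp add: mat_def)
  next
    case 2
    then have "Y = 0" using m by (simp add: mat_pow_Suc)
    then show ?thesis using g by simp
  next
    case (3 l)
    \<comment> \<open>The last nonzero power of \<open>Y\<close> is \<open>V ** Y\<close>. It is
      killed by \<open>Y\<close>, so \<open>V ** mat_pow g k\<close> is affine in \<open>k\<close>
      with slope \<open>N\<close> times \<open>V ** Y\<close>, and boundedness makes that slope
      vanish.\<close>
    define V where "V = mat_pow Y l"
    have VY: "V ** Y = mat_pow Y (Suc l)" and VYY: "V ** Y ** Y = 0"
      using m 3 by (simp_all add: V_def mat_pow_Suc2)
    have fix1: "V ** Y ** mat_pow g k = V ** Y" for k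
    proof (induction k)
      case (Suc k)
      have "V ** Y ** g = V ** Y"
        using step[of "V ** Y"] VYY by simp
      then show ?case
        using Suc by (simp add: mat_pow_Suc matrix_mul_assoc)
    qed simp
    have lin: "V ** mat_pow g k = V + (real k * real N) *\<^sub>R (V ** Y)" for k
    proof (induction k)
      case (Suc k)
      have "V ** mat_pow g (Suc k) = (V + real N *\<^sub>R (V ** Y)) ** mat_pow g k"
        by (simp add: step mat_pow_Suc matrix_mul_assoc)
      also have "\<dots> = V ** mat_pow g k + real N *\<^sub>R (V ** Y ** mat_pow g k)"
        by (simp add: mat_ring_simps)
      finally show ?case
        by (simp add: Suc fix1 algebra_simps)
    qed simp
    have "(V ** Y) $ a $ b = 0" for a b
    proof (rule ccontr)
      assume nz: "(V ** Y) $ a $ b \<noteq> 0"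
      define C where "C = (2 / real N) ^ l * B + \<bar>V $ a $ b\<bar>"
      have le: "real k * (real N * \<bar>(V ** Y) $ a $ b\<bar>) \<le> C" for k
      proof -
        have "\<bar>V $ a $ b + real k * real N * (V ** Y) $ a $ b\<bar> \<le> (2 / real N) ^ l * B"
          using bound[of l k a b] unfolding V_def[symmetric] lin by simp
        then have "\<bar>real k * real N * (V ** Y) $ a $ b\<bar> \<le> C"
          unfolding C_def by linarith
        then show ?thesis by (simp add: abs_mult mult.assoc)
      qed
      have "real N * \<bar>(V ** Y) $ a $ b\<bar> > 0" using nz N by simp
      then obtain k where "C < real k * (real N * \<bar>(V ** Y) $ a $ b\<bar>)"
        using reals_Archimedean3 by blast
      with le[of k] show False by simp
    qed
    then have "V ** Y = 0" by (simp add: vec_eq_iff)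
    then show ?thesis using least[of "Suc l"] 3 VY by simp
  qed
qed

section \<open>Numerator, denominator and positivity for the fractional action\<close>

lemma cmat_simps:
  "cmat (A ** B) = cmat A ** cmat B" "cmat (A + B) = cmat A + cmat B"
  "cmat (A - B) = cmat A - cmat B" "cmat (transpose A) = transpose (cmat A)"
  "cmat (mat 1) = mat 1" "cmat (k *\<^sub>R A) = k *\<^sub>R cmat A" "cmat (- A) = - cmat A"
  by (simp_all add: cmat_def vec_eq_iff matrix_matrix_mult_def mat_def transpose_def)
     (simp add: scaleR_conv_of_real)

lemma conj_mat_simps:
  "conj_mat (A ** B) = conj_mat A ** conj_mat B" "conj_mat (A + B) = conj_mat A + conj_mat B"
  "conj_mat (A - B) = conj_mat A - conj_mat B" "conj_mat (transpose A) = transpose (conj_mat A)"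
  "conj_mat (mat 1) = mat 1" "conj_mat (k *\<^sub>R A) = k *\<^sub>R conj_mat A"
  "conj_mat (cmat R) = cmat R" "conj_mat (conj_mat A) = A"
  by (simp_all add: cmat_def conj_mat_def vec_eq_iff matrix_matrix_mult_def mat_def transpose_def)

definition sp_num :: "mat4 \<Rightarrow> complex^2^2 \<Rightarrow> complex^2^2" where
  "sp_num g Z = cmat (blkA g) ** Z + cmat (blkB g)"

definition sp_den :: "mat4 \<Rightarrow> complex^2^2 \<Rightarrow> complex^2^2" where
  "sp_den g Z = cmat (blkC g) ** Z + cmat (blkD g)"

lemma sp_act_eq: "sp_act g Z = sp_num g Z ** matrix_inv (sp_den g Z)"
  by (simp add: sp_act_def sp_num_def sp_den_def)

text \<open>Both identities express that \<open>g\<close> preserves the pairing by \<open>Jm\<close>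
  of the column blocks (Z, 1) and (W, 1), whose value is Z - W. The cases are W = conj Z and W =
  Z.\<close>

lemma sp_num_den_pairing:
  assumes g: "g \<in> Sp4R" and Z: "transpose Z = Z"
  shows "transpose (sp_num g Z) ** conj_mat (sp_den g Z)
      - transpose (sp_den g Z) ** conj_mat (sp_num g Z) = Z - conj_mat Z" (is ?A)
    and "transpose (sp_num g Z) ** sp_den g Z = transpose (sp_den g Z) ** sp_num g Z" (is ?B)
proof -
  define A B C D where "A = cmat (blkA g)" "B = cmat (blkB g)" "C = cmat (blkC g)" "D = cmat (blkD g)"
  note defs = this
  have AC: "transpose A ** C = transpose C ** A"
    and BD: "transpose B ** D = transpose D ** B"
    and AD: "transpose A ** D = mat 1 + transpose C ** B"
    using g unfolding defs Sp4R_def mem_Collect_eq cmat_simps(4)[symmetric] cmat_simps(1)[symmetric]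
    by (simp_all add: matrix_transpose_mul algebra_simps)
       (metis add.commute add_diff_cancel_left' cmat_simps(2,5) diff_add_cancel)
  have DA: "transpose D ** A = mat 1 + transpose B ** C"
    using arg_cong[OF AD, of transpose] by (simp add: mat_ring_simps)
  have r: "transpose A ** (C ** X) = transpose C ** (A ** X)"
    "transpose B ** (D ** X) = transpose D ** (B ** X)"
    "transpose A ** (D ** X) = X + transpose C ** (B ** X)"
    "transpose D ** (A ** X) = X + transpose B ** (C ** X)" for X
    by (simp_all add: matrix_mul_assoc AC BD AD DA matrix_add_rdistrib)
  have PQ: "sp_num g W = A ** W + B" "sp_den g W = C ** W + D" for W
    by (simp_all add: sp_num_def sp_den_def defs)
  have cPQ: "conj_mat (sp_num g Z) = A ** conj_mat Z + B" "conj_mat (sp_den g Z) = C ** conj_mat Z + D"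
    by (simp_all add: sp_num_def sp_den_def defs conj_mat_simps)
  have "transpose (A ** Z + B) ** (C ** W + D) - transpose (C ** Z + D) ** (A ** W + B) = Z - W" for W
    by (simp add: mat_ring_simps Z r AC BD AD DA flip: matrix_mul_assoc)
  from this[of Z] this[of "conj_mat Z"] show ?A ?B
    unfolding cPQ unfolding PQ by simp_all
qed

definition cdot :: "complex^2 \<Rightarrow> complex^2 \<Rightarrow> complex" where
  "cdot u w = u $ 1 * w $ 1 + u $ 2 * w $ 2"

definition cnj_vec :: "complex^2 \<Rightarrow> complex^2" where
  "cnj_vec u = (\<chi> i. cnj (u $ i))"

lemma cdot_matrix_left: "cdot (A *v u) w = cdot u (transpose A *v w)"
  by (simp add: cdot_def matrix_vector_mult_def sum_2 transpose_def algebra_simps)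

lemma cnj_vec_matrix: "cnj_vec (A *v u) = conj_mat A *v cnj_vec u"
  by (simp add: cnj_vec_def conj_mat_def matrix_vector_mult_def vec_eq_iff)

text \<open>The Hermitian form u^t (Im Z) conj(u). It is written with Z - conj Z = 2i Im Z because
  that is the combination in the pairing identity.\<close>

definition im_form :: "complex^2^2 \<Rightarrow> complex^2 \<Rightarrow> real" where
  "im_form Z u = Im (cdot u ((Z - conj_mat Z) *v cnj_vec u)) / 2"

definition im_mat :: "complex^2^2 \<Rightarrow> real^2^2" where
  "im_mat Z = (\<chi> i j. Im (Z $ i $ j))"

lemma im_form_eq:
  assumes "transpose Z = Z"
  shows "im_form Z u = (\<chi> i. Re (u $ i)) \<bullet> (im_mat Z *v (\<chi> i. Re (u $ i)))
                     + (\<chi> i. Im (u $ i)) \<bullet> (im_mat Z *v (\<chi> i. Im (u $ i)))"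
proof -
  have "Z $ 2 $ 1 = Z $ 1 $ 2"
    using assms by (metis transpose_component)
  then show ?thesis
    by (simp add: im_form_def cdot_def cnj_vec_def im_mat_def conj_mat_def inner_vec_def
        matrix_vector_mult_def sum_2 algebra_simps)
qed

lemma siegel_iff: "Z \<in> siegel \<longleftrightarrow> transpose Z = Z \<and> (\<forall>v. v \<noteq> 0 \<longrightarrow> v \<bullet> (im_mat Z *v v) > 0)"
  by (simp add: siegel_def im_mat_def)

text \<open>The constant is the minimum of the form on the compact unit sphere; homogeneity extends
  the bound to all vectors.\<close>

lemma siegel_lower_bound:
  assumes "Z \<in> siegel"
  obtains c where "c > 0" "\<And>v. v \<bullet> (im_mat Z *v v) \<ge> c * (norm v)\<^sup>2"
proof -
  have "continuous_on (sphere 0 1) (\<lambda>v. v \<bullet> (im_mat Z *v v))"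
    by (intro continuous_intros linear_continuous_on matrix_vector_mul_bounded_linear)
  moreover have "axis 1 1 \<in> sphere (0::real^2) 1"
    by simp
  ultimately obtain x where x: "x \<in> sphere (0::real^2) 1"
    and le: "\<And>y. y \<in> sphere 0 1 \<Longrightarrow> x \<bullet> (im_mat Z *v x) \<le> y \<bullet> (im_mat Z *v y)"
    using continuous_attains_inf[of "sphere (0::real^2) 1"] compact_sphere by blast
  show thesis
  proof (rule that)
    have "x \<noteq> 0" using x by auto
    then show "x \<bullet> (im_mat Z *v x) > 0" using assms by (simp add: siegel_iff)
    show "v \<bullet> (im_mat Z *v v) \<ge> (x \<bullet> (im_mat Z *v x)) * (norm v)\<^sup>2" for v
    proof (cases "v = 0")
      case False
      then have "x \<bullet> (im_mat Z *v x) \<le> (v /\<^sub>R norm v) \<bullet> (im_mat Z *v (v /\<^sub>R norm v))"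
        by (intro le) simp
      also have "\<dots> = (v \<bullet> (im_mat Z *v v)) / (norm v)\<^sup>2"
        by (simp add: matrix_vector_mult_scaleR power2_eq_square divide_simps)
      finally show ?thesis
        using False by (simp add: field_simps)
    qed simp
  qed
qed

lemma im_form_lower_bound:
  assumes "Z \<in> siegel"
  obtains c where "c > 0" "\<And>u. im_form Z u \<ge> c * (norm u)\<^sup>2"
proof -
  obtain c where c: "c > 0" "\<And>v. v \<bullet> (im_mat Z *v v) \<ge> c * (norm v)\<^sup>2"
    using siegel_lower_bound[OF assms] by blast
  show thesis
  proof (rule that[OF c(1)])
    fix u :: "complex^2"
    have "(norm u)\<^sup>2 = (norm (\<chi> i. Re (u $ i)))\<^sup>2 + (norm (\<chi> i. Im (u $ i)))\<^sup>2"
      by (simp add: norm_vec_def L2_set_def sum_2 cmod_def)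
    then have "c * (norm u)\<^sup>2 = c * (norm (\<chi> i. Re (u $ i)))\<^sup>2 + c * (norm (\<chi> i. Im (u $ i)))\<^sup>2"
      by (simp add: distrib_left)
    also have "\<dots> \<le> im_form Z u"
      using assms im_form_eq[of Z u] c(2) by (simp add: siegel_iff add_mono)
    finally show "im_form Z u \<ge> c * (norm u)\<^sup>2" .
  qed
qed

lemma im_form_pos: "Z \<in> siegel \<Longrightarrow> u \<noteq> 0 \<Longrightarrow> im_form Z u > 0"
  by (metis im_form_lower_bound less_le_trans mult_pos_pos zero_less_norm_iff zero_less_power)

lemma im_form_congruence:
  assumes "transpose Q ** (W - conj_mat W) ** conj_mat Q = Z - conj_mat Z"
  shows "im_form W (Q *v u) = im_form Z u"
  unfolding im_form_def cdot_matrix_left cnj_vec_matrix assms[symmetric]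
  by (simp add: matrix_vector_mul_assoc matrix_mul_assoc)

text \<open>A kernel vector of the denominator, together with its conjugate, annihilates both terms
  of the pairing identity, so \<open>im_form Z\<close> would vanish at it.\<close>

lemma sp_den_invertible:
  assumes g: "g \<in> Sp4R" and Z: "Z \<in> siegel"
  shows "invertible (sp_den g Z)"
proof -
  have "u = 0" if u: "sp_den g Z *v u = 0" for u
  proof (rule ccontr)
    assume "u \<noteq> 0"
    have Zt: "transpose Z = Z" using Z by (simp add: siegel_iff)
    have cu: "conj_mat (sp_den g Z) *v cnj_vec u = 0"
      using arg_cong[OF u, of cnj_vec] by (simp add: cnj_vec_matrix) (simp add: cnj_vec_def vec_eq_iff)
    have "cdot u ((Z - conj_mat Z) *v cnj_vec u)
        = cdot u (transpose (sp_num g Z) *v (conj_mat (sp_den g Z) *v cnj_vec u))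
        - cdot (sp_den g Z *v u) (conj_mat (sp_num g Z) *v cnj_vec u)"
      unfolding cdot_matrix_left sp_num_den_pairing(1)[OF g Zt, symmetric]
      by (simp add: matrix_vector_mul_assoc matrix_vector_mult_diff_rdistrib)
         (simp add: cdot_def algebra_simps)
    also have "\<dots> = 0"
      unfolding cu u by (simp add: cdot_def)
    finally have "im_form Z u = 0" by (simp add: im_form_def)
    with im_form_pos[OF Z \<open>u \<noteq> 0\<close>] show False by simp
  qed
  then show ?thesis
    by (metis invertible_left_inverse matrix_left_invertible_ker)
qed

lemma sp_num_eq:
  assumes "g \<in> Sp4R" "Z \<in> siegel"
  shows "sp_num g Z = sp_act g Z ** sp_den g Z"
  using mult_matrix_inv(2)[OF sp_den_invertible[OF assms]]
  by (simp add: sp_act_eq flip: matrix_mul_assoc)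

lemma sp_act_eqI:
  assumes "sp_num g Z = W ** K" "sp_den g Z = K" "invertible K"
  shows "sp_act g Z = W"
  using assms mult_matrix_inv(1)[OF assms(3)] by (simp add: sp_act_eq flip: matrix_mul_assoc)

lemma sp_act_symmetric:
  assumes g: "g \<in> Sp4R" and Z: "Z \<in> siegel"
  shows "transpose (sp_act g Z) = sp_act g Z"
proof -
  define Q W where "Q = sp_den g Z" and "W = sp_act g Z"
  have Zt: "transpose Z = Z" using Z by (simp add: siegel_iff)
  have inv: "invertible Q" unfolding Q_def by (rule sp_den_invertible[OF g Z])
  have "transpose (W ** Q) ** Q = transpose Q ** (W ** Q)"
    using sp_num_den_pairing(2)[OF g Zt] unfolding sp_num_eq[OF g Z] Q_def W_def .
  then have "transpose Q ** (transpose W ** Q) = transpose Q ** (W ** Q)"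
    by (simp add: matrix_transpose_mul matrix_mul_assoc)
  moreover have "transpose (matrix_inv Q) ** transpose Q = mat 1"
    by (simp add: mult_matrix_inv(1)[OF inv] flip: matrix_transpose_mul)
  ultimately have "transpose W ** Q = W ** Q"
    by (metis matrix_mult_left_cancel)
  then have "transpose W = W"
    using matrix_mult_right_cancel mult_matrix_inv(1)[OF inv] by blast
  then show ?thesis by (simp add: W_def)
qed

text \<open>The transformation law Im Z = Q^t Im(gZ) conj(Q) for the denominator Q. It yields
  positivity of Im(gZ) and, when gZ = Z, bounds on Q.\<close>

lemma sp_act_congruence:
  assumes g: "g \<in> Sp4R" and Z: "Z \<in> siegel"
  shows "transpose (sp_den g Z) ** (sp_act g Z - conj_mat (sp_act g Z)) ** conj_mat (sp_den g Z)
    = Z - conj_mat Z"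
proof -
  have Zt: "transpose Z = Z" using Z by (simp add: siegel_iff)
  show ?thesis
    using sp_num_den_pairing(1)[OF g Zt] sp_act_symmetric[OF g Z]
    unfolding sp_num_eq[OF g Z]
    by (simp add: conj_mat_simps mat_ring_simps matrix_mul_assoc)
qed

lemma sp_act_siegel:
  assumes g: "g \<in> Sp4R" and Z: "Z \<in> siegel"
  shows "sp_act g Z \<in> siegel"
proof -
  define Q W where "Q = sp_den g Z" and "W = sp_act g Z"
  have Wt: "transpose W = W" unfolding W_def by (rule sp_act_symmetric[OF g Z])
  have "v \<bullet> (im_mat W *v v) > 0" if v: "v \<noteq> 0" for v
  proof -
    define cv :: "complex^2" where "cv = (\<chi> i. of_real (v $ i))"
    \<comment> \<open>Chosen so that Q u is the given real vector: the form of gZ there equals the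
      form of Z at \<open>u\<close>.\<close>
    define u where "u = matrix_inv Q *v cv"
    have "Q *v u = cv"
      using mult_matrix_inv(1)[OF sp_den_invertible[OF g Z]]
      by (simp add: u_def Q_def matrix_vector_mul_assoc)
    moreover have "cv \<noteq> 0" using v by (auto simp: cv_def vec_eq_iff)
    ultimately have "u \<noteq> 0" by auto
    have "im_form W cv = v \<bullet> (im_mat W *v v)"
      by (subst im_form_eq[OF Wt]) (simp add: cv_def zero_vec_def[symmetric])
    moreover have "im_form W cv = im_form Z u"
      using im_form_congruence[OF sp_act_congruence[OF g Z], of u] \<open>Q *v u = cv\<close>
      by (simp add: W_def Q_def)
    ultimately show ?thesis
      using im_form_pos[OF Z \<open>u \<noteq> 0\<close>] by simp
  qed
  with Wt show ?thesis by (simp add: siegel_iff W_def)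
qed

lemma blk_mult_blocks:
  "blkA (g ** h) = blkA g ** blkA h + blkB g ** blkC h"
  "blkB (g ** h) = blkA g ** blkB h + blkB g ** blkD h"
  "blkC (g ** h) = blkC g ** blkA h + blkD g ** blkC h"
  "blkD (g ** h) = blkC g ** blkB h + blkD g ** blkD h"
proof -
  have "g ** h = blk (blkA g) (blkB g) (blkC g) (blkD g) ** blk (blkA h) (blkB h) (blkC h) (blkD h)"
    by (simp only: blk_eta)
  then show "blkA (g ** h) = blkA g ** blkA h + blkB g ** blkC h"
    "blkB (g ** h) = blkA g ** blkB h + blkB g ** blkD h"
    "blkC (g ** h) = blkC g ** blkA h + blkD g ** blkC h"
    "blkD (g ** h) = blkC g ** blkB h + blkD g ** blkD h"
    by (simp_all add: blk_mult)
qed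

lemma invertible_mult:
  fixes A B :: "'a::field^'n^'n"
  assumes "invertible A" "invertible B"
  shows "invertible (A ** B)"
proof -
  have "(matrix_inv B ** matrix_inv A) ** (A ** B) = matrix_inv B ** (matrix_inv A ** A) ** B"
    by (simp only: matrix_mul_assoc)
  then have "(matrix_inv B ** matrix_inv A) ** (A ** B) = mat 1"
    by (simp add: mult_matrix_inv assms)
  then show ?thesis
    by (metis invertible_def matrix_left_right_inverse)
qed

text \<open>Numerator and denominator of \<open>g ** h\<close> at Z are those of \<open>g\<close> at
  hZ, each multiplied on the right by the denominator of \<open>h\<close>, which then
  cancels.\<close>

lemma sp_act_mult:
  assumes g: "g \<in> Sp4R" and h: "h \<in> Sp4R" and Z: "Z \<in> siegel"
  shows "sp_act (g ** h) Z = sp_act g (sp_act h Z)"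
proof (rule sp_act_eqI)
  have hZ: "sp_act h Z \<in> siegel" by (rule sp_act_siegel[OF h Z])
  have *: "cmat (blkA h) ** Z = sp_act h Z ** sp_den h Z - cmat (blkB h)"
    using sp_num_eq[OF h Z] by (simp add: sp_num_def algebra_simps)
  have **: "cmat (blkC h) ** Z = sp_den h Z - cmat (blkD h)"
    by (simp add: sp_den_def)
  show "sp_den (g ** h) Z = sp_den g (sp_act h Z) ** sp_den h Z"
    unfolding sp_den_def[of "g ** h"] sp_den_def[of g]
    by (simp add: blk_mult_blocks cmat_simps mat_ring_simps * ** flip: matrix_mul_assoc)
  have "sp_num (g ** h) Z = sp_num g (sp_act h Z) ** sp_den h Z"
    unfolding sp_num_def
    by (simp add: blk_mult_blocks cmat_simps mat_ring_simps * ** flip: matrix_mul_assoc)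
  then show "sp_num (g ** h) Z = sp_act g (sp_act h Z) ** (sp_den g (sp_act h Z) ** sp_den h Z)"
    by (simp add: sp_num_eq[OF g hZ] matrix_mul_assoc)
  show "invertible (sp_den g (sp_act h Z) ** sp_den h Z)"
    by (intro invertible_mult sp_den_invertible g h Z hZ)
qed

lemma sp_act_one: "sp_act (mat 1) Z = Z"
proof -
  have "blkA (mat 1) = mat 1" "blkB (mat 1) = 0" "blkC (mat 1) = 0" "blkD (mat 1) = mat 1"
    by (metis blk_blocks mat_eq_blk)+
  moreover have "cmat 0 = 0" by (simp add: cmat_def vec_eq_iff)
  ultimately show ?thesis
    by (intro sp_act_eqI[of _ _ _ "mat 1"])
       (simp_all add: sp_num_def sp_den_def cmat_simps matrix_zero_left invertible_def)
qed

subsection \<open>Stabilizers and the involution\<close>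

lemma im_mat_invertible:
  assumes "Z \<in> siegel"
  shows "invertible (im_mat Z)"
proof -
  have "v = 0" if "im_mat Z *v v = 0" for v
    using assms that by (auto simp: siegel_iff)
  then show ?thesis
    by (metis invertible_left_inverse matrix_left_invertible_ker)
qed

text \<open>The imaginary part of R Z + S is R Im Z, so inverting Im Z bounds R, and the real part
  then bounds S. This recovers the blocks of a symplectic matrix from its numerator and
  denominator.\<close>

lemma real_pair_bounded:
  assumes Z: "Z \<in> siegel"
  shows "\<exists>B. \<forall>R S. (\<forall>i j. norm ((cmat R ** Z + cmat S) $ i $ j) \<le> L) \<longrightarrow>
    (\<forall>i j. \<bar>R $ i $ j\<bar> \<le> B \<and> \<bar>S $ i $ j\<bar> \<le> B)"
proof -
  define Yi where "Yi = matrix_inv (im_mat Z)"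
  define a where "a = (\<Sum>i\<in>UNIV. \<Sum>j\<in>UNIV. \<bar>Yi $ i $ j\<bar>)"
  define b where "b = (\<Sum>i\<in>UNIV. \<Sum>j\<in>UNIV. norm (Z $ i $ j))"
  have bds: "\<bar>R $ i $ j\<bar> \<le> L * a + (L + L * a * b) \<and> \<bar>S $ i $ j\<bar> \<le> L * a + (L + L * a * b)"
    if le: "\<And>i j. norm ((cmat R ** Z + cmat S) $ i $ j) \<le> L" for R S i j
  proof -
    have L0: "0 \<le> L" using le[of 1 1] norm_ge_zero order_trans by blast
    have nn: "0 \<le> a" "0 \<le> b" unfolding a_def b_def by (simp_all add: sum_nonneg)
    have Rbound: "\<bar>R $ i $ j\<bar> \<le> L * a" for i j
    proof -
      have RY: "\<bar>(R ** im_mat Z) $ k $ l\<bar> \<le> L" for k l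
      proof -
        have "(R ** im_mat Z) $ k $ l = Im ((cmat R ** Z + cmat S) $ k $ l)"
          by (simp add: matrix22_mult_component cmat_def im_mat_def)
        then show ?thesis
          using le[of k l] abs_Im_le_cmod order_trans by metis
      qed
      have "R = R ** im_mat Z ** Yi"
        by (simp add: Yi_def mult_matrix_inv(1)[OF im_mat_invertible[OF Z]] flip: matrix_mul_assoc)
      then have "\<bar>R $ i $ j\<bar> = \<bar>(R ** im_mat Z) $ i $ 1 * Yi $ 1 $ j + (R ** im_mat Z) $ i $ 2 * Yi $ 2 $ j\<bar>"
        by (metis matrix22_mult_component)
      also have "\<dots> \<le> L * \<bar>Yi $ 1 $ j\<bar> + L * \<bar>Yi $ 2 $ j\<bar>"
        by (rule order_trans[OF abs_triangle_ineq]) (intro add_mono, simp_all add: abs_mult mult_right_mono RY)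
      also have "\<dots> = L * (\<bar>Yi $ 1 $ j\<bar> + \<bar>Yi $ 2 $ j\<bar>)"
        by (simp add: algebra_simps)
      also have "\<dots> \<le> L * a"
        using exhaust_2[of j] by (intro mult_left_mono L0) (auto simp: a_def sum_2)
      finally show ?thesis .
    qed
    have "S $ i $ j = Re ((cmat R ** Z + cmat S) $ i $ j) - (R $ i $ 1 * Re (Z $ 1 $ j) + R $ i $ 2 * Re (Z $ 2 $ j))"
      by (simp add: matrix22_mult_component cmat_def)
    moreover have "\<bar>Re ((cmat R ** Z + cmat S) $ i $ j)\<bar> \<le> L"
      using le[of i j] abs_Re_le_cmod order_trans by metis
    moreover have "\<bar>R $ i $ k * Re (Z $ k $ j)\<bar> \<le> L * a * norm (Z $ k $ j)" for k
      unfolding abs_mult using L0 nn by (intro mult_mono Rbound abs_Re_le_cmod) auto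
    ultimately have "\<bar>S $ i $ j\<bar> \<le> L + L * a * (norm (Z $ 1 $ j) + norm (Z $ 2 $ j))"
      using abs_triangle_ineq4 abs_triangle_ineq unfolding distrib_left by (smt (verit))
    also have "\<dots> \<le> L + L * a * b"
      using exhaust_2[of j] L0 nn by (intro add_left_mono mult_left_mono) (auto simp: b_def sum_2)
    finally have "\<bar>S $ i $ j\<bar> \<le> L + L * a * b" .
    moreover have "0 \<le> L + L * a * b" "0 \<le> L * a" using L0 nn by simp_all
    ultimately show ?thesis using Rbound[of i j] by linarith
  qed
  show ?thesis using bds by blast
qed

text \<open>If gZ = Z, the denominator preserves the positive definite form
  \<open>im_form Z\<close>, hence is bounded. The numerator is Z times the denominator, hence
  bounded too, and \<open>real_pair_bounded\<close> applies to both.\<close>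

lemma stabilizer_bounded:
  assumes Z: "Z \<in> siegel"
  shows "\<exists>B. \<forall>g\<in>Sp4R. sp_act g Z = Z \<longrightarrow> (\<forall>i j. \<bar>g $ i $ j\<bar> \<le> B)"
proof -
  obtain c where c: "c > 0" "\<And>u. im_form Z u \<ge> c * (norm u)\<^sup>2"
    using im_form_lower_bound[OF Z] by blast
  \<comment> \<open>The summand 1 gives K \<le> K^2, so a bound K for a squared norm is also a bound
    for the norm.\<close>
  define K where "K = 1 + (im_form Z (axis 1 1) + im_form Z (axis 2 1)) / c"
  \<comment> \<open>The summand 1 makes z * K a common bound for numerators and
    denominators.\<close>
  define z where "z = 1 + (\<Sum>i\<in>UNIV. \<Sum>j\<in>UNIV. norm (Z $ i $ j))"
  have z1: "z \<ge> 1" unfolding z_def by (simp add: sum_nonneg)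
  have f0: "im_form Z u \<ge> 0" for u
    using c(2)[of u] c(1) by (smt (verit) mult_nonneg_nonneg zero_le_power2)
  have K1: "K \<ge> 1" unfolding K_def using f0 c(1) by simp
  have den: "norm (sp_den g Z $ i $ j) \<le> K" if g: "g \<in> Sp4R" "sp_act g Z = Z" for g i j
  proof -
    have "c * (norm (sp_den g Z *v axis j 1))\<^sup>2 \<le> im_form Z (axis j 1)"
      using c(2)[of "sp_den g Z *v axis j 1"]
        im_form_congruence[OF sp_act_congruence[OF g(1) Z], unfolded g(2)] by simp
    then have "(norm (sp_den g Z *v axis j 1))\<^sup>2 \<le> im_form Z (axis j 1) / c"
      using c(1) by (simp add: field_simps)
    also have "\<dots> \<le> K"
      using exhaust_2[of j] f0 c(1) by (auto simp: K_def add_divide_distrib add_nonneg_nonneg)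
    also have "\<dots> \<le> K\<^sup>2" using K1 by (simp add: power2_eq_square)
    finally have "norm (sp_den g Z *v axis j 1) \<le> K"
      by (rule power2_le_imp_le) (use K1 in simp)
    moreover have "sp_den g Z $ i $ j = (sp_den g Z *v axis j 1) $ i"
      using exhaust_2[of j] by (auto simp: matrix_vector_mult_def sum_2 axis_def)
    ultimately show ?thesis
      using Finite_Cartesian_Product.norm_nth_le[of "sp_den g Z *v axis j 1" i] by simp
  qed
  have num: "norm (sp_num g Z $ i $ j) \<le> z * K" if g: "g \<in> Sp4R" "sp_act g Z = Z" for g i j
  proof -
    have "norm (sp_num g Z $ i $ j) \<le> norm (Z $ i $ 1) * K + norm (Z $ i $ 2) * K"
      unfolding sp_num_eq[OF g(1) Z] g(2) matrix22_mult_component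
      by (rule order_trans[OF norm_triangle_ineq])
         (intro add_mono, simp_all add: norm_mult mult_left_mono den[OF g])
    also have "\<dots> = (norm (Z $ i $ 1) + norm (Z $ i $ 2)) * K" by (simp add: algebra_simps)
    also have "\<dots> \<le> z * K"
      using exhaust_2[of i] K1 by (intro mult_right_mono) (auto simp: z_def sum_2)
    finally show ?thesis .
  qed
  have den': "norm (sp_den g Z $ i $ j) \<le> z * K" if g: "g \<in> Sp4R" "sp_act g Z = Z" for g i j
    using order_trans[OF den[OF g, of i j], of "z * K"] mult_right_mono[OF z1, of K] K1 by simp
  obtain B where B: "\<And>R S i j. (\<And>i j. norm ((cmat R ** Z + cmat S) $ i $ j) \<le> z * K) \<Longrightarrow>
      \<bar>R $ i $ j\<bar> \<le> B \<and> \<bar>S $ i $ j\<bar> \<le> B"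
    using real_pair_bounded[OF Z, of "z * K"] by blast
  have "\<bar>g $ i $ j\<bar> \<le> B" if g: "g \<in> Sp4R" "sp_act g Z = Z" for g i j
  proof -
    have *: "\<bar>blkA g $ k $ l\<bar> \<le> B \<and> \<bar>blkB g $ k $ l\<bar> \<le> B"
      "\<bar>blkC g $ k $ l\<bar> \<le> B \<and> \<bar>blkD g $ k $ l\<bar> \<le> B" for k l
      using B num[OF g] den'[OF g] unfolding sp_num_def sp_den_def by blast+
    obtain A' B' C' D' where g: "g = blk A' B' C' D'" by (rule blk_cases)
    show ?thesis using * unfolding g by (cases i; cases j) auto
  qed
  then show ?thesis by blast
qed

lemma GammaSp_free:
  assumes N: "N \<ge> 3" and g: "g \<in> GammaSp N" and Z: "Z \<in> siegel" and fixed: "sp_act g Z = Z"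
  shows "g = mat 1"
proof -
  obtain Y where Y: "Y \<in> int_mats" "g = mat 1 + real N *\<^sub>R Y" and gR: "g \<in> Sp4R"
    using g by (auto simp: GammaSp_iff)
  obtain B where B: "\<And>h i j. h \<in> Sp4R \<Longrightarrow> sp_act h Z = Z \<Longrightarrow> \<bar>h $ i $ j\<bar> \<le> B"
    using stabilizer_bounded[OF Z] by blast
  have "mat_pow g k \<in> Sp4R \<and> sp_act (mat_pow g k) Z = Z" for k
  proof (induction k)
    case 0
    then show ?case by (simp add: Sp4R_one sp_act_one)
  next
    case (Suc k)
    then show ?case
      by (simp add: mat_pow_Suc Sp4R_mult gR sp_act_mult[OF gR _ Z] fixed)
  qed
  with B have "\<bar>mat_pow g k $ i $ j\<bar> \<le> B" for k i j by blast
  then show ?thesis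
    using minkowski_congruence[OF N _ Y(2)] Y(1) by (auto simp: int_mats_def)
qed

section \<open>The involution on matrices and the groups attached to it\<close>

lemma transpose_beta_square: "transpose (beta d) ** transpose (beta d) = of_int d *\<^sub>R mat 1"
  by (simp add: beta_square transpose_scalar flip: matrix_transpose_mul)

lemma matrix_inv_Nbeta:
  assumes "d \<noteq> 0"
  shows "matrix_inv (Nbeta d) = (1 / of_int d) *\<^sub>R Nbeta d"
  by (rule matrix_inv_eqI) (simp add: assms Nbeta_square matrix_scaleR_left)

lemma hat_eq:
  assumes "d \<noteq> 0"
  shows "hat d g = (1 / of_int d) *\<^sub>R (Nbeta d ** g ** Nbeta d)"
  by (simp add: hat_def matrix_inv_Nbeta[OF assms] matrix_scalar_ac scalar_matrix_assoc)

lemma Nbeta_Nbeta: "Nbeta d ** (Nbeta d ** X) = of_int d *\<^sub>R X"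
  by (simp add: matrix_mul_assoc Nbeta_square matrix_scaleR_left)

context
  fixes d :: int
  assumes d: "d \<noteq> 0"
begin

lemma hat_one: "hat d (mat 1) = mat 1"
  by (simp add: hat_eq[OF d] Nbeta_square d)

lemma hat_hat: "hat d (hat d g) = g"
  by (simp add: hat_eq[OF d] d mat_ring_simps Nbeta_Nbeta Nbeta_square flip: matrix_mul_assoc)

lemma hat_mult: "hat d (g ** h) = hat d g ** hat d h"
  by (simp add: hat_eq[OF d] d mat_ring_simps Nbeta_Nbeta flip: matrix_mul_assoc)

lemma hat_add: "hat d (g + h) = hat d g + hat d h"
  by (simp add: hat_eq[OF d] mat_ring_simps algebra_simps)

lemma hat_scaleR: "hat d (c *\<^sub>R g) = c *\<^sub>R hat d g"
  by (simp add: hat_eq[OF d] mat_ring_simps)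

lemma hat_blk: "hat d (blk A B C D) = blk
    ((1 / of_int d) *\<^sub>R (beta d ** A ** beta d)) ((1 / of_int d) *\<^sub>R (beta d ** B ** transpose (beta d)))
    ((1 / of_int d) *\<^sub>R (transpose (beta d) ** C ** beta d))
    ((1 / of_int d) *\<^sub>R (transpose (beta d) ** D ** transpose (beta d)))"
  by (simp add: hat_eq[OF d] Nbeta_def blk_mult blk_scaleR matrix_zero_left matrix_zero_right)

end

text \<open>\<open>Nbeta d\<close> is a symplectic similitude with multiplier \<open>d\<close>. The
  two multipliers arising in \<open>hat d g\<close> cancel against the square of 1/d, so
  \<open>hat d\<close> preserves \<open>Sp4R\<close>.\<close>

lemma Nbeta_symplectic: "transpose (Nbeta d) ** Jm ** Nbeta d = of_int d *\<^sub>R Jm"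
  unfolding Nbeta_def Jm_def transpose_blk blk_mult blk_scaleR
  by (simp add: mat_ring_simps beta_square transpose_beta_square)

lemma hat_Sp4R:
  assumes d: "d \<noteq> 0" and g: "g \<in> Sp4R"
  shows "hat d g \<in> Sp4R"
proof -
  have "transpose (Nbeta d ** g ** Nbeta d) ** Jm ** (Nbeta d ** g ** Nbeta d)
      = transpose (Nbeta d) ** (transpose g ** (transpose (Nbeta d) ** Jm ** Nbeta d) ** g) ** Nbeta d"
    by (simp add: matrix_transpose_mul matrix_mul_assoc)
  also have "\<dots> = (of_int d * of_int d) *\<^sub>R Jm"
    using g by (simp add: Nbeta_symplectic mat_ring_simps Sp4R_iff)
  finally show ?thesis
    using d by (simp add: Sp4R_iff hat_eq mat_ring_simps)
qed

lemma hat_inv: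
  assumes "d \<noteq> 0" "g \<in> Sp4R"
  shows "matrix_inv (hat d g) = hat d (matrix_inv g)"
  by (rule matrix_inv_eqI) (simp add: assms Sp4R_inv(2) hat_one flip: hat_mult)

lemma int_mats_Nbeta: "Nbeta d \<in> int_mats"
  by (simp add: int_mats_def Nbeta_def beta_def forall_sum22 forall_2)

lemma Gamma_N_iff:
  assumes "d \<noteq> 0"
  shows "g \<in> Gamma_N d N \<longleftrightarrow> g \<in> GammaSp N \<and> hat d g \<in> GammaSp N"
  unfolding Gamma_N_def using hat_hat[OF assms] by (auto simp: image_iff) metis

context
  fixes d :: int and N :: nat
  assumes d: "d \<noteq> 0"
begin

lemma Gamma_N_one: "mat 1 \<in> Gamma_N d N"
  by (simp add: Gamma_N_iff d hat_one GammaSp_one)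

lemma Gamma_N_mult: "g \<in> Gamma_N d N \<Longrightarrow> h \<in> Gamma_N d N \<Longrightarrow> g ** h \<in> Gamma_N d N"
  by (simp add: Gamma_N_iff d hat_mult GammaSp_mult)

lemma Gamma_N_Sp4Z: "g \<in> Gamma_N d N \<Longrightarrow> g \<in> Sp4Z"
  using GammaSp_subset by (auto simp: Gamma_N_iff d)

lemma Gamma_N_Sp4R: "g \<in> Gamma_N d N \<Longrightarrow> g \<in> Sp4R"
  using Gamma_N_Sp4Z by (simp add: Sp4Z_iff)

lemma Gamma_N_inv: "g \<in> Gamma_N d N \<Longrightarrow> matrix_inv g \<in> Gamma_N d N"
  using Gamma_N_Sp4R by (auto simp: Gamma_N_iff d GammaSp_inv simp flip: hat_inv)

lemma Gamma_N_hat: "g \<in> Gamma_N d N \<Longrightarrow> hat d g \<in> Gamma_N d N"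
  by (simp add: Gamma_N_iff d hat_hat)

lemma Gamma_N_free: "N \<ge> 3 \<Longrightarrow> g \<in> Gamma_N d N \<Longrightarrow> Z \<in> siegel \<Longrightarrow> sp_act g Z = Z \<Longrightarrow> g = mat 1"
  using GammaSp_free by (simp add: Gamma_N_iff d)

text \<open>Conjugation by \<open>Nbeta d\<close> introduces only the denominator \<open>d\<close>,
  which the extra factor in the level clears. Finiteness of the double cosets is deduced from this
  inclusion.\<close>

lemma GammaSp_subset_Gamma_N: "GammaSp (N * nat \<bar>d\<bar>) \<subseteq> Gamma_N d N"
proof
  fix g assume g: "g \<in> GammaSp (N * nat \<bar>d\<bar>)"
  then obtain Y where Y: "Y \<in> int_mats" "g = mat 1 + (real N * \<bar>of_int d\<bar>) *\<^sub>R Y" and gR: "g \<in> Sp4R"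
    by (auto simp: GammaSp_iff)
  have "g = mat 1 + real N *\<^sub>R (\<bar>of_int d\<bar> *\<^sub>R Y)"
    using Y by simp
  then have 1: "g \<in> GammaSp N"
    using gR Y(1) unfolding GammaSp_iff by (metis Ints_abs Ints_of_int int_mats_scale)
  \<comment> \<open>The factor is the sign of \<open>d\<close>: the absolute value comes from the
    level, the denominator from \<open>hat d\<close>.\<close>
  define Y' where "Y' = (\<bar>real_of_int d\<bar> / of_int d) *\<^sub>R (Nbeta d ** Y ** Nbeta d)"
  have "\<bar>real_of_int d\<bar> / of_int d = sgn (of_int d)"
    using d by (simp add: sgn_if)
  then have "Y' \<in> int_mats"
    unfolding Y'_def by (intro int_mats_scale int_mats_mult int_mats_Nbeta Y(1)) (auto simp: sgn_if)
  moreover have "hat d g = mat 1 + real N *\<^sub>R Y'"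
    unfolding Y(2) Y'_def by (simp add: d hat_add hat_scaleR hat_one) (simp add: hat_eq d)
  ultimately have "hat d g \<in> GammaSp N"
    using hat_Sp4R[OF d gR] unfolding GammaSp_iff by blast
  with 1 show "g \<in> Gamma_N d N" by (simp add: Gamma_N_iff d)
qed

text \<open>With k = hat(g) g^-1 in \<open>Gamma_N\<close>, the involution sends g h g^-1 to k (g
  hat(h) g^-1) k^-1, and \<open>Sp4Z\<close> normalizes \<open>GammaSp N\<close>.\<close>

lemma GammaTilde_normalizes:
  assumes g: "g \<in> GammaTilde d N" and h: "h \<in> Gamma_N d N"
  shows "g ** h ** matrix_inv g \<in> Gamma_N d N"
proof -
  have gZ: "g \<in> Sp4Z" and gR: "g \<in> Sp4R" and k: "hat d g ** matrix_inv g \<in> Gamma_N d N"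
    using g by (auto simp: GammaTilde_def Sp4Z_iff)
  define k where "k = hat d g ** matrix_inv g"
  have kR: "k \<in> Sp4R" using k Gamma_N_Sp4R k_def by blast
  have hg: "hat d g = k ** g"
    by (simp add: k_def Sp4R_inv(2)[OF gR] flip: matrix_mul_assoc)
  have hi: "hat d (matrix_inv g) = matrix_inv g ** matrix_inv k"
    using hat_inv[OF d gR] by (simp add: hg Sp4R_inv_mult[OF kR gR])
  have "hat d (g ** h ** matrix_inv g) = k ** (g ** hat d h ** matrix_inv g) ** matrix_inv k"
    by (simp add: hat_mult d hg hi matrix_mul_assoc)
  moreover have "g ** hat d h ** matrix_inv g \<in> GammaSp N" "g ** h ** matrix_inv g \<in> GammaSp N"
    using GammaSp_conj[OF gZ] h by (simp_all add: Gamma_N_iff d)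
  moreover have "k \<in> GammaSp N" using k by (simp add: Gamma_N_iff d k_def)
  ultimately show ?thesis
    by (simp add: Gamma_N_iff d GammaSp_mult GammaSp_inv)
qed

lemma GammaTilde_Sp4Z: "g \<in> GammaTilde d N \<Longrightarrow> g \<in> Sp4Z"
  by (simp add: GammaTilde_def)

lemma GammaTilde_Sp4R: "g \<in> GammaTilde d N \<Longrightarrow> g \<in> Sp4R"
  by (simp add: GammaTilde_def Sp4Z_iff)

text \<open>Proved directly, because closure of \<open>GammaTilde\<close> under inverses is itself
  derived from it.\<close>

lemma GammaTilde_normalizes':
  assumes g: "g \<in> GammaTilde d N" and h: "h \<in> Gamma_N d N"
  shows "matrix_inv g ** h ** g \<in> Gamma_N d N"
proof -
  have gZ: "g \<in> Sp4Z" and gR: "g \<in> Sp4R" and k: "hat d g ** matrix_inv g \<in> Gamma_N d N"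
    using g by (auto simp: GammaTilde_def Sp4Z_iff)
  define k where "k = hat d g ** matrix_inv g"
  have kR: "k \<in> Sp4R" using k Gamma_N_Sp4R k_def by blast
  have kG: "k \<in> GammaSp N" using k by (simp add: Gamma_N_iff d k_def)
  have hg: "hat d g = k ** g"
    by (simp add: k_def Sp4R_inv(2)[OF gR] flip: matrix_mul_assoc)
  have hi: "hat d (matrix_inv g) = matrix_inv g ** matrix_inv k"
    using hat_inv[OF d gR] by (simp add: hg Sp4R_inv_mult[OF kR gR])
  have "hat d (matrix_inv g ** h ** g) = matrix_inv g ** (matrix_inv k ** hat d h ** k) ** g"
    by (simp add: hat_mult d hg hi matrix_mul_assoc)
  moreover have "matrix_inv k ** hat d h ** k \<in> GammaSp N"
    using h kG by (simp add: Gamma_N_iff d GammaSp_mult GammaSp_inv)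
  moreover have "matrix_inv g ** x ** g \<in> GammaSp N" if "x \<in> GammaSp N" for x
    using GammaSp_conj[OF Sp4Z_inv[OF gZ] that] by (simp add: Sp4R_inv_inv gR)
  ultimately show ?thesis
    using h by (simp add: Gamma_N_iff d)
qed

lemma Gamma_N_subset_GammaTilde: "h \<in> Gamma_N d N \<Longrightarrow> h \<in> GammaTilde d N"
  by (simp add: GammaTilde_def Gamma_N_Sp4Z Gamma_N_mult Gamma_N_hat Gamma_N_inv)

lemma GammaTilde_mult:
  assumes g: "g \<in> GammaTilde d N" and h: "h \<in> GammaTilde d N"
  shows "g ** h \<in> GammaTilde d N"
proof -
  have R: "g \<in> Sp4R" "h \<in> Sp4R" using g h GammaTilde_Sp4R by auto
  define k where "k = hat d h ** matrix_inv h"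
  have "hat d g ** matrix_inv g ** (g ** k ** matrix_inv g)
      = hat d g ** (matrix_inv g ** g) ** (k ** matrix_inv g)"
    by (simp only: matrix_mul_assoc)
  then have "hat d (g ** h) ** matrix_inv (g ** h)
      = hat d g ** matrix_inv g ** (g ** k ** matrix_inv g)"
    by (simp add: Sp4R_inv(2) R k_def hat_mult d Sp4R_inv_mult matrix_mul_assoc)
  moreover have "g ** k ** matrix_inv g \<in> Gamma_N d N"
    using h by (intro GammaTilde_normalizes[OF g]) (simp add: GammaTilde_def k_def)
  ultimately show ?thesis
    using g h by (simp add: GammaTilde_def Sp4Z_mult Gamma_N_mult)
qed

lemma GammaTilde_inv:
  assumes g: "g \<in> GammaTilde d N"
  shows "matrix_inv g \<in> GammaTilde d N"
proof -
  have R: "g \<in> Sp4R" using g GammaTilde_Sp4R by auto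
  define k where "k = hat d g ** matrix_inv g"
  have k: "k \<in> Gamma_N d N" using g by (simp add: GammaTilde_def k_def)
  have hg: "hat d g = k ** g"
    by (simp add: k_def Sp4R_inv(2)[OF R] flip: matrix_mul_assoc)
  have "hat d (matrix_inv g) ** matrix_inv (matrix_inv g) = matrix_inv g ** matrix_inv k ** g"
    using hat_inv[OF d R] Gamma_N_Sp4R[OF k] by (simp add: hg Sp4R_inv_inv R Sp4R_inv_mult)
  then show ?thesis
    using GammaTilde_normalizes'[OF g Gamma_N_inv[OF k]] g
    by (simp add: GammaTilde_def Sp4Z_inv)
qed

end

subsection \<open>The ring of integers\<close>

text \<open>With x = u/v in lowest terms, v^2 divides d u^2 and hence d.\<close>

lemma squarefree_mult_square_int:
  fixes d :: int and x :: real
  assumes d: "squarefree d" and x: "x \<in> \<rat>" and int: "of_int d * x\<^sup>2 \<in> \<int>"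
  shows "x \<in> \<int>"
proof -
  obtain u v :: int where uv: "v > 0" "coprime u v" "x = of_int u / of_int v"
    using x by (rule Rats_cases')
  obtain k :: int where "of_int d * x\<^sup>2 = of_int k"
    using int by (auto elim: Ints_cases)
  then have "real_of_int (d * u\<^sup>2) = of_int (k * v\<^sup>2)"
    using uv by (simp add: power_divide field_simps)
  then have "d * u\<^sup>2 = k * v\<^sup>2"
    by (simp only: of_int_eq_iff)
  then have "v\<^sup>2 dvd d * u\<^sup>2" by simp
  moreover have "coprime (v\<^sup>2) (u\<^sup>2)"
    using uv(2) by (simp add: ac_simps)
  ultimately have "v\<^sup>2 dvd d"
    by (simp add: coprime_dvd_mult_left_iff)
  then have "is_unit v" using d by (simp add: squarefree_def)
  then have "v = 1" using uv(1) by simp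
  then show ?thesis using uv(3) by simp
qed

text \<open>\<open>A\<close> and \<open>B\<close> will be twice the coordinates of an algebraic
  integer and \<open>n\<close> its norm. As squares are 0 or 1 modulo 4, the parities are
  determined.\<close>

lemma int_norm_mod4:
  fixes A B d n :: int
  assumes d: "\<not> 4 dvd d" and eq: "A\<^sup>2 - d * B\<^sup>2 = 4 * n"
  shows "if d mod 4 = 1 then even (A + B) else even A \<and> even B"
proof -
  have sq: "\<exists>k. x\<^sup>2 = 4 * k + (if even x then 0 else 1)" for x :: int
  proof (cases "even x")
    case True
    then obtain y where "x = 2 * y" by blast
    then have "x\<^sup>2 = 4 * y\<^sup>2" by (simp add: power2_eq_square)
    with True show ?thesis by auto
  next
    case False
    then obtain y where "x = 2 * y + 1" by (blast elim: oddE)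
    then have "x\<^sup>2 = 4 * (y\<^sup>2 + y) + 1" by (simp add: power2_eq_square algebra_simps)
    with False show ?thesis by (intro exI[of _ "y\<^sup>2 + y"]) simp
  qed
  obtain a where a: "A\<^sup>2 = 4 * a + (if even A then 0 else 1)" using sq by blast
  obtain b where b: "B\<^sup>2 = 4 * b + (if even B then 0 else 1)" using sq by blast
  have *: "4 * a + (if even A then 0 else 1) - (4 * (d * b) + (if even B then 0 else d)) = 4 * n"
    using eq unfolding a b by (auto simp: algebra_simps)
  define db where "db = d * b"
  have "4 * a + (if even A then 0 else 1) - (4 * db + (if even B then 0 else d)) = 4 * n"
    using * by (simp add: db_def)
  then show ?thesis
    using d by (cases "even A"; cases "even B"; simp) presburger+
qed

lemma of_real_of_rat: "of_real (of_rat q) = (of_rat q :: 'a::{field_char_0,real_field})"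
  by (cases q) (simp add: of_rat_rat)

lemma coord_of_real:
  assumes "d < 0"
  shows "coord_a (of_real a + of_real b * csqrt (of_int d)) = a"
    "coord_b d (of_real a + of_real b * csqrt (of_int d)) = b"
  using assms by (simp_all add: coord_a_def coord_b_def)

text \<open>One direction reads integrality off the trace 2a and the norm a^2 - d b^2; the other
  exhibits the monic polynomial with these coefficients. That trace and norm are again in
  \<open>quad_ints d\<close> comes from the ring structure contained in
  \<open>principal_domain\<close>.\<close>

lemma quad_ints_coords:
  assumes d: "d < 0" and sf: "squarefree d" and pd: "principal_domain (quad_int_ring d)"
  shows "x \<in> quad_ints d \<longleftrightarrow> (if d mod 4 = 1 then coord_a x + coord_b d x \<in> \<int> \<and> 2 * coord_b d x \<in> \<int>
      else coord_a x \<in> \<int> \<and> coord_b d x \<in> \<int>)" (is "_ \<longleftrightarrow> ?R")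
proof
  define s where "s = csqrt (of_int d :: complex)"
  have s2: "s * s = of_int d"
    by (metis power2_csqrt power2_eq_square s_def)
  have s2': "s * (s * y) = of_int d * y" for y
    using s2 by (simp flip: mult.assoc)
  have cnj_s: "cnj s = - s"
    using d by (simp add: s_def)
  have d4: "\<not> 4 dvd d"
  proof
    assume "4 dvd d"
    then have "2\<^sup>2 dvd d" by simp
    then have "is_unit (2::int)" using sf by (simp only: squarefree_def)
    then show False by simp
  qed
  interpret R: ring "quad_int_ring d"
    using pd by (simp add: principal_domain_def domain_def cring_def)
  have plus: "y + z \<in> quad_ints d" and mult: "y * z \<in> quad_ints d"
    if "y \<in> quad_ints d" "z \<in> quad_ints d" for y z
    using R.a_closed[of y z] R.m_closed[of y z] that by (simp_all add: quad_int_ring_def)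
  {
    assume x: "x \<in> quad_ints d"
    then obtain a' b' where ab: "a' \<in> \<rat>" "b' \<in> \<rat>" "x = a' + b' * s"
      by (auto simp: quad_ints_def s_def)
    then obtain a b :: rat where rab: "a' = of_rat a" "b' = of_rat b" by (auto elim!: Rats_cases)
    define a1 b1 :: real where "a1 = of_rat a" and "b1 = of_rat b"
    have r: "a' = of_real a1" "b' = of_real b1"
      by (simp_all add: rab a1_def b1_def of_real_of_rat)
    have x_eq: "x = of_real a1 + of_real b1 * s"
      by (simp add: ab r)
    have cx_eq: "cnj x = of_real a1 - of_real b1 * s"
      by (simp add: x_eq cnj_s)
    have coords: "coord_a x = a1" "coord_b d x = b1"
      using coord_of_real[OF d] by (simp_all add: x_eq s_def)
    have "cnj x = a' + (- b') * s"
      by (simp add: cx_eq r)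
    then have cx: "cnj x \<in> quad_ints d"
    proof -
      have "algebraic_int (cnj x)"
        using x by (simp add: quad_ints_def del: complex_cnj_add)
      moreover have "- b' \<in> \<rat>" using ab(2) by simp
      ultimately show ?thesis
        using ab(1) \<open>cnj x = a' + (- b') * s\<close> unfolding quad_ints_def s_def by blast
    qed
    have int: "y \<in> \<int>" if "complex_of_real y \<in> quad_ints d" "y \<in> \<rat>" for y
      using that rational_algebraic_int_is_int[of y] by (simp add: quad_ints_def algebraic_int_of_real_iff)
    have "x + cnj x = of_real (2 * a1)" "x * cnj x = of_real (a1\<^sup>2 - of_int d * b1\<^sup>2)"
      unfolding cx_eq unfolding x_eq by (simp_all add: algebra_simps power2_eq_square s2 s2')
    moreover have "2 * a1 \<in> \<rat>" "a1\<^sup>2 - of_int d * b1\<^sup>2 \<in> \<rat>"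
      by (simp_all add: a1_def b1_def)
    ultimately have i: "2 * a1 \<in> \<int>" "a1\<^sup>2 - of_int d * b1\<^sup>2 \<in> \<int>"
      using plus[OF x cx] mult[OF x cx] int by metis+
    obtain A where A: "2 * a1 = of_int A" using i(1) by (auto elim: Ints_cases)
    obtain n where n: "a1\<^sup>2 - of_int d * b1\<^sup>2 = of_int n" using i(2) by (auto elim: Ints_cases)
    have e: "of_int d * (2 * b1)\<^sup>2 = of_int (A\<^sup>2 - 4 * n)"
      using n by (simp add: A[symmetric] power_mult_distrib)
    then have "of_int d * (2 * b1)\<^sup>2 \<in> \<int>" by simp
    moreover have "2 * b1 \<in> \<rat>" by (simp add: b1_def)
    ultimately have "2 * b1 \<in> \<int>" using squarefree_mult_square_int[OF sf] by blast
    then obtain B where B: "2 * b1 = of_int B" by (auto elim: Ints_cases)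
    have "real_of_int (d * B\<^sup>2) = of_int (A\<^sup>2 - 4 * n)" using e unfolding B by simp
    then have "d * B\<^sup>2 = A\<^sup>2 - 4 * n" by (simp only: of_int_eq_iff)
    then have par: "if d mod 4 = 1 then even (A + B) else even A \<and> even B"
      using int_norm_mod4[OF d4, of A B n] by simp
    show ?R
    proof (cases "d mod 4 = 1")
      case True
      with par obtain k where "A + B = 2 * k" by (meson evenE)
      then have "2 * a1 + 2 * b1 = 2 * of_int k" unfolding A B by (metis of_int_add of_int_mult of_int_numeral)
      then have "a1 + b1 = of_int k" by simp
      then show ?thesis using True B by (simp add: coords)
    next
      case False
      with par obtain k l where "A = 2 * k" "B = 2 * l" by (meson evenE)
      then have "a1 = of_int k" "b1 = of_int l" using A B by simp_all
      then show ?thesis using False by (simp add: coords)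
    qed
  next
    assume R: ?R
    define a b where "a = coord_a x" and "b = coord_b d x"
    have x_eq: "x = of_real a + of_real b * s"
      unfolding a_def b_def s_def by (rule coord_decomp[OF d])
    have main: "2 * a \<in> \<int> \<and> a\<^sup>2 - of_int d * b\<^sup>2 \<in> \<int> \<and> a \<in> \<rat> \<and> b \<in> \<rat>"
    proof (cases "d mod 4 = 1")
      case True
      then obtain k l where kl: "a + b = of_int k" "2 * b = of_int l"
        using R by (auto simp: a_def b_def elim!: Ints_cases)
      define m where "m = (d - 1) div 4"
      have dm: "real_of_int d = 1 + 4 * of_int m"
      proof -
        have "d = 1 + 4 * m" using True unfolding m_def by presburger
        then show ?thesis by simp
      qed
      have b: "b = of_int l / 2" and a: "a = of_int k - of_int l / 2" using kl by simp_all
      have "a\<^sup>2 - of_int d * b\<^sup>2 = of_int (k\<^sup>2 - k * l - m * l\<^sup>2)"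
        unfolding a b dm by (simp add: power2_eq_square field_simps)
      moreover have "2 * a = of_int (2 * k - l)" by (simp add: a)
      ultimately show ?thesis unfolding a b by (metis Ints_of_int Rats_diff Rats_divide Rats_number_of Rats_of_int)
    next
      case False
      then show ?thesis using R by (auto simp: a_def b_def elim!: Ints_cases)
    qed
    have ring_eq: "x\<^sup>2 - 2 * of_real a * x + of_real (a\<^sup>2 - of_int d * b\<^sup>2) = 0"
      by (simp add: x_eq power2_eq_square algebra_simps s2 s2')
    have "algebraic_int x"
    proof (rule algebraic_int.intros)
      let ?p = "[:of_real (a\<^sup>2 - of_int d * b\<^sup>2), - of_real (2 * a), 1:] :: complex poly"
      show "lead_coeff ?p = 1" by simp
      have "of_real (a\<^sup>2 - of_int d * b\<^sup>2) \<in> (\<int> :: complex set)" "of_real (2 * a) \<in> (\<int> :: complex set)"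
        using main by (metis Ints_cases Ints_of_int of_real_of_int_eq)+
      then show "\<forall>i. Polynomial.coeff ?p i \<in> \<int>"
        by (auto simp: coeff_pCons split: nat.split)
      show "poly ?p x = 0"
        using ring_eq by (simp add: power2_eq_square algebra_simps)
    qed
    moreover have "of_real a \<in> (\<rat> :: complex set)" "of_real b \<in> (\<rat> :: complex set)"
      using main by (metis Rats_cases Rats_of_rat of_real_of_rat)+
    ultimately show "x \<in> quad_ints d"
      using x_eq by (auto simp: quad_ints_def s_def)
  }
qed

subsection \<open>The embeddings and the fixed subgroup\<close>

lemma cmat_beta_square: "cmat (beta d) ** cmat (beta d) = of_int d *\<^sub>R mat 1"
  "transpose (cmat (beta d)) ** transpose (cmat (beta d)) = of_int d *\<^sub>R mat 1"
  by (simp_all add: beta_square transpose_beta_square flip: cmat_simps)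

lemma cmat_beta_beta:
  "cmat (beta d) ** (cmat (beta d) ** X) = of_int d *\<^sub>R X"
  "transpose (cmat (beta d)) ** (transpose (cmat (beta d)) ** X) = of_int d *\<^sub>R X"
  by (simp_all add: matrix_mul_assoc cmat_beta_square matrix_scaleR_left)

lemma hatZ_eq:
  assumes "d \<noteq> 0"
  shows "hatZ d Z = (1 / of_int d) *\<^sub>R (cmat (beta d) ** conj_mat Z ** transpose (cmat (beta d)))"
proof -
  have "matrix_inv (transpose (beta d)) = (1 / of_int d) *\<^sub>R transpose (beta d)"
    by (rule matrix_inv_eqI) (simp add: assms transpose_beta_square matrix_scaleR_left)
  then show ?thesis
    by (simp add: hatZ_def cmat_simps matrix_scalar_ac scalar_matrix_assoc)
qed

lemma hatZ_siegel:
  assumes d: "d < 0" and Z: "Z \<in> siegel"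
  shows "hatZ d Z \<in> siegel"
proof -
  have Zt: "transpose Z = Z" using Z by (simp add: siegel_iff)
  have im: "im_mat (hatZ d Z) = (- 1 / of_int d) *\<^sub>R (beta d ** im_mat Z ** transpose (beta d))"
    using d by (simp add: hatZ_eq im_mat_def cmat_def conj_mat_def vec_eq_iff matrix_matrix_mult_def sum_2
      transpose_def field_simps)
  have "v \<bullet> (im_mat (hatZ d Z) *v v) > 0" if "v \<noteq> 0" for v
  proof -
    define w where "w = transpose (beta d) *v v"
    have "transpose (beta d) *v w = of_int d *\<^sub>R v"
      unfolding w_def matrix_vector_mul_assoc transpose_beta_square
      by (simp add: scaleR_matrix_vector_assoc[symmetric])
    then have "w \<noteq> 0" using that d by auto
    then have pos: "w \<bullet> (im_mat Z *v w) > 0" using Z by (simp add: siegel_iff)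
    have "v \<bullet> (im_mat (hatZ d Z) *v v) = (- 1 / of_int d) * (w \<bullet> (im_mat Z *v w))"
      unfolding im w_def scaleR_matrix_vector_assoc[symmetric] inner_scaleR_right
        matrix_vector_mul_assoc[symmetric] dot_lmul_matrix[symmetric] transpose_matrix_vector ..
    then show ?thesis using pos d by (simp add: divide_pos_neg)
  qed
  moreover have "transpose (hatZ d Z) = hatZ d Z"
    using d by (simp add: hatZ_eq transpose_scalar matrix_transpose_mul Zt matrix_mul_assoc flip: conj_mat_simps(4))
  ultimately show ?thesis by (simp add: siegel_iff)
qed

lemma hatZ_hatZ:
  assumes "d \<noteq> 0"
  shows "hatZ d (hatZ d Z) = Z"
  by (simp add: assms hatZ_eq conj_mat_simps mat_ring_simps cmat_beta_beta cmat_beta_square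
      flip: matrix_mul_assoc cmat_simps(4))
     (simp add: assms cmat_simps mat_ring_simps cmat_beta_beta cmat_beta_square flip: matrix_mul_assoc)

lemma hatZ_sp_act:
  assumes d: "d < 0" and g: "g \<in> Sp4R" and Z: "Z \<in> siegel"
  shows "hatZ d (sp_act g Z) = sp_act (hat d g) (hatZ d Z)"
proof (rule sp_act_eqI[symmetric])
  have d0: "d \<noteq> 0" using d by simp
  let ?b = "cmat (beta d)"
  obtain A B C D where gb: "g = blk A B C D" by (rule blk_cases)
  have den: "sp_den (hat d g) (hatZ d Z) = (1 / of_int d) *\<^sub>R (transpose ?b ** conj_mat (sp_den g Z) ** transpose ?b)"
    by (simp add: gb hat_blk[OF d0] sp_den_def hatZ_eq[OF d0] cmat_simps conj_mat_simps mat_ring_simps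
        cmat_beta_beta d0 scaleR_add_right flip: matrix_mul_assoc)
  have num: "sp_num (hat d g) (hatZ d Z) = (1 / of_int d) *\<^sub>R (?b ** conj_mat (sp_num g Z) ** transpose ?b)"
    by (simp add: gb hat_blk[OF d0] sp_num_def hatZ_eq[OF d0] cmat_simps conj_mat_simps mat_ring_simps
        cmat_beta_beta d0 scaleR_add_right flip: matrix_mul_assoc)
  show "sp_num (hat d g) (hatZ d Z) = hatZ d (sp_act g Z) ** sp_den (hat d g) (hatZ d Z)"
    unfolding num den sp_num_eq[OF g Z]
    by (simp add: hatZ_eq[OF d0] conj_mat_simps mat_ring_simps cmat_beta_beta d0 flip: matrix_mul_assoc)
  show "sp_den (hat d g) (hatZ d Z) = sp_den (hat d g) (hatZ d Z)" ..
  show "invertible (sp_den (hat d g) (hatZ d Z))"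
    by (intro sp_den_invertible hat_Sp4R hatZ_siegel d0 d g Z)
qed

text \<open>
  Conjugation by \<open>sigma d\<close> (on \<open>mat4\<close>: by \<open>Mmat d\<close>) turns \<open>beta d\<close> into \<open>beta0 d\<close>, so that the case
  \<open>d mod 4 = 1\<close> is reduced to the other one.
\<close>

definition beta0 :: "int \<Rightarrow> real^2^2" where
  "beta0 d = mat22 0 1 (of_int d) 0"

definition sigma_inv :: "int \<Rightarrow> real^2^2" where
  "sigma_inv d = (if d mod 4 = 1 then mat22 (1/2) 0 (1/2) 1 else mat 1)"

text \<open>For \<open>d mod 4 = 1\<close> this is twice the transposed inverse of
  \<open>sigma d\<close>, the lower block of \<open>Mmat d\<close>.\<close>

definition tau :: "int \<Rightarrow> real^2^2" where
  "tau d = (if d mod 4 = 1 then mat22 1 1 0 2 else mat 1)"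

definition tau_inv :: "int \<Rightarrow> real^2^2" where
  "tau_inv d = (if d mod 4 = 1 then mat22 1 (- 1/2) 0 (1/2) else mat 1)"

lemma sigma_inverse: "sigma d ** sigma_inv d = mat 1" "sigma_inv d ** sigma d = mat 1"
  "tau d ** tau_inv d = mat 1" "tau_inv d ** tau d = mat 1"
  by (auto simp: sigma_def sigma_inv_def tau_def tau_inv_def mat22_simps)

lemma sigma_inverse_assoc: "sigma d ** (sigma_inv d ** X) = X" "sigma_inv d ** (sigma d ** X) = X"
  "tau d ** (tau_inv d ** X) = X" "tau_inv d ** (tau d ** X) = X"
  by (simp_all add: matrix_mul_assoc sigma_inverse)

lemma mod4_one_real:
  assumes "d mod 4 = 1"
  shows "2 * (real_of_int ((d - 1) div 4)) = (of_int d - 1) / 2"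
proof -
  have "d = 1 + 4 * ((d - 1) div 4)" using assms by presburger
  then have "real_of_int d = 1 + 4 * of_int ((d - 1) div 4)" by linarith
  then show ?thesis by simp
qed

lemma beta_sigma: "beta d ** sigma d = sigma d ** beta0 d"
  "transpose (beta d) ** tau d = tau d ** transpose (beta0 d)"
  by (auto simp: beta_def sigma_def beta0_def tau_def mat22_simps mod4_one_real field_simps)

lemma sigma_inv_beta: "sigma_inv d ** beta d = beta0 d ** sigma_inv d"
  "tau_inv d ** transpose (beta d) = transpose (beta0 d) ** tau_inv d"
  by (auto simp: beta_def sigma_inv_def beta0_def tau_inv_def mat22_simps mod4_one_real field_simps)

lemma Mmat_eq: "Mmat d = blk (sigma d) 0 0 (tau d)"
proof (cases "d mod 4 = 1")
  case True
  have "matrix_inv (sigma d) = sigma_inv d"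
    by (rule matrix_inv_eqI) (rule sigma_inverse)
  moreover have "2 *\<^sub>R transpose (sigma_inv d) = tau d"
    using True by (simp add: sigma_inv_def tau_def mat22_simps)
  ultimately show ?thesis using True by (simp add: Mmat_def)
next
  case False
  then show ?thesis by (simp add: Mmat_def sigma_def tau_def flip: mat_eq_blk)
qed

lemma matrix_inv_Mmat: "matrix_inv (Mmat d) = blk (sigma_inv d) 0 0 (tau_inv d)"
  by (rule matrix_inv_eqI)
     (simp add: Mmat_eq blk_mult sigma_inverse matrix_zero_left matrix_zero_right flip: mat_eq_blk)

section \<open>The embedding of SL2 and its image\<close>

definition phi0 :: "int \<Rightarrow> complex^2^2 \<Rightarrow> mat4" where
  "phi0 d g =
    (let a1 = coord_a (g $ 1 $ 1); b1 = coord_b d (g $ 1 $ 1);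
         a2 = coord_a (g $ 1 $ 2); b2 = coord_b d (g $ 1 $ 2);
         a3 = coord_a (g $ 2 $ 1); b3 = coord_b d (g $ 2 $ 1);
         a4 = coord_a (g $ 2 $ 2); b4 = coord_b d (g $ 2 $ 2);
         e = real_of_int d
     in blk (mat22 a1 b1 (b1 * e) a1) (mat22 b2 a2 a2 (b2 * e))
            (mat22 (b3 * e) a3 a3 b3) (mat22 a4 (b4 * e) b4 a4))"

lemma phiSL_eq: "phiSL d g = Mmat d ** phi0 d g ** matrix_inv (Mmat d)"
  by (simp add: phiSL_def phi0_def Let_def)

lemma phiSL_blk:
  assumes "phi0 d g = blk A B C D"
  shows "phiSL d g = blk (sigma d ** A ** sigma_inv d) (sigma d ** B ** tau_inv d)
    (tau d ** C ** sigma_inv d) (tau d ** D ** tau_inv d)"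
  unfolding phiSL_eq assms matrix_inv_Mmat unfolding Mmat_eq
  by (simp add: blk_mult matrix_zero_left matrix_zero_right)

lemma phiSL_one: "phiSL d (mat 1) = mat 1"
proof -
  have "phi0 d (mat 1) = blk (mat 1) 0 0 (mat 1)"
    by (simp add: phi0_def Let_def coord_a_def coord_b_def blk_eq_iff mat22_simps)
  from phiSL_blk[OF this] show ?thesis
    by (simp add: sigma_inverse matrix_zero_left matrix_zero_right flip: mat_eq_blk)
qed

lemma phi0_add: "phi0 d (g + h) = phi0 d g + phi0 d h"
  by (simp add: phi0_def Let_def coord_a_def coord_b_def blk_add blk_eq_iff mat22_simps add_divide_distrib algebra_simps)

lemma phi0_scaleR: "phi0 d (c *\<^sub>R g) = c *\<^sub>R phi0 d g"
  by (simp add: phi0_def Let_def coord_a_def coord_b_def blk_scaleR blk_eq_iff mat22_simps algebra_simps)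

lemma phiSL_add: "phiSL d (g + h) = phiSL d g + phiSL d h"
  and phiSL_scaleR: "phiSL d (c *\<^sub>R g) = c *\<^sub>R phiSL d g"
  by (simp_all add: phiSL_eq phi0_add phi0_scaleR mat_ring_simps)

lemma hat_phiSL:
  assumes d: "d \<noteq> 0"
  shows "hat d (phiSL d g) = phiSL d g"
proof -
  obtain A B C D where g: "phi0 d g = blk A B C D" by (rule blk_cases)
  then have fixed: "(1 / of_int d) *\<^sub>R (beta0 d ** (A ** beta0 d)) = A"
    "(1 / of_int d) *\<^sub>R (beta0 d ** (B ** transpose (beta0 d))) = B"
    "(1 / of_int d) *\<^sub>R (transpose (beta0 d) ** (C ** beta0 d)) = C"
    "(1 / of_int d) *\<^sub>R (transpose (beta0 d) ** (D ** transpose (beta0 d))) = D"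
    using d by (auto simp: phi0_def Let_def blk_eq_iff beta0_def mat22_simps field_simps)
  have move: "beta d ** (sigma d ** X) = sigma d ** (beta0 d ** X)"
    "transpose (beta d) ** (tau d ** X) = tau d ** (transpose (beta0 d) ** X)" for X
    by (simp_all add: matrix_mul_assoc beta_sigma)
  have pull: "(1 / real_of_int d) *\<^sub>R (X ** (P ** (Y ** (Q ** R)))) = X ** ((1 / real_of_int d) *\<^sub>R (P ** (Y ** Q)) ** R)"
    for X P Y Q R :: "real^2^2"
    by (simp add: mat_ring_simps matrix_mul_assoc)
  show ?thesis
    unfolding phiSL_blk[OF g] hat_blk[OF d] blk_eq_iff
    by (simp only: flip: matrix_mul_assoc) (simp only: move sigma_inv_beta pull fixed simp_thms)
qed

text \<open>After conjugation back by \<open>Mmat d\<close>, being fixed is a linear condition with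
  \<open>beta0 d\<close> that leaves two free entries in each block. These are the two coordinates
  of one entry of \<open>T\<close>.\<close>

lemma hat_fixed_imp_phiSL:
  assumes d: "d < 0" and fixed: "hat d g = g"
  obtains T where "g = phiSL d T"
proof -
  obtain A' B' C' D' where g: "g = blk A' B' C' D'" by (rule blk_cases)
  define A B C D where "A = sigma_inv d ** A' ** sigma d" "B = sigma_inv d ** B' ** tau d"
    "C = tau_inv d ** C' ** sigma d" "D = tau_inv d ** D' ** tau d"
  note defs = this
  have inv: "A' = sigma d ** A ** sigma_inv d" "B' = sigma d ** B ** tau_inv d"
    "C' = tau d ** C ** sigma_inv d" "D' = tau d ** D ** tau_inv d"
    by (simp_all add: defs sigma_inverse_assoc sigma_inverse flip: matrix_mul_assoc)
  have move: "sigma_inv d ** (beta d ** X) = beta0 d ** (sigma_inv d ** X)"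
    "tau_inv d ** (transpose (beta d) ** X) = transpose (beta0 d) ** (tau_inv d ** X)" for X
    by (simp_all add: matrix_mul_assoc sigma_inv_beta)
  have "A' = (1 / of_int d) *\<^sub>R (beta d ** (A' ** beta d))"
    "B' = (1 / of_int d) *\<^sub>R (beta d ** (B' ** transpose (beta d)))"
    "C' = (1 / of_int d) *\<^sub>R (transpose (beta d) ** (C' ** beta d))"
    "D' = (1 / of_int d) *\<^sub>R (transpose (beta d) ** (D' ** transpose (beta d)))"
    using fixed d unfolding g by (simp_all add: hat_blk blk_eq_iff matrix_mul_assoc)
  then have "A = sigma_inv d ** ((1 / of_int d) *\<^sub>R (beta d ** (A' ** beta d))) ** sigma d"
    "B = sigma_inv d ** ((1 / of_int d) *\<^sub>R (beta d ** (B' ** transpose (beta d)))) ** tau d"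
    "C = tau_inv d ** ((1 / of_int d) *\<^sub>R (transpose (beta d) ** (C' ** beta d))) ** sigma d"
    "D = tau_inv d ** ((1 / of_int d) *\<^sub>R (transpose (beta d) ** (D' ** transpose (beta d)))) ** tau d"
    unfolding defs by simp_all
  moreover have "sigma_inv d ** ((1 / of_int d) *\<^sub>R (beta d ** (A' ** beta d))) ** sigma d
      = (1 / of_int d) *\<^sub>R (beta0 d ** (A ** beta0 d))"
    "sigma_inv d ** ((1 / of_int d) *\<^sub>R (beta d ** (B' ** transpose (beta d)))) ** tau d
      = (1 / of_int d) *\<^sub>R (beta0 d ** (B ** transpose (beta0 d)))"
    "tau_inv d ** ((1 / of_int d) *\<^sub>R (transpose (beta d) ** (C' ** beta d))) ** sigma d
      = (1 / of_int d) *\<^sub>R (transpose (beta0 d) ** (C ** beta0 d))"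
    "tau_inv d ** ((1 / of_int d) *\<^sub>R (transpose (beta d) ** (D' ** transpose (beta d)))) ** tau d
      = (1 / of_int d) *\<^sub>R (transpose (beta0 d) ** (D ** transpose (beta0 d)))"
    unfolding defs by (simp_all add: mat_ring_simps move beta_sigma flip: matrix_mul_assoc)
  moreover have flip: "of_int d *\<^sub>R X = Y" if "X = (1 / of_int d) *\<^sub>R Y" for X Y :: "real^2^2"
    using that d by simp
  ultimately have eqs: "of_int d *\<^sub>R A = beta0 d ** (A ** beta0 d)"
    "of_int d *\<^sub>R B = beta0 d ** (B ** transpose (beta0 d))"
    "of_int d *\<^sub>R C = transpose (beta0 d) ** (C ** beta0 d)"
    "of_int d *\<^sub>R D = transpose (beta0 d) ** (D ** transpose (beta0 d))"
    by (metis (no_types))+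
  have entries: "A $ 2 $ 1 = A $ 1 $ 2 * of_int d" "A $ 2 $ 2 = A $ 1 $ 1"
    "B $ 2 $ 1 = B $ 1 $ 2" "B $ 2 $ 2 = B $ 1 $ 1 * of_int d"
    "C $ 1 $ 1 = C $ 2 $ 2 * of_int d" "C $ 2 $ 1 = C $ 1 $ 2"
    "D $ 1 $ 2 = D $ 2 $ 1 * of_int d" "D $ 2 $ 2 = D $ 1 $ 1"
    using eqs[THEN arg_cong, of "\<lambda>M. M $ 1 $ 1"] eqs[THEN arg_cong, of "\<lambda>M. M $ 1 $ 2"]
      eqs[THEN arg_cong, of "\<lambda>M. M $ 2 $ 2"] d
    by (simp_all add: beta0_def matrix22_mult_component mult.commute)
  let ?s = "csqrt (of_int d)"
  define T where "T = mat22 (of_real (A $ 1 $ 1) + of_real (A $ 1 $ 2) * ?s)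
    (of_real (B $ 1 $ 2) + of_real (B $ 1 $ 1) * ?s) (of_real (C $ 1 $ 2) + of_real (C $ 2 $ 2) * ?s)
    (of_real (D $ 1 $ 1) + of_real (D $ 2 $ 1) * ?s)"
  have "phi0 d T = blk A B C D"
    using d by (simp add: T_def phi0_def Let_def coord_a_def coord_b_def blk_eq_iff mat22_simps entries)
  then have "phiSL d T = g"
    by (simp add: phiSL_blk g inv)
  then show thesis using that by blast
qed

text \<open>The shape of the blocks makes A^t C and B^t D symmetric. If det T = x + y sqrt(d), then
  A^t D - C^t B has diagonal entries x and off-diagonal entries d y and y.\<close>

lemma phi0_symplectic_iff:
  assumes d: "d < 0"
  shows "phi0 d T \<in> Sp4R \<longleftrightarrow> det T = 1"
proof -
  define a b where "a = (\<lambda>i j. coord_a (T $ i $ j))" and "b = (\<lambda>i j. coord_b d (T $ i $ j))"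
  let ?s = "csqrt (of_int d)"
  have s2: "?s * ?s = of_int d"
    by (metis power2_csqrt power2_eq_square)
  have s2': "?s * (?s * y) = of_int d * y" for y
    using s2 by (simp flip: mult.assoc)
  have T: "T $ i $ j = of_real (a i j) + of_real (b i j) * ?s" for i j
    unfolding a_def b_def by (rule coord_decomp[OF d])
  define x y where "x = a 1 1 * a 2 2 + of_int d * (b 1 1 * b 2 2) - (a 1 2 * a 2 1 + of_int d * (b 1 2 * b 2 1))"
    and "y = a 1 1 * b 2 2 + b 1 1 * a 2 2 - (a 1 2 * b 2 1 + b 1 2 * a 2 1)"
  have "det T = of_real x + of_real y * ?s"
    unfolding det_2 T x_def y_def by (simp add: algebra_simps s2 s2')
  then have "det T = 1 \<longleftrightarrow> x = 1 \<and> y = 0"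
    using coord_of_real[OF d, of x y] coord_of_real[OF d, of 1 0] by auto
  moreover have "phi0 d T = blk (mat22 (a 1 1) (b 1 1) (b 1 1 * of_int d) (a 1 1))
      (mat22 (b 1 2) (a 1 2) (a 1 2) (b 1 2 * of_int d))
      (mat22 (b 2 1 * of_int d) (a 2 1) (a 2 1) (b 2 1))
      (mat22 (a 2 2) (b 2 2 * of_int d) (b 2 2) (a 2 2))"
    by (simp add: phi0_def Let_def a_def b_def)
  then have "phi0 d T \<in> Sp4R \<longleftrightarrow> mat22 x (of_int d * y) y x = mat 1"
    unfolding Sp4R_def by (simp add: mat22_simps x_def y_def algebra_simps)
  then have "phi0 d T \<in> Sp4R \<longleftrightarrow> x = 1 \<and> y = 0"
    by (auto simp: mat22_simps)
  ultimately show ?thesis by simp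
qed

text \<open>\<open>Mmat d\<close> is a similitude, so conjugation by it preserves
  \<open>Sp4R\<close>; the multiplier 2 is the factor 2 in its lower block.\<close>

lemma Mmat_symplectic:
  "transpose (Mmat d) ** Jm ** Mmat d = (if d mod 4 = 1 then 2 else 1) *\<^sub>R Jm"
  unfolding Mmat_eq Jm_def transpose_blk blk_mult blk_scaleR blk_eq_iff
  by (auto simp: sigma_def tau_def mat22_simps)

lemma phiSL_Sp4R_iff:
  assumes d: "d < 0"
  shows "phiSL d T \<in> Sp4R \<longleftrightarrow> det T = 1"
proof -
  define c :: real where "c = (if d mod 4 = 1 then 2 else 1)"
  define M Mi where "M = Mmat d" and "Mi = matrix_inv (Mmat d)"
  have c: "c \<noteq> 0" by (simp add: c_def)
  have MM: "transpose M ** Jm ** M = c *\<^sub>R Jm"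
    unfolding M_def c_def by (rule Mmat_symplectic)
  have inv: "M ** Mi = mat 1" "Mi ** M = mat 1"
    unfolding M_def Mi_def matrix_inv_Mmat unfolding Mmat_eq
    by (simp_all add: blk_mult sigma_inverse matrix_zero_left matrix_zero_right flip: mat_eq_blk)
  have inv': "transpose M ** transpose Mi = mat 1" "transpose Mi ** transpose M = mat 1"
    by (simp_all add: inv flip: matrix_transpose_mul)
  define h where "h = phi0 d T"
  define g where "g = M ** h ** Mi"
  have "transpose M ** (transpose g ** Jm ** g) ** M = (transpose M ** transpose Mi) ** transpose h
      ** (transpose M ** Jm ** M) ** h ** (Mi ** M)"
    by (simp add: g_def matrix_transpose_mul matrix_mul_assoc)
  then have *: "transpose M ** (transpose g ** Jm ** g) ** M = c *\<^sub>R (transpose h ** Jm ** h)"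
    by (simp add: inv inv' MM mat_ring_simps matrix_mul_assoc)
  have "g \<in> Sp4R \<longleftrightarrow> h \<in> Sp4R"
  proof
    assume "g \<in> Sp4R"
    then have "c *\<^sub>R (transpose h ** Jm ** h) = c *\<^sub>R Jm"
      using * MM unfolding Sp4R_iff by metis
    then show "h \<in> Sp4R" using c by (simp add: Sp4R_iff)
  next
    assume "h \<in> Sp4R"
    then have "transpose M ** (transpose g ** Jm ** g) ** M = transpose M ** Jm ** M"
      using * MM by (simp add: Sp4R_iff)
    then have "transpose M ** (transpose g ** Jm ** g) = transpose M ** Jm"
      by (rule matrix_mult_right_cancel[OF inv(1)])
    then have "transpose g ** Jm ** g = Jm"
      by (rule matrix_mult_left_cancel[OF inv'(2)])
    then show "g \<in> Sp4R" by (simp add: Sp4R_iff)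
  qed
  then show ?thesis
    unfolding g_def h_def M_def Mi_def phiSL_eq[symmetric] by (simp add: phi0_symplectic_iff d)
qed

text \<open>Here the conjugation by \<open>Mmat d\<close> pays off: for \<open>d mod 4 = 1\<close>
  the entries become integral combinations of a + b and 2b, the two numbers that
  \<open>quad_ints_coords\<close> tests. It is stated for all \<open>T\<close>, without a
  determinant condition, so that it applies to (T - 1)/N as well.\<close>

lemma phiSL_int_iff:
  assumes d: "d < 0" "squarefree d" "principal_domain (quad_int_ring d)"
  shows "phiSL d T \<in> int_mats \<longleftrightarrow> (\<forall>i j. T $ i $ j \<in> quad_ints d)"
proof -
  define a b where "a = (\<lambda>i j. coord_a (T $ i $ j))" and "b = (\<lambda>i j. coord_b d (T $ i $ j))"
  have int: "T $ i $ j \<in> quad_ints d \<longleftrightarrow> (if d mod 4 = 1 then a i j + b i j \<in> \<int> \<and> 2 * b i j \<in> \<int>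
      else a i j \<in> \<int> \<and> b i j \<in> \<int>)" for i j
    unfolding a_def b_def by (rule quad_ints_coords[OF d])
  have phi0: "phi0 d T = blk (mat22 (a 1 1) (b 1 1) (b 1 1 * of_int d) (a 1 1))
      (mat22 (b 1 2) (a 1 2) (a 1 2) (b 1 2 * of_int d))
      (mat22 (b 2 1 * of_int d) (a 2 1) (a 2 1) (b 2 1))
      (mat22 (a 2 2) (b 2 2 * of_int d) (b 2 2) (a 2 2))"
    by (simp add: phi0_def Let_def a_def b_def)
  show ?thesis
  proof (cases "d mod 4 = 1")
    case True
    define m where "m = (d - 1) div 4"
    have "d = 1 + 4 * m" using True unfolding m_def by presburger
    then have dm: "real_of_int d = 1 + 4 * of_int m" by simp
    define p q where "p = (\<lambda>i j. a i j + b i j)" and "q = (\<lambda>i j. 2 * b i j)"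
    have entries: "phiSL d T = blk
      (mat22 (p 1 1) (q 1 1) (of_int m * q 1 1) (p 1 1 - q 1 1))
      (mat22 (q 1 2) (p 1 2 - q 1 2) (p 1 2 - q 1 2) (of_int m * q 1 2 + q 1 2 - p 1 2))
      (mat22 (of_int m * q 2 1 + p 2 1) (p 2 1) (p 2 1) (q 2 1))
      (mat22 (p 2 2) (of_int m * q 2 2) (q 2 2) (p 2 2 - q 2 2))"
      unfolding phiSL_blk[OF phi0] blk_eq_iff
      using True by (simp add: sigma_def sigma_inv_def tau_def tau_inv_def mat22_simps dm p_def q_def field_simps)
    \<comment> \<open>Up to sign and multiples of \<open>q 1 2\<close>, the number
      \<open>p 1 2\<close> occurs only as \<open>p 1 2 - q 1 2\<close>, so it has to be recovered
      from that difference.\<close>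
    have "p 1 2 \<in> \<int>" if "p 1 2 - q 1 2 \<in> \<int>" "q 1 2 \<in> \<int>"
      using Ints_add[OF that] by simp
    moreover have "T $ i $ j \<in> quad_ints d \<longleftrightarrow> p i j \<in> \<int> \<and> q i j \<in> \<int>" for i j
      using True by (simp add: int p_def q_def)
    ultimately show ?thesis
      unfolding entries int_mats_def mem_Collect_eq forall_sum22 forall_2 by auto
  next
    case False
    have "phiSL d T = phi0 d T"
      unfolding phiSL_blk[OF phi0] using False
      by (simp add: phi0 sigma_def sigma_inv_def tau_def tau_inv_def)
    then show ?thesis
      unfolding phi0 int_mats_def mem_Collect_eq forall_sum22 forall_2 int using False by auto
  qed
qed

lemma phiSL_Lambda:
  assumes d: "d < 0" "squarefree d" "principal_domain (quad_int_ring d)"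
  shows "phiSL d ` Lambda d = {g \<in> Sp4Z. hat d g = g}"
proof (intro equalityI subsetI)
  fix g assume "g \<in> phiSL d ` Lambda d"
  then show "g \<in> {g \<in> Sp4Z. hat d g = g}"
    using d by (auto simp: Lambda_def SL2C_def Sp4Z_iff phiSL_Sp4R_iff phiSL_int_iff hat_phiSL)
next
  fix g assume g: "g \<in> {g \<in> Sp4Z. hat d g = g}"
  then obtain T where T: "g = phiSL d T"
    using hat_fixed_imp_phiSL[OF d(1)] by blast
  then have "T \<in> Lambda d"
    using g d by (simp add: Lambda_def SL2C_def Sp4Z_iff phiSL_Sp4R_iff phiSL_int_iff)
  then show "g \<in> phiSL d ` Lambda d" using T by blast
qed

text \<open>\<open>phiSL d\<close> is real linear and sends 1 to 1, so (phiSL T - 1)/N = phiSL((T -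
  1)/N) and the integrality criterion compares the two congruence conditions.\<close>

lemma phiSL_LambdaN:
  assumes d: "d < 0" "squarefree d" "principal_domain (quad_int_ring d)" and N: "N > 0"
  shows "phiSL d ` LambdaN d N = {g \<in> Gamma_N d N. hat d g = g}"
proof -
  have diff: "phiSL d T - mat 1 = real N *\<^sub>R phiSL d ((1 / real N) *\<^sub>R (T - mat 1))" for T
  proof -
    have "T = mat 1 + real N *\<^sub>R ((1 / real N) *\<^sub>R (T - mat 1))"
      using N by simp
    then have "phiSL d T = phiSL d (mat 1) + real N *\<^sub>R phiSL d ((1 / real N) *\<^sub>R (T - mat 1))"
      by (metis phiSL_add phiSL_scaleR)
    then show ?thesis by (simp add: phiSL_one)
  qed
  have LN: "T \<in> LambdaN d N \<longleftrightarrow> T \<in> Lambda d \<and> phiSL d ((1 / real N) *\<^sub>R (T - mat 1)) \<in> int_mats" for T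
  proof -
    have "(\<exists>t\<in>quad_ints d. T $ i $ j - mat 1 $ i $ j = of_nat N * t)
        \<longleftrightarrow> ((1 / real N) *\<^sub>R (T - mat 1)) $ i $ j \<in> quad_ints d" for i j
    proof -
      have "x = of_nat N * t \<longleftrightarrow> t = (1 / real N) *\<^sub>R x" for x t :: complex
        using N by (auto simp: scaleR_conv_of_real)
      then show ?thesis by auto
    qed
    then show ?thesis
      by (simp add: LambdaN_def phiSL_int_iff[OF d])
  qed
  have GN: "g \<in> Gamma_N d N \<longleftrightarrow> g \<in> Sp4Z \<and> (1 / real N) *\<^sub>R (g - mat 1) \<in> int_mats" if "hat d g = g" for g
  proof -
    have "g = mat 1 + real N *\<^sub>R Y \<longleftrightarrow> Y = (1 / real N) *\<^sub>R (g - mat 1)" for Y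
      using N by auto
    then have "g \<in> GammaSp N \<longleftrightarrow> g \<in> Sp4R \<and> (1 / real N) *\<^sub>R (g - mat 1) \<in> int_mats"
      unfolding GammaSp_iff by auto
    moreover have "g \<in> Gamma_N d N \<longleftrightarrow> g \<in> GammaSp N"
      using that d(1) by (simp add: Gamma_N_iff)
    ultimately show ?thesis
      using GammaSp_subset[of N] by (auto simp: Sp4Z_iff)
  qed
  have eq: "(1 / real N) *\<^sub>R (phiSL d T - mat 1) = phiSL d ((1 / real N) *\<^sub>R (T - mat 1))" for T
    using N by (simp add: diff)
  have "T \<in> LambdaN d N \<longleftrightarrow> phiSL d T \<in> Gamma_N d N" if "T \<in> Lambda d" for T
  proof -
    have "phiSL d T \<in> {g \<in> Sp4Z. hat d g = g}"
      using that phiSL_Lambda[OF d] by blast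
    then show ?thesis using that LN[of T] GN[of "phiSL d T"] eq[of T] by simp
  qed
  moreover have "LambdaN d N \<subseteq> Lambda d" by (auto simp: LambdaN_def)
  moreover have "Gamma_N d N \<subseteq> Sp4Z" using Gamma_N_Sp4Z[of d] d(1) by (metis less_irrefl subsetI)
  ultimately show ?thesis
    using phiSL_Lambda[OF d] hat_phiSL[of d] d(1)
    by (fastforce simp: image_iff set_eq_iff)
qed

subsection \<open>Unimodular lattices over the ring of integers\<close>

lemma matrix_vector_mult_minus: "(- A) *v x = - (A *v x)"
  for A :: "'a::ring_1^'n^'m"
  by (simp add: matrix_vector_mult_def vec_eq_iff sum_negf)

definition sform :: "real^(2+2) \<Rightarrow> real^(2+2) \<Rightarrow> real" where
  "sform v w = v \<bullet> (Jm *v w)"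

lemma sform_skew: "sform w v = - sform v w"
proof -
  have "sform w v = (transpose Jm *v w) \<bullet> v"
    by (simp add: sform_def dot_lmul_matrix)
  also have "\<dots> = v \<bullet> ((- Jm) *v w)"
    by (simp only: transpose_Jm inner_commute)
  also have "(- Jm) *v w = - (Jm *v w)"
    by (rule matrix_vector_mult_minus)
  finally show ?thesis by (simp add: sform_def)
qed

lemma sform_bilinear:
  "sform (u + v) w = sform u w + sform v w" "sform u (v + w) = sform u v + sform u w"
  "sform (u - v) w = sform u w - sform v w" "sform u (v - w) = sform u v - sform u w"
  "sform (c *\<^sub>R u) w = c * sform u w" "sform u (c *\<^sub>R w) = c * sform u w"
  by (simp_all add: sform_def algebra_simps inner_simps matrix_vector_mult_scaleR)

definition int_vecs :: "(real^(2+2)) set" where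
  "int_vecs = {v. \<forall>i. v $ i \<in> \<int>}"

lemma int_vecs_add: "v \<in> int_vecs \<Longrightarrow> w \<in> int_vecs \<Longrightarrow> v + w \<in> int_vecs"
  and int_vecs_diff: "v \<in> int_vecs \<Longrightarrow> w \<in> int_vecs \<Longrightarrow> v - w \<in> int_vecs"
  and int_vecs_scale: "v \<in> int_vecs \<Longrightarrow> k \<in> \<int> \<Longrightarrow> k *\<^sub>R v \<in> int_vecs"
  and int_vecs_axis: "axis i 1 \<in> int_vecs"
  and int_vecs_zero: "0 \<in> int_vecs"
  by (auto simp: int_vecs_def axis_def)

lemma int_vecs_matrix: "A \<in> int_mats \<Longrightarrow> v \<in> int_vecs \<Longrightarrow> A *v v \<in> int_vecs"
  by (auto simp: int_mats_def int_vecs_def matrix_vector_mult_def)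

lemma int_vecs_inner: "v \<in> int_vecs \<Longrightarrow> w \<in> int_vecs \<Longrightarrow> v \<bullet> w \<in> \<int>"
  by (auto simp: int_vecs_def inner_vec_def)

lemma sform_int: "v \<in> int_vecs \<Longrightarrow> w \<in> int_vecs \<Longrightarrow> sform v w \<in> \<int>"
  by (simp add: sform_def int_vecs_inner int_vecs_matrix int_mats_Jm)

text \<open>The lattice is its own dual for \<open>sform\<close>: pairing with - J e_i recovers the
  i-th coordinate.\<close>

lemma int_vecs_iff_sform: "u \<in> int_vecs \<longleftrightarrow> (\<forall>w\<in>int_vecs. sform u w \<in> \<int>)"
proof
  assume *: "\<forall>w\<in>int_vecs. sform u w \<in> \<int>"
  have "u $ i \<in> \<int>" for i
  proof -
    have "sform u (- (Jm *v axis i 1)) = - (u \<bullet> (Jm *v (Jm *v axis i 1)))"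
      by (simp add: sform_def linear_neg[OF matrix_vector_mul_linear])
    also have "Jm *v (Jm *v axis i 1) = - axis i 1"
      by (simp add: matrix_vector_mul_assoc Jm_square matrix_vector_mult_minus)
    finally have "sform u (- (Jm *v axis i 1)) = u $ i"
      by (simp add: inner_axis)
    moreover have "- (Jm *v axis i 1) \<in> int_vecs"
      using int_vecs_matrix[OF int_mats_Jm int_vecs_axis] int_vecs_diff[OF int_vecs_zero] by simp
    ultimately show ?thesis using * by metis
  qed
  then show "u \<in> int_vecs" by (simp add: int_vecs_def)
qed (use sform_int in blast)

text \<open>\<open>W\<close> is the action on the lattice \<open>int_vecs\<close> of the generator \<open>om\<close> of the ring of integers.\<close>

locale quad_lattice =
  fixes d :: int and om :: complex and t n :: int and W :: mat4
  assumes om_square: "om * om = of_int t * om + of_int n"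
    and om_nonreal: "Im om \<noteq> 0"
    and quad_ints_eq: "quad_ints d = {of_int p + of_int q * om | p q. True}"
    and pid: "principal_domain (quad_int_ring d)"
    and W_int: "W \<in> int_mats"
    and W_square: "W ** W = of_int t *\<^sub>R W + of_int n *\<^sub>R mat 1"
    and W_adjoint: "transpose W ** Jm = Jm ** W"
begin

lemma om_om: "om * (om * x) = of_int t * (om * x) + of_int n * x"
  using om_square by (metis distrib_right mult.assoc)

lemma sform_W: "sform (W *v v) w = sform v (W *v w)"
proof -
  have "sform (W *v v) w = (v v* transpose W) \<bullet> (Jm *v w)"
    by (simp add: sform_def)
  also have "\<dots> = v \<bullet> ((transpose W ** Jm) *v w)"
    by (simp only: dot_lmul_matrix matrix_vector_mul_assoc)
  also have "\<dots> = sform v (W *v w)"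
    by (simp add: W_adjoint sform_def matrix_vector_mul_assoc)
  finally show ?thesis .
qed

lemma W_W: "W *v (W *v v) = of_int t *\<^sub>R (W *v v) + of_int n *\<^sub>R v"
  by (simp add: matrix_vector_mul_assoc W_square matrix_vector_mult_add_rdistrib
      flip: scaleR_matrix_vector_assoc)

text \<open>The \<open>om\<close>-bilinear alternating form whose \<open>om\<close>-coordinate is \<open>sform\<close>.\<close>

definition E :: "real^(2+2) \<Rightarrow> real^(2+2) \<Rightarrow> complex" where
  "E v w = of_real (sform (W *v v) w - of_int t * sform v w) + of_real (sform v w) * om"

lemma E_add: "E v (w + w') = E v w + E v w'"
  by (simp add: E_def sform_bilinear algebra_simps)

lemma E_scale: "E v (c *\<^sub>R w) = of_real c * E v w"
  by (simp add: E_def sform_bilinear algebra_simps)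

text \<open>The shift by \<open>t\<close> in \<open>E\<close> is made for this. With f = sform v w
  and h = sform (W v) w, both sides equal n f + h \<open>om\<close>.\<close>

lemma E_W: "E v (W *v w) = om * E v w"
proof -
  have "sform (W *v v) (W *v w) = of_int t * sform (W *v v) w + of_int n * sform v w"
    unfolding sform_W[of "v" "W *v w", symmetric, folded sform_W] sform_W W_W sform_bilinear ..
  then show ?thesis
    by (simp add: E_def sform_W[symmetric] algebra_simps om_om om_square)
qed

lemma om_coords:
  fixes a b a' b' :: real
  shows "of_real a + of_real b * om = of_real a' + of_real b' * om \<longleftrightarrow> a = a' \<and> b = b'"
  using om_nonreal by (auto simp: complex_eq_iff)

lemma E_closed:
  assumes "v \<in> int_vecs" "w \<in> int_vecs"
  shows "E v w \<in> quad_ints d"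
proof -
  have "sform (W *v v) w - of_int t * sform v w \<in> \<int>" "sform v w \<in> \<int>"
    using assms by (auto intro!: Ints_diff Ints_mult sform_int int_vecs_matrix W_int)
  then obtain p q where "sform (W *v v) w - of_int t * sform v w = of_int p" "sform v w = of_int q"
    by (meson Ints_cases)
  then show ?thesis
    unfolding E_def quad_ints_eq by auto
qed

text \<open>The values of \<open>E v\<close> form an ideal \<open>(a)\<close>; then \<open>u = v / a\<close> is integral by unimodularity.\<close>

lemma unimodular_pair:
  "\<exists>u\<in>int_vecs. \<exists>w\<in>int_vecs. sform u w = 0 \<and> sform (W *v u) w = 1"
proof -
  define v :: "real^(2+2)" where "v = axis (Inl 1) 1"
  have v: "v \<in> int_vecs" unfolding v_def by (rule int_vecs_axis)
  interpret R: principal_domain "quad_int_ring d" by (rule pid)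
  define I where "I = E v ` int_vecs"
  have Ir: "I = carrier (quad_int_ring d) \<inter> I"
    using E_closed[OF v] by (auto simp: I_def quad_int_ring_def)
  have "ideal I (quad_int_ring d)"
  proof (rule idealI[OF R.ring_axioms])
    show "subgroup I (add_monoid (quad_int_ring d))"
    proof (rule R.add.subgroupI)
      show "I \<subseteq> carrier (quad_int_ring d)" using Ir by blast
      show "I \<noteq> {}" unfolding I_def using int_vecs_zero by blast
      fix a assume a: "a \<in> I"
      then obtain w where w: "w \<in> int_vecs" "a = E v w" by (auto simp: I_def)
      have "\<ominus>\<^bsub>quad_int_ring d\<^esub> a = - a"
      proof (rule R.minus_equality)
        show "- a \<oplus>\<^bsub>quad_int_ring d\<^esub> a = \<zero>\<^bsub>quad_int_ring d\<^esub>"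
          by (simp add: quad_int_ring_def)
        show "a \<in> carrier (quad_int_ring d)" using a Ir by blast
        have "- a = E v ((- 1) *\<^sub>R w)" unfolding E_scale w by simp
        then show "- a \<in> carrier (quad_int_ring d)"
          using E_closed[OF v int_vecs_scale[OF w(1), of "- 1"]] by (simp add: quad_int_ring_def)
      qed
      moreover have "- a = E v ((- 1) *\<^sub>R w)" unfolding E_scale w by simp
      ultimately show "\<ominus>\<^bsub>quad_int_ring d\<^esub> a \<in> I"
        unfolding I_def using int_vecs_scale[OF w(1), of "- 1"] by auto
    next
      fix a b assume "a \<in> I" "b \<in> I"
      then show "a \<oplus>\<^bsub>quad_int_ring d\<^esub> b \<in> I"
        unfolding I_def by (auto simp: quad_int_ring_def E_add[symmetric] int_vecs_add)
    qed
    fix a x assume "a \<in> I" and x: "x \<in> carrier (quad_int_ring d)"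
    then obtain w where w: "w \<in> int_vecs" "a = E v w" by (auto simp: I_def)
    obtain p q where pq: "x = of_int p + of_int q * om"
      using x by (auto simp: quad_int_ring_def quad_ints_eq)
    have "x * a = E v (of_int p *\<^sub>R w + of_int q *\<^sub>R (W *v w))"
      by (simp add: w pq E_add E_scale E_W algebra_simps)
    moreover have "of_int p *\<^sub>R w + of_int q *\<^sub>R (W *v w) \<in> int_vecs"
      by (intro int_vecs_add int_vecs_scale int_vecs_matrix W_int w) auto
    ultimately have "x * a \<in> I" by (auto simp: I_def)
    then show "x \<otimes>\<^bsub>quad_int_ring d\<^esub> a \<in> I" "a \<otimes>\<^bsub>quad_int_ring d\<^esub> x \<in> I"
      by (simp_all add: quad_int_ring_def mult.commute)
  qed
  then obtain a where a: "a \<in> carrier (quad_int_ring d)" "I = PIdl\<^bsub>quad_int_ring d\<^esub> a"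
    using R.exists_gen by blast
  then have I_eq: "I = {x * a | x. x \<in> quad_ints d}"
    by (auto simp: cgenideal_def quad_int_ring_def)
  have aI: "a \<in> I"
    using R.cgenideal_self[OF a(1)] a(2) by simp
  then obtain w0 where w0: "w0 \<in> int_vecs" "a = E v w0" by (auto simp: I_def)
  obtain p q where pq: "a = of_int p + of_int q * om"
    using a(1) by (auto simp: quad_int_ring_def quad_ints_eq)
  \<comment> \<open>The norm of the generator: (p + q t) - q \<open>om\<close> is the conjugate of
    a, the conjugate of \<open>om\<close> being t - \<open>om\<close>.\<close>
  define N where "N = p\<^sup>2 + p * q * t - q\<^sup>2 * n"
  have "(of_int (p + q * t) - of_int q * om) * a = of_int N"
    unfolding pq N_def by (simp add: algebra_simps om_square om_om power2_eq_square)
  note norm_a = this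
  have "a \<noteq> 0"
  proof
    assume "a = 0"
    then have "I = {0}" using aI I_eq by auto
    moreover have "axis (Inr 1) 1 \<in> int_vecs" by (rule int_vecs_axis)
    ultimately have "E v (axis (Inr 1) 1) = 0" by (auto simp: I_def)
    then have "sform v (axis (Inr 1) 1) = 0"
      using om_coords[of _ _ 0 0] unfolding E_def by (metis add_0 mult_zero_left of_real_0)
    moreover have "sform v (axis (Inr 1) 1) = 1"
      by (simp add: sform_def v_def inner_vec_def matrix_vector_mult_def sum_UNIV_sum22 axis_def Jm_def)
    ultimately show False by simp
  qed
  have "N \<noteq> 0"
  proof
    assume "N = 0"
    then have "of_int (p + q * t) - of_int q * om = 0" using norm_a \<open>a \<noteq> 0\<close> by simp
    then have "q = 0" "p + q * t = 0"
      using om_coords[of "of_int (p + q * t)" "- of_int q" 0 0] by auto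
    then show False using \<open>a \<noteq> 0\<close> pq by simp
  qed
  \<comment> \<open>This is v / a, with 1/a written as the conjugate of a over its norm and
    \<open>om\<close> acting as \<open>W\<close>.\<close>
  define u where "u = (1 / of_int N) *\<^sub>R (of_int (p + q * t) *\<^sub>R v - of_int q *\<^sub>R (W *v v))"
  \<comment> \<open>In coordinates this says that E v w = x a implies E u w = x, for x = c + e
    \<open>om\<close>.\<close>
  have key: "sform u w = of_int e \<and> sform (W *v u) w = of_int (c + t * e)"
    if w: "E v w = (of_int c + of_int e * om) * a" for w c e
  proof -
    define f h where "f = sform v w" and "h = sform (W *v v) w"
    have "(of_int c + of_int e * om) * a = of_int (p * c + q * e * n) + of_int (p * e + q * c + q * e * t) * om"
      unfolding pq by (simp add: algebra_simps om_square om_om)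
    then have "of_real (h - of_int t * f) + of_real f * om
        = of_real (of_int (p * c + q * e * n)) + of_real (of_int (p * e + q * c + q * e * t)) * om"
      using w by (simp add: E_def f_def h_def)
    then have hf: "h = of_int (p * c + q * e * n) + of_int t * f" "f = of_int (p * e + q * c + q * e * t)"
      unfolding om_coords by auto
    have "sform u w = ((of_int (p + q * t)) * f - of_int q * h) / of_int N"
      by (simp add: u_def sform_bilinear f_def h_def)
    also have "(of_int (p + q * t)) * f - of_int q * h = of_int e * (of_int N :: real)"
      unfolding hf(1) unfolding hf(2) N_def by (simp add: algebra_simps power2_eq_square)
    finally have 1: "sform u w = of_int e" using \<open>N \<noteq> 0\<close> by simp
    have "W *v u = (1 / of_int N) *\<^sub>R (of_int p *\<^sub>R (W *v v) - of_int (q * n) *\<^sub>R v)"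
      by (simp add: u_def matrix_vector_mult_scaleR matrix_vector_mult_diff_distrib W_W algebra_simps)
    then have "sform (W *v u) w = (of_int p * h - of_int (q * n) * f) / of_int N"
      by (simp add: sform_bilinear f_def h_def)
    also have "of_int p * h - of_int (q * n) * f = of_int (c + t * e) * (of_int N :: real)"
      unfolding hf(1) unfolding hf(2) N_def by (simp add: algebra_simps power2_eq_square)
    finally show ?thesis using 1 \<open>N \<noteq> 0\<close> by simp
  qed
  have "u \<in> int_vecs"
    unfolding int_vecs_iff_sform
  proof
    fix w assume "w \<in> int_vecs"
    then have "E v w \<in> I" by (simp add: I_def)
    then obtain x where x: "x \<in> quad_ints d" "E v w = x * a" using I_eq by auto
    then obtain c e where "x = of_int c + of_int e * om" unfolding quad_ints_eq by auto
    then have "sform u w = of_int e" using key[of w c e] x by simp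
    then show "sform u w \<in> \<int>" by simp
  qed
  \<comment> \<open>The vector \<open>w0\<close> has E v w0 = a, so here x = 1, that is c = 1 and e
    = 0.\<close>
  moreover have "sform u w0 = 0 \<and> sform (W *v u) w0 = 1"
    using key[of w0 1 0] w0(2) by simp
  ultimately show ?thesis using w0(1) by blast
qed

text \<open>The upper block is the companion matrix of X^2 - t X - n. The lower block is its
  transpose, as self-adjointness for \<open>Jm\<close> requires.\<close>

definition companion :: mat4 where
  "companion = blk (mat22 0 (of_int n) 1 (of_int t)) 0 0 (mat22 0 1 (of_int n) (of_int t))"

text \<open>For a unimodular pair \<open>u, w\<close>, the columns \<open>u, W u, W w - t w, w\<close> form a symplectic basis.\<close>

lemma symplectic_companion: "\<exists>C\<in>Sp4Z. W ** C = C ** companion"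
proof -
  obtain u w where u: "u \<in> int_vecs" and w: "w \<in> int_vecs" and uw: "sform u w = 0" "sform (W *v u) w = 1"
    using unimodular_pair by blast
  define col :: "2+2 \<Rightarrow> real^(2+2)" where
    "col j = (case j of Inl k \<Rightarrow> (if k = 1 then u else W *v u)
       | Inr k \<Rightarrow> (if k = 1 then W *v w - of_int t *\<^sub>R w else w))" for j
  define C :: mat4 where "C = (\<chi> i j. col j $ i)"
  have cols [simp]: "col (Inl 1) = u" "col (Inl 2) = W *v u"
    "col (Inr 1) = W *v w - of_int t *\<^sub>R w" "col (Inr 2) = w"
    by (simp_all add: col_def)
  have self: "sform v v = 0" for v using sform_skew[of v v] by simp
  have selfW: "sform (W *v v) v = 0" "sform v (W *v v) = 0" for v
    using sform_skew[of v "W *v v"] sform_W[of v v] by simp_all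
  \<comment> \<open>These values explain the third column: subtracting t w from W w keeps the
    pairing with u equal to 1 and makes the pairing with W u zero.\<close>
  have uw': "sform u (W *v w) = 1" "sform (W *v u) (W *v w) = of_int t"
    using uw by (simp_all add: sform_W[symmetric] W_W sform_bilinear)
  have wu: "sform w u = 0" "sform w (W *v u) = - 1" "sform (W *v w) u = - 1"
    "sform (W *v w) (W *v u) = - of_int t"
    using uw uw' sform_skew[of w u] sform_skew[of w "W *v u"] sform_skew[of "W *v w" u]
      sform_skew[of "W *v w" "W *v u"] by simp_all
  have entry: "(transpose C ** Jm ** C) $ i $ j = sform (col i) (col j)" for i j
  proof -
    have "(transpose C ** Jm ** C) $ i $ j = (\<Sum>k\<in>UNIV. \<Sum>l\<in>UNIV. col i $ l * Jm $ l $ k * col j $ k)"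
      by (simp add: C_def matrix_matrix_mult_def sum_distrib_right)
    also have "\<dots> = (\<Sum>l\<in>UNIV. \<Sum>k\<in>UNIV. col i $ l * Jm $ l $ k * col j $ k)"
      by (rule sum.swap)
    also have "\<dots> = sform (col i) (col j)"
      by (simp add: sform_def inner_vec_def matrix_vector_mult_def sum_distrib_left mult.assoc)
    finally show ?thesis .
  qed
  have "transpose C ** Jm ** C = Jm"
    unfolding vec_eq_iff forall_sum22 entry
    by (simp add: Jm_def sform_bilinear self selfW uw uw' wu)
  moreover have "C \<in> int_mats"
  proof -
    have "u \<in> int_vecs" "W *v u \<in> int_vecs" "W *v w - of_int t *\<^sub>R w \<in> int_vecs" "w \<in> int_vecs"
      using u w by (auto intro!: int_vecs_diff int_vecs_scale int_vecs_matrix W_int)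
    then show ?thesis
      by (simp add: int_mats_def C_def int_vecs_def forall_sum22)
  qed
  moreover have "W ** C = C ** companion"
  proof -
    have 1: "(W ** C) $ i $ j = (W *v col j) $ i" for i j
      by (simp add: C_def matrix_matrix_mult_def matrix_vector_mult_def)
    have 2: "(C ** companion) $ i $ j = (\<Sum>k\<in>UNIV. companion $ k $ j *\<^sub>R col k) $ i" for i j
      by (simp add: C_def matrix_matrix_mult_def mult.commute)
    have "W *v col j = (\<Sum>k\<in>UNIV. companion $ k $ j *\<^sub>R col k)" for j
    proof -
      have "\<forall>j. W *v col j = (\<Sum>k\<in>UNIV. companion $ k $ j *\<^sub>R col k)"
        unfolding forall_sum22
        by (simp add: sum_UNIV_sum22 companion_def W_W matrix_vector_mult_diff_distrib
            matrix_vector_mult_scaleR algebra_simps)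
      then show ?thesis by blast
    qed
    then show ?thesis by (simp add: vec_eq_iff 1 2)
  qed
  ultimately show ?thesis by (auto simp: Sp4Z_iff Sp4R_iff)
qed

end

subsection \<open>Triviality of cocycles and fixed points in the Siegel space\<close>

definition quad_gen :: "int \<Rightarrow> complex" where
  "quad_gen d = (if d mod 4 = 1 then (1 + csqrt (of_int d)) / 2 else csqrt (of_int d))"

definition quad_tr :: "int \<Rightarrow> int" where
  "quad_tr d = (if d mod 4 = 1 then 1 else 0)"

text \<open>Minus the norm of \<open>quad_gen d\<close>, the sign fitting om^2 = t om + n.\<close>

definition quad_nm :: "int \<Rightarrow> int" where
  "quad_nm d = (if d mod 4 = 1 then (d - 1) div 4 else d)"

lemma quad_nm_real: "d mod 4 = 1 \<Longrightarrow> of_int (quad_nm d) = (of_int d - 1 :: 'a::field_char_0) / 4"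
proof -
  assume "d mod 4 = 1"
  then have "d = 1 + 4 * quad_nm d" unfolding quad_nm_def by presburger
  then have "(of_int d :: 'a) = 1 + 4 * of_int (quad_nm d)"
    by (metis of_int_1 of_int_add of_int_mult of_int_numeral)
  then show ?thesis by simp
qed

lemma quad_gen_square: "quad_gen d * quad_gen d = of_int (quad_tr d) * quad_gen d + of_int (quad_nm d)"
proof -
  have s2: "csqrt (of_int d) * csqrt (of_int d) = of_int d"
    by (metis power2_csqrt power2_eq_square)
  show ?thesis
  proof (cases "d mod 4 = 1")
    case True
    then show ?thesis
      using s2 by (simp add: quad_gen_def quad_tr_def quad_nm_real field_simps)
  next
    case False
    then show ?thesis using s2 by (simp add: quad_gen_def quad_tr_def quad_nm_def)
  qed
qed

lemma quad_ints_gen: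
  assumes d: "d < 0" "squarefree d" "principal_domain (quad_int_ring d)"
  shows "quad_ints d = {of_int p + of_int q * quad_gen d | p q. True}"
proof (intro equalityI subsetI)
  fix x assume x: "x \<in> quad_ints d"
  define a b where "a = coord_a x" and "b = coord_b d x"
  have x_eq: "x = of_real a + of_real b * csqrt (of_int d)"
    unfolding a_def b_def by (rule coord_decomp[OF d(1)])
  show "x \<in> {of_int p + of_int q * quad_gen d | p q. True}"
  proof (cases "d mod 4 = 1")
    case True
    then obtain k l where "a + b = of_int k" "2 * b = of_int l"
      using x quad_ints_coords[OF d] by (auto simp: a_def b_def elim!: Ints_cases)
    then have ab: "b = of_int l / 2" "a = of_int k - of_int l / 2" by simp_all
    have "x = of_int (k - l) + of_int l * quad_gen d"
      using True unfolding x_eq ab by (simp add: quad_gen_def field_simps)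
    then show ?thesis by blast
  next
    case False
    then obtain k l where ab: "a = of_int k" "b = of_int l"
      using x quad_ints_coords[OF d] by (auto simp: a_def b_def elim!: Ints_cases)
    have "x = of_int k + of_int l * quad_gen d"
      using False unfolding x_eq ab by (simp add: quad_gen_def)
    then show ?thesis by blast
  qed
next
  fix x assume "x \<in> {of_int p + of_int q * quad_gen d | p q. True}"
  then obtain p q where x: "x = of_int p + of_int q * quad_gen d" by blast
  show "x \<in> quad_ints d"
  proof (cases "d mod 4 = 1")
    case True
    have "x = of_real (of_int p + of_int q / 2) + of_real (of_int q / 2) * csqrt (of_int d)"
      using True by (simp add: x quad_gen_def field_simps)
    then have "coord_a x = of_int p + of_int q / 2" "coord_b d x = of_int q / 2"
      by (metis coord_of_real[OF d(1)])+
    then have "coord_a x + coord_b d x = of_int (p + q)" "2 * coord_b d x = of_int q" by simp_all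
    then show ?thesis using True unfolding quad_ints_coords[OF d] by (metis Ints_of_int)
  next
    case False
    have "x = of_real (of_int p) + of_real (of_int q) * csqrt (of_int d)"
      using False by (simp add: x quad_gen_def)
    then have "coord_a x = of_int p" "coord_b d x = of_int q"
      by (metis coord_of_real[OF d(1)])+
    then show ?thesis using False unfolding quad_ints_coords[OF d] by simp
  qed
qed

lemma quad_gen_nonreal: "d < 0 \<Longrightarrow> Im (quad_gen d) \<noteq> 0"
  by (simp add: quad_gen_def)

text \<open>The companion form is that of W, which is (1 + P)/2 for \<open>d mod 4 = 1\<close>; 2 W
  - 1 turns it back into a form for P. It depends on \<open>d\<close> alone, so any two such P are
  conjugate in \<open>Sp4Z\<close>.\<close>

definition normal_form :: "int \<Rightarrow> mat4" where
  "normal_form d = (let K = quad_lattice.companion (quad_tr d) (quad_nm d)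
     in if d mod 4 = 1 then 2 *\<^sub>R K - mat 1 else K)"

lemma symplectic_normal_form:
  assumes d: "d < 0" "squarefree d" "principal_domain (quad_int_ring d)"
    and P: "P \<in> int_mats" "P ** P = of_int d *\<^sub>R mat 1" "transpose P ** Jm = Jm ** P"
    and half: "d mod 4 = 1 \<Longrightarrow> (1/2) *\<^sub>R (mat 1 + P) \<in> int_mats"
  shows "\<exists>C\<in>Sp4Z. P ** C = C ** normal_form d"
proof -
  define W where "W = (if d mod 4 = 1 then (1/2) *\<^sub>R (mat 1 + P) else P)"
  interpret quad_lattice d "quad_gen d" "quad_tr d" "quad_nm d" W
  proof (rule quad_lattice.intro)
    show "quad_gen d * quad_gen d = of_int (quad_tr d) * quad_gen d + of_int (quad_nm d)"
      by (rule quad_gen_square)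
    show "Im (quad_gen d) \<noteq> 0" by (rule quad_gen_nonreal[OF d(1)])
    show "quad_ints d = {of_int p + of_int q * quad_gen d | p q. True}" by (rule quad_ints_gen[OF d])
    show "principal_domain (quad_int_ring d)" by (rule d)
    show "W \<in> int_mats" using P half by (simp add: W_def)
    show "W ** W = of_int (quad_tr d) *\<^sub>R W + of_int (quad_nm d) *\<^sub>R mat 1"
    proof (cases "d mod 4 = 1")
      case True
      have dm: "real_of_int d = 1 + 4 * of_int (quad_nm d)"
        using quad_nm_real[OF True, where 'a = real] by simp
      show ?thesis
        using True by (simp add: W_def quad_tr_def mat_ring_simps P(2) dm)
          (simp add: algebra_simps vec_eq_iff)
    next
      case False
      then show ?thesis by (simp add: W_def quad_tr_def quad_nm_def P(2))
    qed
    show "transpose W ** Jm = Jm ** W"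
      using P(3) by (simp add: W_def mat_ring_simps scaleR_add_right)
  qed
  obtain C where C: "C \<in> Sp4Z" "W ** C = C ** companion"
    using symplectic_companion by blast
  have "P ** C = C ** normal_form d"
  proof (cases "d mod 4 = 1")
    case True
    then have "P = 2 *\<^sub>R W - mat 1" by (simp add: W_def)
    then have "P ** C = 2 *\<^sub>R (W ** C) - C" by (simp add: mat_ring_simps)
    also have "\<dots> = C ** normal_form d"
      using True by (simp add: C(2) normal_form_def mat_ring_simps)
    finally show ?thesis .
  next
    case False
    then show ?thesis using C(2) by (simp add: W_def normal_form_def)
  qed
  with C(1) show ?thesis by blast
qed

lemma cocycle_normal_form:
  assumes d: "d < 0" "squarefree d" "principal_domain (quad_int_ring d)"
    and N: "d mod 4 = 1 \<longrightarrow> even N"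
    and g: "g \<in> GammaSp N" "hat d g ** g = mat 1"
  shows "\<exists>C\<in>Sp4Z. Nbeta d ** g ** C = C ** normal_form d"
proof (rule symplectic_normal_form[OF d])
  define P where "P = Nbeta d ** g"
  have d0: "d \<noteq> 0" using d by simp
  have gR: "g \<in> Sp4R" using g(1) by (simp add: GammaSp_iff)
  obtain Y where Y: "Y \<in> int_mats" "g = mat 1 + real N *\<^sub>R Y"
    using g(1) by (auto simp: GammaSp_iff)
  have "g \<in> int_mats" using g(1) GammaSp_subset[of N] by (auto simp: Sp4Z_iff)
  then show "Nbeta d ** g \<in> int_mats"
    by (simp add: int_mats_mult int_mats_Nbeta)
  have "(1 / of_int d) *\<^sub>R (P ** P) = mat 1"
    using g(2) by (simp add: hat_eq[OF d0] P_def matrix_scaleR_left matrix_mul_assoc)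
  then have "of_int d *\<^sub>R ((1 / of_int d) *\<^sub>R (P ** P)) = of_int d *\<^sub>R mat 1" by simp
  then have P2: "P ** P = of_int d *\<^sub>R mat 1" using d0 by simp
  then show "Nbeta d ** g ** (Nbeta d ** g) = of_int d *\<^sub>R mat 1" by (simp add: P_def)
  have "transpose P ** Jm ** P = transpose g ** (transpose (Nbeta d) ** Jm ** Nbeta d) ** g"
    by (simp add: P_def matrix_transpose_mul matrix_mul_assoc)
  also have "\<dots> = of_int d *\<^sub>R Jm"
    using gR by (simp add: Nbeta_symplectic mat_ring_simps Sp4R_iff)
  \<comment> \<open>Being a similitude with multiplier \<open>d\<close> and squaring to
    \<open>d\<close> together give self-adjointness: multiply P^t J P = d J by P on the
    right.\<close>
  finally have "transpose P ** Jm ** (P ** P) = of_int d *\<^sub>R (Jm ** P)"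
    by (simp add: matrix_mul_assoc matrix_scaleR_left)
  then show "transpose (Nbeta d ** g) ** Jm = Jm ** (Nbeta d ** g)"
    using d0 unfolding P2 P_def[symmetric] by (simp add: matrix_scalar_ac)
  show "(1/2) *\<^sub>R (mat 1 + Nbeta d ** g) \<in> int_mats" if d4: "d mod 4 = 1"
  proof -
    from N d4 obtain k where k: "N = 2 * k" by auto
    \<comment> \<open>For \<open>d mod 4 = 1\<close> the diagonal of \<open>beta d\<close> is odd
      and its other entries are even, so 1 + \<open>Nbeta d\<close> is divisible by 2. The part of
      \<open>g\<close> beyond 1 is divisible by N = 2k.\<close>
    define B where "B = (1/2) *\<^sub>R (mat 1 + Nbeta d)"
    have "B \<in> int_mats"
      using d4 by (simp add: B_def int_mats_def forall_sum22 forall_2 Nbeta_def beta_def mat_def)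
    moreover have "(1/2) *\<^sub>R (mat 1 + Nbeta d ** g) = B + real k *\<^sub>R (Nbeta d ** Y)"
      by (simp add: B_def Y(2) k mat_ring_simps algebra_simps)
    ultimately show ?thesis
      using Y(1) by (simp add: int_mats_add int_mats_scale int_mats_mult int_mats_Nbeta)
  qed
qed

lemma cocycle_is_coboundary:
  assumes d: "d < 0" "squarefree d" "principal_domain (quad_int_ring d)"
    and N: "d mod 4 = 1 \<longrightarrow> even N"
    and g: "g \<in> Gamma_N d N" "hat d g ** g = mat 1"
  obtains h where "h \<in> GammaTilde d N" "g = hat d h ** matrix_inv h"
proof -
  have d0: "d \<noteq> 0" using d by simp
  have "g \<in> GammaSp N" using g(1) d0 by (simp add: Gamma_N_iff)
  then obtain C where C: "C \<in> Sp4Z" "Nbeta d ** g ** C = C ** normal_form d"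
    using cocycle_normal_form[OF d N _ g(2)] by blast
  \<comment> \<open>The trivial cocycle supplies a basis putting \<open>Nbeta d\<close> itself into
    normal form.\<close>
  have "hat d (mat 1) ** mat 1 = mat 1" by (simp add: hat_one d0)
  then obtain C0 where C0: "C0 \<in> Sp4Z" "Nbeta d ** C0 = C0 ** normal_form d"
    using cocycle_normal_form[OF d N GammaSp_one] by auto
  define h where "h = C ** matrix_inv C0"
  have h: "h \<in> Sp4Z" unfolding h_def by (intro Sp4Z_mult Sp4Z_inv C C0)
  have hR: "h \<in> Sp4R" and C0R: "C0 \<in> Sp4R" using h C0(1) by (simp_all add: Sp4Z_iff)
  have "matrix_inv C0 ** Nbeta d = matrix_inv C0 ** (Nbeta d ** C0) ** matrix_inv C0"
    by (simp add: Sp4R_inv(3)[OF C0R] flip: matrix_mul_assoc)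
  also have "\<dots> = normal_form d ** matrix_inv C0"
    unfolding C0(2) by (simp add: matrix_mul_assoc Sp4R_inv(2)[OF C0R])
  finally have "matrix_inv C0 ** Nbeta d = normal_form d ** matrix_inv C0" .
  then have "h ** Nbeta d = C ** normal_form d ** matrix_inv C0"
    by (simp add: h_def flip: matrix_mul_assoc)
  also have "\<dots> = Nbeta d ** g ** h"
    by (simp add: h_def matrix_mul_assoc flip: C(2))
  finally have "hat d h = (1 / of_int d) *\<^sub>R (Nbeta d ** (Nbeta d ** (g ** h)))"
    unfolding hat_eq[OF d0] by (simp add: flip: matrix_mul_assoc)
  then have "hat d h = g ** h" using d0 by (simp add: Nbeta_Nbeta)
  then have eq: "g = hat d h ** matrix_inv h"
    by (simp add: Sp4R_inv(3)[OF hR] flip: matrix_mul_assoc)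
  then have "h \<in> GammaTilde d N" using h g(1) by (simp add: GammaTilde_def)
  with eq show thesis using that by blast
qed

section \<open>The image of hyperbolic space as the fixed set of the involution\<close>

lemma siegel_congruence:
  assumes BA: "B ** A = mat 1" and Z: "Z \<in> siegel"
  shows "cmat A ** Z ** transpose (cmat A) \<in> siegel"
proof -
  \<comment> \<open>A block diagonal symplectic matrix whose fractional action is the congruence by
    A.\<close>
  define g where "g = blk A 0 0 (transpose B)"
  have "transpose A ** transpose B = mat 1"
    by (simp add: BA flip: matrix_transpose_mul)
  then have g: "g \<in> Sp4R"
    by (simp add: g_def Sp4R_def matrix_zero_left matrix_zero_right transpose_zero)
  have z: "cmat 0 = 0" by (simp add: cmat_def vec_eq_iff)
  have "transpose (cmat A) ** transpose (cmat B) = mat 1"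
    using BA by (metis cmat_simps(1,4,5) matrix_transpose_mul transpose_mat)
  then have "matrix_inv (transpose (cmat B)) = transpose (cmat A)"
    by (rule matrix_inv_eqI)
  then have "sp_act g Z = cmat A ** Z ** transpose (cmat A)"
    by (simp add: g_def sp_act_def z matrix_zero_left cmat_simps)
  then show ?thesis using sp_act_siegel[OF g Z] by simp
qed

definition h3_mat :: "int \<Rightarrow> complex \<times> real \<Rightarrow> complex^2^2" where
  "h3_mat d = (\<lambda>(z, r). mat22 z (of_real r) (of_real r) (of_int d * cnj z))"

lemma phiH_eq: "phiH d x = cmat (sigma d) ** h3_mat d x ** transpose (cmat (sigma d))"
  by (cases x) (simp add: phiH_def h3_mat_def)

text \<open>The imaginary part is Im z times the diagonal matrix with entries 1 and -d, and the
  latter is positive definite since d < 0.\<close>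

lemma h3_mat_siegel_iff:
  assumes d: "d < 0"
  shows "h3_mat d (z, r) \<in> siegel \<longleftrightarrow> Im z > 0"
proof -
  have q: "v \<bullet> (im_mat (h3_mat d (z, r)) *v v) = Im z * ((v $ 1)\<^sup>2 - of_int d * (v $ 2)\<^sup>2)" for v :: "real^2"
    by (simp add: h3_mat_def im_mat_def inner_vec_def matrix_vector_mult_def sum_2 power2_eq_square algebra_simps)
  have t: "transpose (h3_mat d (z, r)) = h3_mat d (z, r)"
    by (simp add: h3_mat_def matrix22_eq_iff)
  have pos: "(v $ 1)\<^sup>2 - of_int d * (v $ 2)\<^sup>2 > 0" if "v \<noteq> 0" for v :: "real^2"
  proof -
    have "v $ 1 \<noteq> 0 \<or> v $ 2 \<noteq> 0" using that by (auto simp: vec_eq_iff forall_2)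
    then have "(v $ 1)\<^sup>2 > 0 \<or> - of_int d * (v $ 2)\<^sup>2 > 0" using d by (auto simp: mult_neg_pos)
    moreover have "(v $ 1)\<^sup>2 \<ge> 0" "- of_int d * (v $ 2)\<^sup>2 \<ge> 0" using d by (auto simp: mult_nonpos_nonneg)
    ultimately show ?thesis by linarith
  qed
  have "Im z > 0" if "\<forall>v::real^2. v \<noteq> 0 \<longrightarrow> Im z * ((v $ 1)\<^sup>2 - of_int d * (v $ 2)\<^sup>2) > 0"
  proof -
    have "(axis 1 1 :: real^2) \<noteq> 0" by simp
    from that[rule_format, OF this] show ?thesis by (simp add: axis_def)
  qed
  then show ?thesis
    using pos by (auto simp: siegel_iff q t)
qed

lemma cmat_sigma_inverse: "cmat (sigma_inv d) ** cmat (sigma d) = mat 1"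
  "cmat (sigma d) ** cmat (sigma_inv d) = mat 1"
  "transpose (cmat (sigma d)) ** transpose (cmat (sigma_inv d)) = mat 1"
  by (simp_all add: sigma_inverse flip: cmat_simps matrix_transpose_mul)

lemma cmat_sigma_inverse_assoc: "cmat (sigma_inv d) ** (cmat (sigma d) ** X) = X"
  "cmat (sigma d) ** (cmat (sigma_inv d) ** X) = X"
  by (simp_all add: matrix_mul_assoc cmat_sigma_inverse)

lemma phiH_siegel:
  assumes "d < 0" "x \<in> H3"
  shows "phiH d x \<in> siegel"
  unfolding phiH_eq
  using assms by (intro siegel_congruence[of "sigma_inv d"] sigma_inverse)
    (auto simp: H3_def h3_mat_siegel_iff)

lemma phiH_inj:
  assumes "phiH d x = phiH d y"
  shows "x = y"
proof -
  have inv: "cmat (sigma_inv d) ** phiH d x ** transpose (cmat (sigma_inv d)) = h3_mat d x" for x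
    unfolding phiH_eq
    by (simp add: cmat_sigma_inverse cmat_sigma_inverse_assoc flip: matrix_mul_assoc)
  have "h3_mat d x = h3_mat d y"
    using assms inv[of x] inv[of y] by simp
  then show ?thesis
    by (cases x; cases y) (auto simp: h3_mat_def matrix22_eq_iff)
qed

lemma hatZ_sigma:
  assumes d: "d \<noteq> 0"
  shows "hatZ d (cmat (sigma d) ** Z ** transpose (cmat (sigma d)))
    = cmat (sigma d) ** ((1 / of_int d) *\<^sub>R (cmat (beta0 d) ** conj_mat Z ** transpose (cmat (beta0 d))))
       ** transpose (cmat (sigma d))"
proof -
  have 1: "cmat (beta d) ** cmat (sigma d) = cmat (sigma d) ** cmat (beta0 d)"
    by (simp add: beta_sigma flip: cmat_simps)
  have 2: "transpose (cmat (sigma d)) ** transpose (cmat (beta d)) = transpose (cmat (beta0 d)) ** transpose (cmat (sigma d))"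
    by (simp add: 1 flip: matrix_transpose_mul)
  have 3: "cmat (beta d) ** (cmat (sigma d) ** X) = cmat (sigma d) ** (cmat (beta0 d) ** X)" for X
    by (simp add: matrix_mul_assoc 1)
  have 4: "conj_mat (transpose (cmat (sigma d))) = transpose (cmat (sigma d))"
    by (simp add: conj_mat_simps)
  show ?thesis
    by (simp add: hatZ_eq[OF d] conj_mat_simps(1,6,7) 4 mat_ring_simps(1-10) 2 3 flip: matrix_mul_assoc)
qed

lemma hatZ_phiH:
  assumes d: "d < 0"
  shows "hatZ d (phiH d x) = phiH d x"
proof -
  have "(1 / of_int d) *\<^sub>R (cmat (beta0 d) ** conj_mat (h3_mat d x) ** transpose (cmat (beta0 d))) = h3_mat d x"
    using d by (cases x) (simp add: h3_mat_def beta0_def cmat_def conj_mat_def mat22_simps complex_eq_iff)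
  then show ?thesis using d by (simp add: phiH_eq hatZ_sigma)
qed

text \<open>Once \<open>sigma d\<close> is stripped off, being fixed makes the off-diagonal entry
  real and the lower right entry d times the conjugate of the upper left one.\<close>

lemma hatZ_fixed_imp_phiH:
  assumes d: "d < 0" and Z: "Z \<in> siegel" and fixed: "hatZ d Z = Z"
  shows "Z \<in> phiH d ` H3"
proof -
  define h where "h = cmat (sigma_inv d) ** Z ** transpose (cmat (sigma_inv d))"
  have h: "h \<in> siegel" unfolding h_def
    by (rule siegel_congruence[OF sigma_inverse(1) Z])
  have t: "transpose (cmat (sigma_inv d)) ** transpose (cmat (sigma d)) = mat 1"
    by (simp add: cmat_sigma_inverse flip: matrix_transpose_mul)
  have Zh: "Z = cmat (sigma d) ** h ** transpose (cmat (sigma d))"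
    by (simp add: h_def t cmat_sigma_inverse_assoc flip: matrix_mul_assoc)
  define k where "k = (1 / of_int d) *\<^sub>R (cmat (beta0 d) ** conj_mat h ** transpose (cmat (beta0 d)))"
  have "cmat (sigma d) ** k ** transpose (cmat (sigma d)) = cmat (sigma d) ** h ** transpose (cmat (sigma d))"
    using fixed d unfolding Zh k_def by (simp add: hatZ_sigma)
  then have "cmat (sigma d) ** k = cmat (sigma d) ** h"
    by (rule matrix_mult_right_cancel[OF cmat_sigma_inverse(3)])
  then have kh: "k = h"
    by (rule matrix_mult_left_cancel[OF cmat_sigma_inverse(1)])
  have "transpose h = h" using h by (simp add: siegel_iff)
  then have sym: "h $ 2 $ 1 = h $ 1 $ 2" by (metis transpose_component)
  have "k $ 1 $ 2 = cnj (h $ 1 $ 2)" "k $ 2 $ 2 = of_int d * cnj (h $ 1 $ 1)"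
    using d by (simp_all add: k_def matrix22_mult_component beta0_def cmat_def conj_mat_def sym
        complex_eq_iff)
  then have r: "cnj (h $ 1 $ 2) = h $ 1 $ 2" and e: "h $ 2 $ 2 = of_int d * cnj (h $ 1 $ 1)"
    unfolding kh by simp_all
  from r have "of_real (Re (h $ 1 $ 2)) = h $ 1 $ 2"
    by (simp add: complex_eq_iff)
  then have hm: "h = h3_mat d (h $ 1 $ 1, Re (h $ 1 $ 2))"
    using sym e by (simp add: h3_mat_def matrix22_eq_iff)
  with h have "Im (h $ 1 $ 1) > 0" using h3_mat_siegel_iff[OF d] by metis
  then have "(h $ 1 $ 1, Re (h $ 1 $ 2)) \<in> H3" by (simp add: H3_def)
  moreover have "Z = phiH d (h $ 1 $ 1, Re (h $ 1 $ 2))"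
    unfolding phiH_eq hm[symmetric] by (rule Zh)
  ultimately show ?thesis by blast
qed

text \<open>Used for the coboundary map from \<open>GammaTilde d N\<close> onto the cocycles. One
  direction of \<open>iff\<close> makes the induced map well defined, the other makes it
  injective.\<close>

lemma bij_betw_quotient:
  assumes r: "equiv A r" and s: "equiv B s" and f: "f ` A = B"
    and iff: "\<And>x y. x \<in> A \<Longrightarrow> y \<in> A \<Longrightarrow> (x, y) \<in> r \<longleftrightarrow> (f x, f y) \<in> s"
  shows "\<exists>\<Phi>. bij_betw \<Phi> (A // r) (B // s) \<and> (\<forall>a\<in>A. \<Phi> (r `` {a}) = s `` {f a})"
proof -
  define \<Phi> where "\<Phi> X = (\<Union>x\<in>X. s `` {f x})" for X
  have fB: "f a \<in> B" if "a \<in> A" for a using f that by blast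
  have "(\<lambda>x. s `` {f x}) respects r"
  proof (rule congruentI)
    fix y z assume "(y, z) \<in> r"
    moreover from this have "y \<in> A" "z \<in> A" using r by (auto simp: equiv_def refl_on_def)
    ultimately show "s `` {f y} = s `` {f z}"
      using iff equiv_class_eq[OF s] by blast
  qed
  then have \<Phi>: "\<Phi> (r `` {a}) = s `` {f a}" if "a \<in> A" for a
    unfolding \<Phi>_def using UN_equiv_class[OF r _ that] by blast
  have "bij_betw \<Phi> (A // r) (B // s)"
  proof (rule bij_betwI')
    fix X Y assume "X \<in> A // r" "Y \<in> A // r"
    then obtain a b where ab: "a \<in> A" "b \<in> A" "X = r `` {a}" "Y = r `` {b}"
      by (auto elim!: quotientE)
    show "\<Phi> X = \<Phi> Y \<longleftrightarrow> X = Y"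
      using ab iff[of a b] eq_equiv_class_iff[OF r, of a b] eq_equiv_class_iff[OF s, of "f a" "f b"]
      by (simp add: \<Phi> fB)
  next
    fix X assume "X \<in> A // r"
    then obtain a where "a \<in> A" "X = r `` {a}" by (auto elim!: quotientE)
    then show "\<Phi> X \<in> B // s" by (simp add: \<Phi> fB quotientI)
  next
    fix Y assume "Y \<in> B // s"
    then obtain b where b: "b \<in> B" "Y = s `` {b}" by (auto elim!: quotientE)
    then obtain a where "a \<in> A" "b = f a" using f by blast
    then show "\<exists>X\<in>A // r. Y = \<Phi> X"
      using b by (intro bexI[of _ "r `` {a}"]) (simp_all add: \<Phi> quotientI)
  qed
  with \<Phi> show ?thesis by blast
qed

subsection \<open>The real points\<close>

lemma equiv_on_setI:
  assumes sub: "r \<subseteq> A \<times> A" and refl: "\<And>x. x \<in> A \<Longrightarrow> (x, x) \<in> r"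
    and sym: "\<And>x y. (x, y) \<in> r \<Longrightarrow> (y, x) \<in> r"
    and trans: "\<And>x y z. (x, y) \<in> r \<Longrightarrow> (y, z) \<in> r \<Longrightarrow> (x, z) \<in> r"
  shows "equiv A r"
proof (rule equivI[OF sub])
  show "refl_on A r" using refl by (rule refl_onI)
  show "sym r" using sym by (rule symI)
  show "trans r" using trans by (rule transI)
qed

text \<open>\<open>f\<close> need not be constant on classes; it only has to separate them. It will
  be the reduction of matrix entries modulo an integer.\<close>

lemma finite_quotient_invariant:
  assumes fin: "finite (f ` A)" and r: "equiv A r"
    and f: "\<And>x y. x \<in> A \<Longrightarrow> y \<in> A \<Longrightarrow> f x = f y \<Longrightarrow> (x, y) \<in> r"
  shows "finite (A // r)"
proof (rule finite_subset)
  show "A // r \<subseteq> (\<lambda>m. r `` {SOME x. x \<in> A \<and> f x = m}) ` (f ` A)"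
  proof
    fix X assume "X \<in> A // r"
    then obtain a where a: "a \<in> A" "X = r `` {a}" by (auto elim!: quotientE)
    define b where "b = (SOME x. x \<in> A \<and> f x = f a)"
    have "b \<in> A \<and> f b = f a"
      unfolding b_def by (rule someI[of _ a]) (use a in simp)
    then have "(a, b) \<in> r" using f[of a b] a(1) by simp
    then have "X = r `` {b}" using equiv_class_eq[OF r] a(2) by blast
    then show "X \<in> (\<lambda>m. r `` {SOME x. x \<in> A \<and> f x = m}) ` (f ` A)"
      using a(1) unfolding b_def by blast
  qed
qed (use fin in simp)

locale real_points =
  fixes d :: int and N :: nat
  assumes d: "d < 0" "squarefree d" "principal_domain (quad_int_ring d)"
    and N3: "N \<ge> 3" and N_even: "d mod 4 = 1 \<longrightarrow> even N"
begin

abbreviation "\<Gamma> \<equiv> Gamma_N d N"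

text \<open>By \<open>F_eq\<close> this is the embedded \<open>Lambda d\<close>. Described as a
  fixed group, it inherits its group laws from the multiplicativity of \<open>hat d\<close>.\<close>

definition F :: "mat4 set" where
  "F = {g \<in> Sp4Z. hat d g = g}"

lemma d0: "d \<noteq> 0"
  using d by simp

lemmas \<Gamma>_one = Gamma_N_one[OF d0, of N]
  and \<Gamma>_mult = Gamma_N_mult[OF d0, of _ N]
  and \<Gamma>_inv = Gamma_N_inv[OF d0, of _ N]
  and \<Gamma>_hat = Gamma_N_hat[OF d0, of _ N]
  and \<Gamma>_R = Gamma_N_Sp4R[OF d0, of _ N]
  and \<Gamma>_Z = Gamma_N_Sp4Z[OF d0, of _ N]
  and \<Gamma>_free = Gamma_N_free[OF d0 N3]

lemmas GT_R = GammaTilde_Sp4R[OF d0, of _ N]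
  and GT_Z = GammaTilde_Sp4Z[OF d0, of _ N]
  and GT_mult = GammaTilde_mult[OF d0, of _ N]
  and GT_inv = GammaTilde_inv[OF d0, of _ N]
  and GT_\<Gamma> = Gamma_N_subset_GammaTilde[OF d0, of _ N]

lemma F_eq: "phiSL d ` Lambda d = F"
  unfolding F_def by (rule phiSL_Lambda[OF d])

lemma F_\<Gamma>_eq: "phiSL d ` LambdaN d N = F \<inter> \<Gamma>"
  using phiSL_LambdaN[OF d, of N] N3 \<Gamma>_Z by (auto simp: F_def)

lemma F_R: "h \<in> F \<Longrightarrow> h \<in> Sp4R"
  by (simp add: F_def Sp4Z_iff)

lemma F_hat: "h \<in> F \<Longrightarrow> hat d h = h"
  by (simp add: F_def)

lemma F_one: "mat 1 \<in> F"
  by (simp add: F_def Sp4Z_one hat_one d0)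

lemma F_mult: "g \<in> F \<Longrightarrow> h \<in> F \<Longrightarrow> g ** h \<in> F"
  by (simp add: F_def Sp4Z_mult hat_mult d0)

lemma F_inv: "h \<in> F \<Longrightarrow> matrix_inv h \<in> F"
  using F_R[of h] by (auto simp: F_def Sp4Z_inv simp flip: hat_inv[OF d0])

lemma inv_act:
  assumes g: "g \<in> Sp4R" and Z: "Z \<in> siegel"
  shows "sp_act (matrix_inv g) (sp_act g Z) = Z" "sp_act g (sp_act (matrix_inv g) Z) = Z"
  using sp_act_mult[OF Sp4R_inv(4)[OF g] g Z] sp_act_mult[OF g Sp4R_inv(4)[OF g] Z]
  by (simp_all add: Sp4R_inv(2,3) g sp_act_one)

lemma X_rel_iff: "(Z, Z') \<in> X_rel d N \<longleftrightarrow> Z \<in> siegel \<and> (\<exists>g\<in>\<Gamma>. Z' = sp_act g Z)"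
  using sp_act_siegel \<Gamma>_R by (auto simp: X_rel_def orbit_rel_def)

lemma X_equiv: "equiv siegel (X_rel d N)"
proof (rule equiv_on_setI)
  show "X_rel d N \<subseteq> siegel \<times> siegel"
    by (auto simp: X_rel_def orbit_rel_def)
  show "(Z, Z) \<in> X_rel d N" if "Z \<in> siegel" for Z
    using that \<Gamma>_one by (auto simp: X_rel_iff intro!: bexI[of _ "mat 1"] simp: sp_act_one)
  show "(Z', Z) \<in> X_rel d N" if "(Z, Z') \<in> X_rel d N" for Z Z'
  proof -
    obtain g where g: "Z \<in> siegel" "g \<in> \<Gamma>" "Z' = sp_act g Z" using \<open>(Z, Z') \<in> _\<close> by (auto simp: X_rel_iff)
    then have "Z = sp_act (matrix_inv g) Z'" using inv_act \<Gamma>_R by simp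
    moreover have "Z' \<in> siegel" using g sp_act_siegel[OF \<Gamma>_R] by simp
    ultimately show ?thesis using \<Gamma>_inv[OF g(2)] unfolding X_rel_iff by blast
  qed
  show "(Z, Z'') \<in> X_rel d N" if ZZ: "(Z, Z') \<in> X_rel d N" "(Z', Z'') \<in> X_rel d N" for Z Z' Z''
  proof -
    obtain g g' where g: "Z \<in> siegel" "g \<in> \<Gamma>" "Z' = sp_act g Z" "g' \<in> \<Gamma>" "Z'' = sp_act g' Z'"
      using ZZ unfolding X_rel_iff by blast
    then have "Z'' = sp_act (g' ** g) Z" by (simp add: sp_act_mult \<Gamma>_R)
    then show ?thesis using g(1) \<Gamma>_mult[OF g(4,2)] unfolding X_rel_iff by blast
  qed
qed

section \<open>Orbits in the Siegel space and in hyperbolic space\<close>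

definition orb :: "complex^2^2 \<Rightarrow> (complex^2^2) set" where
  "orb Z = X_rel d N `` {Z}"

lemma orb_eq_iff: "Z \<in> siegel \<Longrightarrow> Z' \<in> siegel \<Longrightarrow> orb Z = orb Z' \<longleftrightarrow> (Z, Z') \<in> X_rel d N"
  unfolding orb_def by (rule eq_equiv_class_iff[OF X_equiv])

lemma orb_eq: "Z \<in> siegel \<Longrightarrow> orb Z = {sp_act g Z | g. g \<in> \<Gamma>}"
  by (auto simp: orb_def X_rel_iff)

lemma orb_act: "Z \<in> siegel \<Longrightarrow> g \<in> \<Gamma> \<Longrightarrow> orb (sp_act g Z) = orb Z"
  using orb_eq_iff[of Z "sp_act g Z"] sp_act_siegel[OF \<Gamma>_R] by (auto simp: X_rel_iff)

lemma hatZ_orb: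
  assumes Z: "Z \<in> siegel"
  shows "hatZ d ` orb Z = orb (hatZ d Z)"
proof -
  have *: "hatZ d (sp_act g Z) = sp_act (hat d g) (hatZ d Z)" if "g \<in> \<Gamma>" for g
    by (rule hatZ_sp_act[OF d(1) \<Gamma>_R[OF that] Z])
  have **: "sp_act g (hatZ d Z) = hatZ d (sp_act (hat d g) Z)" if "g \<in> \<Gamma>" for g
    using *[OF \<Gamma>_hat[OF that]] by (simp add: hat_hat d0)
  show ?thesis
    unfolding orb_eq[OF Z] orb_eq[OF hatZ_siegel[OF d(1) Z]]
  proof (intro equalityI subsetI)
    fix x assume "x \<in> hatZ d ` {sp_act g Z | g. g \<in> \<Gamma>}"
    then obtain g where "g \<in> \<Gamma>" "x = hatZ d (sp_act g Z)" by blast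
    then show "x \<in> {sp_act g (hatZ d Z) | g. g \<in> \<Gamma>}" using * \<Gamma>_hat by blast
  next
    fix x assume "x \<in> {sp_act g (hatZ d Z) | g. g \<in> \<Gamma>}"
    then obtain g where "g \<in> \<Gamma>" "x = sp_act g (hatZ d Z)" by blast
    then show "x \<in> hatZ d ` {sp_act g Z | g. g \<in> \<Gamma>}" using ** \<Gamma>_hat by blast
  qed
qed

lemma phiH_in [simp]: "w \<in> H3 \<Longrightarrow> phiH d w \<in> siegel"
  by (rule phiH_siegel[OF d(1)])

text \<open>Elements of \<open>F\<close> commute with the involution on \<open>siegel\<close>, so
  they preserve its fixed set, which is the image of \<open>H3\<close>.\<close>

lemma F_phiH:
  assumes h: "h \<in> F" and w: "w \<in> H3"
  shows "\<exists>w'\<in>H3. phiH d w' = sp_act h (phiH d w)"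
proof -
  have "hatZ d (sp_act h (phiH d w)) = sp_act h (phiH d w)"
    by (simp add: hatZ_sp_act d F_R[OF h] w F_hat[OF h] hatZ_phiH)
  then have "sp_act h (phiH d w) \<in> phiH d ` H3"
    using hatZ_fixed_imp_phiH[OF d(1)] sp_act_siegel[OF F_R[OF h] phiH_in[OF w]] by blast
  then show ?thesis by auto
qed

lemma h3_act_eq:
  assumes l: "l \<in> Lambda d" and w: "w \<in> H3"
  shows "h3_act d l w \<in> H3 \<and> phiH d (h3_act d l w) = sp_act (phiSL d l) (phiH d w)"
  unfolding h3_act_def
proof (rule theI')
  have "phiSL d l \<in> F" using l F_eq by blast
  then obtain w' where "w' \<in> H3" "phiH d w' = sp_act (phiSL d l) (phiH d w)"
    using F_phiH w by blast
  then show "\<exists>!y. y \<in> H3 \<and> phiH d y = sp_act (phiSL d l) (phiH d w)"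
    using phiH_inj by metis
qed

definition W_rel :: "((complex \<times> real) \<times> (complex \<times> real)) set" where
  "W_rel = orbit_rel (LambdaN d N) (h3_act d) H3"

lemma W_rel_iff: "(w, w') \<in> W_rel \<longleftrightarrow> w \<in> H3 \<and> w' \<in> H3 \<and> (\<exists>h\<in>F \<inter> \<Gamma>. phiH d w' = sp_act h (phiH d w))"
proof -
  have "w' = h3_act d l w \<longleftrightarrow> phiH d w' = sp_act (phiSL d l) (phiH d w)"
    if "w \<in> H3" "w' \<in> H3" "l \<in> LambdaN d N" for l
  proof -
    have "l \<in> Lambda d" using that by (simp add: LambdaN_def)
    then show ?thesis using h3_act_eq[OF _ that(1)] phiH_inj by metis
  qed
  then show ?thesis
    unfolding W_rel_def orbit_rel_def F_\<Gamma>_eq[symmetric] by auto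
qed

lemma W_equiv: "equiv H3 W_rel"
proof (rule equiv_on_setI)
  show "W_rel \<subseteq> H3 \<times> H3" by (auto simp: W_rel_iff)
  show "(w, w) \<in> W_rel" if "w \<in> H3" for w
    using that F_one \<Gamma>_one by (auto simp: W_rel_iff sp_act_one intro!: bexI[of _ "mat 1"])
  show "(w', w) \<in> W_rel" if ww: "(w, w') \<in> W_rel" for w w'
  proof -
    obtain h where h: "w \<in> H3" "w' \<in> H3" "h \<in> F" "h \<in> \<Gamma>" "phiH d w' = sp_act h (phiH d w)"
      using ww by (auto simp: W_rel_iff)
    then have "phiH d w = sp_act (matrix_inv h) (phiH d w')"
      using inv_act(1)[OF F_R[OF h(3)] phiH_in[OF h(1)]] by simp
    then show ?thesis using h F_inv \<Gamma>_inv unfolding W_rel_iff by blast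
  qed
  show "(w, w'') \<in> W_rel" if ww: "(w, w') \<in> W_rel" "(w', w'') \<in> W_rel" for w w' w''
  proof -
    obtain h h' where h: "w \<in> H3" "w'' \<in> H3" "h \<in> F" "h \<in> \<Gamma>" "phiH d w' = sp_act h (phiH d w)"
      "h' \<in> F" "h' \<in> \<Gamma>" "phiH d w'' = sp_act h' (phiH d w')"
      using ww by (auto simp: W_rel_iff)
    then have "phiH d w'' = sp_act (h' ** h) (phiH d w)"
      by (simp add: sp_act_mult F_R)
    then show ?thesis using h F_mult \<Gamma>_mult unfolding W_rel_iff by blast
  qed
qed

text \<open>Well-definedness on orbits: for \<open>h\<close> in \<open>F \<inter> \<Gamma>\<close>
  one has g h = (g h g^-1) g, and \<open>g\<close> normalizes \<open>\<Gamma>\<close>. The union in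
  \<open>gphi\<close> thus collapses to a single orbit.\<close>

lemma gphi_class:
  assumes g: "g \<in> GammaTilde d N" and w: "w \<in> H3"
  shows "gphi d N g (W_rel `` {w}) = orb (sp_act g (phiH d w))"
proof -
  have "orb (sp_act g (phiH d w')) = orb (sp_act g (phiH d w))" if ww: "(w, w') \<in> W_rel" for w'
  proof -
    obtain h where h: "h \<in> F" "h \<in> \<Gamma>" "phiH d w' = sp_act h (phiH d w)"
      using ww by (auto simp: W_rel_iff)
    define k where "k = g ** h ** matrix_inv g"
    have k: "k \<in> \<Gamma>" unfolding k_def by (rule GammaTilde_normalizes[OF d0 g h(2)])
    have "k ** g = g ** h"
      by (simp add: k_def Sp4R_inv(2)[OF GT_R[OF g]] flip: matrix_mul_assoc)
    then have "sp_act g (phiH d w') = sp_act k (sp_act g (phiH d w))"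
      using w by (simp add: h(3) GT_R[OF g] \<Gamma>_R[OF k] F_R[OF h(1)] flip: sp_act_mult)
    then show ?thesis
      using orb_act[OF sp_act_siegel[OF GT_R[OF g] phiH_in[OF w]] k] by simp
  qed
  moreover have "(w, w) \<in> W_rel" using w equiv_class_self[OF W_equiv] by blast
  ultimately show ?thesis
    unfolding gphi_def orb_def[symmetric] by blast
qed

text \<open>The element h = (\<delta> g')^-1 g carries one point fixed by the involution to another.
  So hat(h) h^-1, which lies in \<open>\<Gamma>\<close>, fixes the second point and is 1 by
  freeness. Taking g = g' serves injectivity, distinct representatives serve disjointness.\<close>

lemma same_orbit:
  assumes g: "g \<in> GammaTilde d N" and g': "g' \<in> GammaTilde d N" and w: "w \<in> H3" and w': "w' \<in> H3"
    and eq: "orb (sp_act g (phiH d w)) = orb (sp_act g' (phiH d w'))"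
  obtains \<delta> h where "\<delta> \<in> \<Gamma>" "h \<in> F" "g = \<delta> ** g' ** h" "phiH d w' = sp_act h (phiH d w)"
proof -
  have sg: "sp_act g (phiH d w) \<in> siegel" "sp_act g' (phiH d w') \<in> siegel"
    using GT_R g g' w w' by (auto intro!: sp_act_siegel)
  have "(sp_act g' (phiH d w'), sp_act g (phiH d w)) \<in> X_rel d N"
    using eq orb_eq_iff sg by metis
  then obtain \<delta> where \<delta>: "\<delta> \<in> \<Gamma>" "sp_act g (phiH d w) = sp_act \<delta> (sp_act g' (phiH d w'))"
    by (auto simp: X_rel_iff)
  define k where "k = \<delta> ** g'"
  have k: "k \<in> GammaTilde d N" unfolding k_def by (intro GT_mult GT_\<Gamma> \<delta> g')
  define h where "h = matrix_inv k ** g"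
  have h: "h \<in> GammaTilde d N" unfolding h_def by (intro GT_mult GT_inv k g)
  have gkh: "g = k ** h"
    by (simp add: h_def matrix_mul_assoc Sp4R_inv(3)[OF GT_R[OF k]])
  have hw: "sp_act h (phiH d w) = phiH d w'"
  proof -
    have "sp_act h (phiH d w) = sp_act (matrix_inv k) (sp_act g (phiH d w))"
      unfolding h_def by (intro sp_act_mult Sp4R_inv(4) GT_R k g phiH_in w)
    also have "\<dots> = sp_act (matrix_inv k) (sp_act k (phiH d w'))"
      unfolding \<delta>(2) k_def using \<delta>(1) g' w' by (simp add: sp_act_mult \<Gamma>_R GT_R)
    also have "\<dots> = phiH d w'"
      by (intro inv_act GT_R k phiH_in w')
    finally show ?thesis .
  qed
  define c where "c = hat d h ** matrix_inv h"
  have c: "c \<in> \<Gamma>" using h by (simp add: GammaTilde_def c_def)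
  have "c ** h = hat d h"
    by (simp add: c_def Sp4R_inv(2)[OF GT_R[OF h]] flip: matrix_mul_assoc)
  then have "sp_act c (phiH d w') = sp_act (hat d h) (phiH d w)"
    using w by (simp add: hw[symmetric] GT_R[OF h] \<Gamma>_R[OF c] flip: sp_act_mult)
  also have "\<dots> = hatZ d (sp_act h (phiH d w))"
    using w by (simp add: hatZ_sp_act d GT_R[OF h] hatZ_phiH)
  also have "\<dots> = phiH d w'" by (simp add: hw hatZ_phiH d)
  finally have "c = mat 1" by (rule \<Gamma>_free[OF c phiH_in[OF w']])
  with \<open>c ** h = hat d h\<close> have "h \<in> F"
    using GT_Z[OF h] by (simp add: F_def)
  with \<delta>(1) gkh hw show thesis using that k_def by metis
qed

lemma dc_rel_iff: "(g, g') \<in> dc_rel d N \<longleftrightarrow> g \<in> GammaTilde d N \<and> g' \<in> GammaTilde d N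
    \<and> (\<exists>\<gamma>\<in>\<Gamma>. \<exists>h\<in>F. g' = \<gamma> ** g ** h)"
  unfolding dc_rel_def F_eq[symmetric] by auto

section \<open>Double cosets, their finiteness and the decomposition\<close>

lemma dc_equiv: "equiv (GammaTilde d N) (dc_rel d N)"
proof (rule equiv_on_setI)
  show "dc_rel d N \<subseteq> GammaTilde d N \<times> GammaTilde d N" by (auto simp: dc_rel_iff)
  show "(g, g) \<in> dc_rel d N" if "g \<in> GammaTilde d N" for g
    using that F_one \<Gamma>_one by (auto simp: dc_rel_iff intro!: bexI[of _ "mat 1"])
  show "(g', g) \<in> dc_rel d N" if gg: "(g, g') \<in> dc_rel d N" for g g'
  proof -
    obtain \<gamma> h where *: "g \<in> GammaTilde d N" "g' \<in> GammaTilde d N" "\<gamma> \<in> \<Gamma>" "h \<in> F" "g' = \<gamma> ** g ** h"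
      using gg by (auto simp: dc_rel_iff)
    have "matrix_inv \<gamma> ** g' ** matrix_inv h = (matrix_inv \<gamma> ** \<gamma>) ** g ** (h ** matrix_inv h)"
      unfolding *(5) by (simp only: matrix_mul_assoc)
    then have "g = matrix_inv \<gamma> ** g' ** matrix_inv h"
      by (simp add: Sp4R_inv(2,3) \<Gamma>_R[OF *(3)] F_R[OF *(4)])
    then show ?thesis using * \<Gamma>_inv F_inv unfolding dc_rel_iff by blast
  qed
  show "(g, g'') \<in> dc_rel d N" if gg: "(g, g') \<in> dc_rel d N" "(g', g'') \<in> dc_rel d N" for g g' g''
  proof -
    obtain \<gamma> h \<gamma>' h' where *: "g \<in> GammaTilde d N" "g'' \<in> GammaTilde d N" "\<gamma> \<in> \<Gamma>" "h \<in> F" "g' = \<gamma> ** g ** h"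
      "\<gamma>' \<in> \<Gamma>" "h' \<in> F" "g'' = \<gamma>' ** g' ** h'"
      using gg by (auto simp: dc_rel_iff)
    have "g'' = (\<gamma>' ** \<gamma>) ** g ** (h ** h')"
      unfolding *(5,8) by (simp only: matrix_mul_assoc)
    then show ?thesis using * \<Gamma>_mult F_mult unfolding dc_rel_iff by blast
  qed
qed

text \<open>Two elements of \<open>GammaTilde d N\<close> that agree modulo K = N |d| differ by a
  left factor in \<open>GammaSp K\<close>, which is contained in \<open>\<Gamma>\<close>. There are
  finitely many residues.\<close>

lemma finite_double_cosets: "finite (double_cosets d N)"
  unfolding double_cosets_def
proof (rule finite_quotient_invariant[OF _ dc_equiv])
  define K where "K = N * nat \<bar>d\<bar>"
  have K: "K > 0" using N3 d0 by (simp add: K_def)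
  \<comment> \<open>The entries are real numbers known to be integral, hence the floor before
    reducing.\<close>
  define \<rho> where "\<rho> g = (\<lambda>p. \<lfloor>g $ fst p $ snd p\<rfloor> mod int K)" for g :: mat4
  have "\<rho> ` GammaTilde d N \<subseteq> PiE UNIV (\<lambda>_. {0..<int K})"
    using K by (auto simp: \<rho>_def)
  then show "finite (\<rho> ` GammaTilde d N)"
    by (rule finite_subset) (simp add: finite_PiE)
  fix g g' assume g: "g \<in> GammaTilde d N" and g': "g' \<in> GammaTilde d N" and eq: "\<rho> g = \<rho> g'"
  have entries: "(1 / real K) *\<^sub>R (g' - g) \<in> int_mats"
    unfolding int_mats_def mem_Collect_eq
  proof (intro allI)
    fix i j
    have "g $ i $ j \<in> \<int>" "g' $ i $ j \<in> \<int>"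
      using GT_Z[OF g] GT_Z[OF g'] by (auto simp: Sp4Z_def)
    then obtain x y where xy: "g $ i $ j = of_int x" "g' $ i $ j = of_int y"
      by (meson Ints_cases)
    have "x mod int K = y mod int K"
      using fun_cong[OF eq, of "(i, j)"] by (simp add: \<rho>_def xy)
    then have "int K dvd y - x" by (metis mod_eq_dvd_iff)
    then obtain z where "y - x = int K * z" by blast
    then have "real_of_int y - of_int x = real K * of_int z"
      by (metis of_int_diff of_int_mult of_int_of_nat_eq)
    then have "((1 / real K) *\<^sub>R (g' - g)) $ i $ j = of_int z"
      using K by (simp add: xy)
    then show "((1 / real K) *\<^sub>R (g' - g)) $ i $ j \<in> \<int>" by simp
  qed
  define \<gamma> where "\<gamma> = g' ** matrix_inv g"
  have "g' = g + real K *\<^sub>R ((1 / real K) *\<^sub>R (g' - g))" using K by simp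
  then have "\<gamma> = g ** matrix_inv g + real K *\<^sub>R (((1 / real K) *\<^sub>R (g' - g)) ** matrix_inv g)"
    unfolding \<gamma>_def by (metis matrix_add_rdistrib matrix_scaleR_left)
  then have "\<gamma> = mat 1 + real K *\<^sub>R (((1 / real K) *\<^sub>R (g' - g)) ** matrix_inv g)"
    by (simp add: Sp4R_inv(3) GT_R[OF g])
  moreover have "((1 / real K) *\<^sub>R (g' - g)) ** matrix_inv g \<in> int_mats"
    using Sp4Z_inv[OF GT_Z[OF g]] by (intro int_mats_mult entries) (simp add: Sp4Z_iff)
  moreover have "\<gamma> \<in> Sp4R"
    unfolding \<gamma>_def by (intro Sp4R_mult Sp4R_inv(4) GT_R g g')
  ultimately have "\<gamma> \<in> GammaSp K" unfolding GammaSp_iff by blast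
  then have "\<gamma> \<in> \<Gamma>" using GammaSp_subset_Gamma_N[OF d0] K_def by blast
  moreover have "g' = \<gamma> ** g ** mat 1"
    by (simp add: \<gamma>_def Sp4R_inv(2) GT_R[OF g] flip: matrix_mul_assoc)
  ultimately show "(g, g') \<in> dc_rel d N"
    using g g' F_one unfolding dc_rel_iff by blast
qed

lemma X_real_exists:
  assumes x: "x \<in> X_real d N"
  obtains g w where "g \<in> GammaTilde d N" "w \<in> H3" "x = orb (sp_act g (phiH d w))"
proof -
  obtain Z where Z: "Z \<in> siegel" "x = orb Z" and hx: "hatZ d ` x = x"
    using x by (auto simp: X_real_def X_space_def orb_def elim!: quotientE)
  have hZ: "hatZ d Z \<in> siegel" by (rule hatZ_siegel[OF d(1) Z(1)])
  have "orb Z = orb (hatZ d Z)" using hx by (simp add: Z hatZ_orb)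
  then obtain c where c: "c \<in> \<Gamma>" "hatZ d Z = sp_act c Z"
    using orb_eq_iff[OF Z(1) hZ] by (auto simp: X_rel_iff)
  have cR: "c \<in> Sp4R" and hcR: "hat d c \<in> Sp4R" using c(1) \<Gamma>_R \<Gamma>_hat by auto
  have "Z = hatZ d (hatZ d Z)" by (simp add: hatZ_hatZ d0)
  also have "\<dots> = sp_act (hat d c) (sp_act c Z)"
    using hatZ_sp_act[OF d(1) cR Z(1)] unfolding c(2) .
  also have "\<dots> = sp_act (hat d c ** c) Z"
    by (rule sp_act_mult[OF hcR cR Z(1), symmetric])
  finally have "hat d c ** c = mat 1"
    using \<Gamma>_free[OF \<Gamma>_mult[OF \<Gamma>_hat[OF c(1)] c(1)] Z(1)] by simp
  then obtain g where g: "g \<in> GammaTilde d N" "c = hat d g ** matrix_inv g"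
    using cocycle_is_coboundary[OF d N_even c(1)] by blast
  have gR: "g \<in> Sp4R" by (rule GT_R[OF g(1)])
  \<comment> \<open>The involution sends Z to cZ, hence \<open>Z0\<close> to hat(g)^-1 c Z, and c =
    hat(g) g^-1 makes this \<open>Z0\<close> again.\<close>
  define Z0 where "Z0 = sp_act (matrix_inv g) Z"
  have Z0: "Z0 \<in> siegel" unfolding Z0_def by (intro sp_act_siegel Sp4R_inv(4) gR Z)
  have "hatZ d Z0 = sp_act (hat d (matrix_inv g)) (sp_act c Z)"
    unfolding Z0_def by (simp add: hatZ_sp_act d Sp4R_inv(4) gR Z(1) c(2))
  also have "\<dots> = sp_act (hat d (matrix_inv g) ** c) Z"
    by (rule sp_act_mult[symmetric]) (simp_all add: hat_Sp4R d0 Sp4R_inv(4) gR cR Z(1))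
  also have "hat d (matrix_inv g) ** c = matrix_inv g"
    unfolding g(2) by (simp add: matrix_mul_assoc Sp4R_inv(2) gR hat_one d0 flip: hat_mult)
  finally have "hatZ d Z0 = Z0" by (simp add: Z0_def)
  then obtain w where w: "w \<in> H3" "Z0 = phiH d w"
    using hatZ_fixed_imp_phiH[OF d(1) Z0] by blast
  then have "Z = sp_act g (phiH d w)"
    using inv_act(2)[OF gR Z(1)] by (simp add: Z0_def)
  then show thesis using that g(1) w(1) Z(2) by blast
qed

lemma X_real_member:
  assumes g: "g \<in> GammaTilde d N" and w: "w \<in> H3"
  shows "orb (sp_act g (phiH d w)) \<in> X_real d N"
proof -
  define Z where "Z = sp_act g (phiH d w)"
  have gR: "g \<in> Sp4R" by (rule GT_R[OF g])
  have Z: "Z \<in> siegel" unfolding Z_def by (intro sp_act_siegel gR phiH_in w)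
  define c where "c = hat d g ** matrix_inv g"
  have c: "c \<in> \<Gamma>" using g by (simp add: GammaTilde_def c_def)
  have "c ** g = hat d g"
    by (simp add: c_def Sp4R_inv(2) gR flip: matrix_mul_assoc)
  then have "hatZ d Z = sp_act c Z"
    using w by (simp add: Z_def hatZ_sp_act d gR hatZ_phiH \<Gamma>_R[OF c] flip: sp_act_mult)
  then have "hatZ d ` orb Z = orb Z"
    by (simp add: hatZ_orb Z orb_act c)
  moreover have "orb Z \<in> X_space d N"
    unfolding X_space_def orb_def using Z by (rule quotientI)
  ultimately show ?thesis by (simp add: X_real_def Z_def)
qed

lemma W_space_eq: "W_space d N = (\<lambda>w. W_rel `` {w}) ` H3"
  unfolding W_space_def W_rel_def[symmetric] quotient_def by blast

lemma gphi_image: "g \<in> GammaTilde d N \<Longrightarrow> gphi d N g ` W_space d N = (\<lambda>w. orb (sp_act g (phiH d w))) ` H3"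
  by (simp add: W_space_eq image_image gphi_class)

lemma gphi_inj:
  assumes g: "g \<in> GammaTilde d N"
  shows "inj_on (gphi d N g) (W_space d N)"
proof (rule inj_onI)
  fix \<omega> \<omega>' assume "\<omega> \<in> W_space d N" "\<omega>' \<in> W_space d N" and eq: "gphi d N g \<omega> = gphi d N g \<omega>'"
  then obtain w w' where w: "w \<in> H3" "w' \<in> H3" "\<omega> = W_rel `` {w}" "\<omega>' = W_rel `` {w'}"
    by (auto simp: W_space_eq)
  then have "orb (sp_act g (phiH d w)) = orb (sp_act g (phiH d w'))"
    using eq by (simp add: gphi_class g)
  then obtain \<delta> h where h: "\<delta> \<in> \<Gamma>" "h \<in> F" "g = \<delta> ** g ** h" "phiH d w' = sp_act h (phiH d w)"
    using same_orbit[OF g g w(1,2)] by blast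
  have gR: "g \<in> Sp4R" and \<delta>R: "\<delta> \<in> Sp4R" using GT_R g \<Gamma>_R h(1) by auto
  \<comment> \<open>Solving g = \<delta> g h for h gives g^-1 \<delta>^-1 g, which lies in
    \<open>\<Gamma>\<close> because \<open>g\<close> normalizes it.\<close>
  have "h = (matrix_inv g ** ((matrix_inv \<delta> ** \<delta>) ** g)) ** h"
    by (simp add: Sp4R_inv(2) gR \<delta>R)
  also have "\<dots> = matrix_inv g ** matrix_inv \<delta> ** (\<delta> ** g ** h)"
    by (simp only: matrix_mul_assoc)
  also have "\<dots> = matrix_inv g ** matrix_inv \<delta> ** g"
    by (simp only: h(3)[symmetric])
  finally have "h \<in> \<Gamma>"
    using GammaTilde_normalizes'[OF d0 g \<Gamma>_inv[OF h(1)]] by simp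
  then have "(w, w') \<in> W_rel" using h w by (auto simp: W_rel_iff)
  then show "\<omega> = \<omega>'" using w equiv_class_eq[OF W_equiv] by simp
qed

lemma decomposition:
  assumes R: "R \<subseteq> GammaTilde d N" and bij: "bij_betw (\<lambda>g. dc_rel d N `` {g}) R (double_cosets d N)"
  shows "X_real d N = (\<Union>g\<in>R. gphi d N g ` W_space d N)"
    and "disjoint_family_on (\<lambda>g. gphi d N g ` W_space d N) R"
proof -
  show "X_real d N = (\<Union>g\<in>R. gphi d N g ` W_space d N)"
  proof (intro equalityI subsetI)
    fix x assume "x \<in> X_real d N"
    then obtain g w where g: "g \<in> GammaTilde d N" "w \<in> H3" "x = orb (sp_act g (phiH d w))"
      by (rule X_real_exists)
    \<comment> \<open>The element \<open>g\<close> is replaced by the representative of its double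
      coset: the left factor disappears in the orbit, the right factor moves the point within
      \<open>H3\<close>.\<close>
    have "dc_rel d N `` {g} \<in> double_cosets d N"
      unfolding double_cosets_def by (rule quotientI[OF g(1)])
    then obtain r where r: "r \<in> R" "dc_rel d N `` {r} = dc_rel d N `` {g}"
      unfolding bij_betw_imp_surj_on[OF bij, symmetric] by force
    have rT: "r \<in> GammaTilde d N" using r R by blast
    have "(r, g) \<in> dc_rel d N"
      using eq_equiv_class_iff[OF dc_equiv rT g(1)] r(2) by simp
    then obtain \<gamma> h where h: "\<gamma> \<in> \<Gamma>" "h \<in> F" "g = \<gamma> ** r ** h" by (auto simp: dc_rel_iff)
    obtain w' where w': "w' \<in> H3" "phiH d w' = sp_act h (phiH d w)"
      using F_phiH[OF h(2) g(2)] by blast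
    have "sp_act g (phiH d w) = sp_act \<gamma> (sp_act r (phiH d w'))"
      using g(2) w' by (simp add: h(3) sp_act_mult Sp4R_mult \<Gamma>_R[OF h(1)] GT_R[OF rT] F_R[OF h(2)] sp_act_siegel)
    then have "x = orb (sp_act r (phiH d w'))"
      using orb_act[OF sp_act_siegel[OF GT_R[OF rT] phiH_in[OF w'(1)]] h(1)] g(3) by simp
    then show "x \<in> (\<Union>g\<in>R. gphi d N g ` W_space d N)"
      using r(1) w'(1) gphi_image[OF rT] by blast
  next
    fix x assume "x \<in> (\<Union>g\<in>R. gphi d N g ` W_space d N)"
    then obtain g where g: "g \<in> R" "x \<in> gphi d N g ` W_space d N" by blast
    then have "x \<in> (\<lambda>w. orb (sp_act g (phiH d w))) ` H3"
      using gphi_image R by blast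
    then show "x \<in> X_real d N" using X_real_member g R by blast
  qed
  show "disjoint_family_on (\<lambda>g. gphi d N g ` W_space d N) R"
    unfolding disjoint_family_on_def
  proof (intro ballI impI)
    fix g g' assume g: "g \<in> R" "g' \<in> R" "g \<noteq> g'"
    have T: "g \<in> GammaTilde d N" "g' \<in> GammaTilde d N" using g R by auto
    have False if x: "x \<in> gphi d N g ` W_space d N" "x \<in> gphi d N g' ` W_space d N" for x
    proof -
      obtain w w' where w: "w \<in> H3" "w' \<in> H3" "x = orb (sp_act g (phiH d w))" "x = orb (sp_act g' (phiH d w'))"
        using x unfolding gphi_image[OF T(1)] gphi_image[OF T(2)] by blast
      then have "orb (sp_act g (phiH d w)) = orb (sp_act g' (phiH d w'))" by simp
      then obtain \<delta> h where "\<delta> \<in> \<Gamma>" "h \<in> F" "g = \<delta> ** g' ** h"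
        using same_orbit[OF T w(1,2)] by blast
      then have "(g', g) \<in> dc_rel d N" using T by (auto simp: dc_rel_iff)
      then have "dc_rel d N `` {g'} = dc_rel d N `` {g}"
        by (rule equiv_class_eq[OF dc_equiv])
      then show False using g bij by (auto simp: bij_betw_def inj_on_def)
    qed
    then show "gphi d N g ` W_space d N \<inter> gphi d N g' ` W_space d N = {}" by blast
  qed
qed

section \<open>Identification of the double cosets with the first cohomology set\<close>

lemma Z1_iff: "f \<in> Z1 d \<Gamma> \<longleftrightarrow> (\<exists>c\<in>\<Gamma>. f = cochain c \<and> hat d c ** c = mat 1)"
  using matrix_left_right_inverse by (auto simp: Z1_def cocycle_cochain_iff[OF d0])

lemma cohom_rel_iff:
  assumes "cochain c \<in> Z1 d \<Gamma>" "cochain c' \<in> Z1 d \<Gamma>"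
  shows "(cochain c, cochain c') \<in> cohom_rel d \<Gamma> \<longleftrightarrow> (\<exists>h\<in>\<Gamma>. c' = hat d h ** c ** matrix_inv h)"
proof -
  have "(\<forall>s. cochain c' s = gal_act d s h ** cochain c s ** matrix_inv h) \<longleftrightarrow> c' = hat d h ** c ** matrix_inv h"
    if "h \<in> \<Gamma>" for h
  proof -
    have all: "(\<forall>s. P s) \<longleftrightarrow> P GalId \<and> P GalConj" for P
      by (metis (full_types) gal.exhaust)
    show ?thesis unfolding all using that \<Gamma>_R by (simp add: Sp4R_inv(3))
  qed
  then show ?thesis using assms by (auto simp: cohom_rel_def)
qed

lemma cohom_equiv: "equiv (Z1 d \<Gamma>) (cohom_rel d \<Gamma>)"
proof (rule equiv_on_setI)
  show sub: "cohom_rel d \<Gamma> \<subseteq> Z1 d \<Gamma> \<times> Z1 d \<Gamma>" by (auto simp: cohom_rel_def)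
  show "(f, f) \<in> cohom_rel d \<Gamma>" if f: "f \<in> Z1 d \<Gamma>" for f
  proof -
    obtain c where c: "f = cochain c" using f by (auto simp: Z1_iff)
    have "c = hat d (mat 1) ** c ** matrix_inv (mat 1)"
      using matrix_inv_eqI[of "mat 1" "mat 1 :: mat4"] by (simp add: hat_one d0)
    then show ?thesis using f \<Gamma>_one cohom_rel_iff[of c c] unfolding c by blast
  qed
  show "(f', f) \<in> cohom_rel d \<Gamma>" if ff: "(f, f') \<in> cohom_rel d \<Gamma>" for f f'
  proof -
    have Z: "f \<in> Z1 d \<Gamma>" "f' \<in> Z1 d \<Gamma>" using ff sub by auto
    then obtain c c' where c: "f = cochain c" "f' = cochain c'" by (auto simp: Z1_iff)
    obtain h where h: "h \<in> \<Gamma>" "c' = hat d h ** c ** matrix_inv h"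
      using ff Z cohom_rel_iff[of c c'] unfolding c by blast
    have hR: "h \<in> Sp4R" by (rule \<Gamma>_R[OF h(1)])
    have "hat d (matrix_inv h) ** c' ** matrix_inv (matrix_inv h)
        = (hat d (matrix_inv h) ** hat d h) ** c ** (matrix_inv h ** h)"
      unfolding h(2) Sp4R_inv_inv[OF hR] by (simp only: matrix_mul_assoc)
    then have "c = hat d (matrix_inv h) ** c' ** matrix_inv (matrix_inv h)"
      by (simp add: Sp4R_inv(2) hR hat_one d0 flip: hat_mult)
    then show ?thesis using Z \<Gamma>_inv[OF h(1)] cohom_rel_iff[of c' c] unfolding c by blast
  qed
  show "(f, f'') \<in> cohom_rel d \<Gamma>" if ff: "(f, f') \<in> cohom_rel d \<Gamma>" "(f', f'') \<in> cohom_rel d \<Gamma>" for f f' f''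
  proof -
    have Z: "f \<in> Z1 d \<Gamma>" "f' \<in> Z1 d \<Gamma>" "f'' \<in> Z1 d \<Gamma>" using ff sub by auto
    then obtain c c' c'' where c: "f = cochain c" "f' = cochain c'" "f'' = cochain c''" by (auto simp: Z1_iff)
    obtain h where h: "h \<in> \<Gamma>" "c' = hat d h ** c ** matrix_inv h"
      using ff Z cohom_rel_iff[of c c'] unfolding c by blast
    obtain h' where h': "h' \<in> \<Gamma>" "c'' = hat d h' ** c' ** matrix_inv h'"
      using ff Z cohom_rel_iff[of c' c''] unfolding c by blast
    have "c'' = hat d (h' ** h) ** c ** matrix_inv (h' ** h)"
      by (simp add: h h' hat_mult d0 Sp4R_inv_mult \<Gamma>_R matrix_mul_assoc)
    then show ?thesis using Z \<Gamma>_mult[OF h'(1) h(1)] cohom_rel_iff[of c c''] unfolding c by blast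
  qed
qed

lemma coboundary_Z1:
  assumes g: "g \<in> GammaTilde d N"
  shows "cochain (hat d g ** matrix_inv g) \<in> Z1 d \<Gamma>"
proof -
  have gR: "g \<in> Sp4R" by (rule GT_R[OF g])
  have "hat d (hat d g ** matrix_inv g) ** (hat d g ** matrix_inv g)
      = g ** (hat d (matrix_inv g) ** hat d g) ** matrix_inv g"
    by (simp add: hat_mult hat_hat d0 matrix_mul_assoc)
  also have "\<dots> = mat 1"
    by (simp add: Sp4R_inv(2,3) gR hat_one d0 flip: hat_mult)
  finally show ?thesis
    using g by (auto simp: Z1_iff GammaTilde_def)
qed

text \<open>A left factor \<open>\<gamma>\<close> twists the coboundary exactly as
  \<open>cohom_rel\<close> does, and a right factor fixed by \<open>hat d\<close> cancels.
  Conversely, if \<gamma> g and g' have the same coboundary, their quotient is fixed by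
  \<open>hat d\<close> and so lies in \<open>F\<close>.\<close>

lemma dc_rel_iff_cohom:
  assumes g: "g \<in> GammaTilde d N" and g': "g' \<in> GammaTilde d N"
  shows "(g, g') \<in> dc_rel d N \<longleftrightarrow>
    (cochain (hat d g ** matrix_inv g), cochain (hat d g' ** matrix_inv g')) \<in> cohom_rel d \<Gamma>"
proof -
  have gR: "g \<in> Sp4R" "g' \<in> Sp4R" using GT_R g g' by auto
  have "(\<exists>\<gamma>\<in>\<Gamma>. \<exists>h\<in>F. g' = \<gamma> ** g ** h) \<longleftrightarrow>
    (\<exists>\<gamma>\<in>\<Gamma>. hat d g' ** matrix_inv g' = hat d \<gamma> ** (hat d g ** matrix_inv g) ** matrix_inv \<gamma>)"
  proof (intro bex_cong refl iffI)
    fix \<gamma> assume \<gamma>: "\<gamma> \<in> \<Gamma>" and "\<exists>h\<in>F. g' = \<gamma> ** g ** h"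
    then obtain h where h: "h \<in> F" "g' = \<gamma> ** g ** h" by blast
    have \<gamma>R: "\<gamma> \<in> Sp4R" and hR: "h \<in> Sp4R" using \<Gamma>_R F_R \<gamma> h by auto
    have "hat d g' ** matrix_inv g' = hat d \<gamma> ** hat d g ** (h ** matrix_inv h) ** matrix_inv g ** matrix_inv \<gamma>"
      by (simp add: h(2) hat_mult d0 F_hat[OF h(1)] Sp4R_inv_mult Sp4R_mult \<gamma>R gR hR matrix_mul_assoc)
    then show "hat d g' ** matrix_inv g' = hat d \<gamma> ** (hat d g ** matrix_inv g) ** matrix_inv \<gamma>"
      by (simp add: Sp4R_inv(3) hR matrix_mul_assoc)
  next
    fix \<gamma> assume \<gamma>: "\<gamma> \<in> \<Gamma>"
      and eq: "hat d g' ** matrix_inv g' = hat d \<gamma> ** (hat d g ** matrix_inv g) ** matrix_inv \<gamma>"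
    define k where "k = \<gamma> ** g"
    have k: "k \<in> GammaTilde d N" unfolding k_def by (intro GT_mult GT_\<Gamma> \<gamma> g)
    have kR: "k \<in> Sp4R" by (rule GT_R[OF k])
    have eq': "hat d g' ** matrix_inv g' = hat d k ** matrix_inv k"
      by (simp add: eq k_def hat_mult d0 Sp4R_inv_mult \<Gamma>_R[OF \<gamma>] gR matrix_mul_assoc)
    define h where "h = matrix_inv k ** g'"
    have "hat d g' = hat d g' ** matrix_inv g' ** g'"
      by (simp add: Sp4R_inv(2) gR flip: matrix_mul_assoc)
    then have "hat d h = (hat d (matrix_inv k) ** hat d k) ** matrix_inv k ** g'"
      by (simp add: eq' h_def hat_mult d0 matrix_mul_assoc)
    then have "hat d h = h"
      by (simp add: h_def Sp4R_inv(2) kR hat_one d0 flip: hat_mult)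
    moreover have "h \<in> Sp4Z"
      unfolding h_def by (intro Sp4Z_mult Sp4Z_inv GT_Z k g')
    ultimately have "h \<in> F" by (simp add: F_def)
    moreover have "g' = \<gamma> ** g ** h"
      unfolding h_def k_def[symmetric] by (simp add: matrix_mul_assoc Sp4R_inv(3) kR)
    ultimately show "\<exists>h\<in>F. g' = \<gamma> ** g ** h" by blast
  qed
  then show ?thesis
    using g g' cohom_rel_iff[OF coboundary_Z1[OF g] coboundary_Z1[OF g']] by (simp add: dc_rel_iff)
qed

lemma coboundary_image:
  "(\<lambda>g. cochain (hat d g ** matrix_inv g)) ` GammaTilde d N = Z1 d \<Gamma>"
proof (intro equalityI subsetI)
  fix f assume "f \<in> Z1 d \<Gamma>"
  then obtain c where c: "c \<in> \<Gamma>" "f = cochain c" "hat d c ** c = mat 1" by (auto simp: Z1_iff)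
  then obtain g where "g \<in> GammaTilde d N" "c = hat d g ** matrix_inv g"
    using cocycle_is_coboundary[OF d N_even c(1,3)] by blast
  then show "f \<in> (\<lambda>g. cochain (hat d g ** matrix_inv g)) ` GammaTilde d N"
    using c(2) by blast
qed (use coboundary_Z1 in blast)

end

theorem theorem6p3:
  fixes d :: int and N :: nat
  assumes "d < 0" and "squarefree d"
    and "principal_domain (quad_int_ring d)"
    and "N \<ge> 3"
    and "d mod 4 = 1 \<longrightarrow> even N"
  shows "finite (double_cosets d N)
    \<and> (\<forall>R. R \<subseteq> GammaTilde d N
            \<and> bij_betw (\<lambda>g. dc_rel d N `` {g}) R (double_cosets d N) \<longrightarrow>
          X_real d N = (\<Union>g\<in>R. gphi d N g ` W_space d N)
          \<and> disjoint_family_on (\<lambda>g. gphi d N g ` W_space d N) R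
          \<and> (\<forall>g\<in>R. inj_on (gphi d N g) (W_space d N)))
    \<and> (\<exists>\<Phi>. bij_betw \<Phi> (double_cosets d N) (H1 d (Gamma_N d N))
          \<and> (\<forall>g\<in>GammaTilde d N.
                cochain (hat d g ** matrix_inv g) \<in> Z1 d (Gamma_N d N)
                \<and> \<Phi> (dc_rel d N `` {g})
                    = cohom_rel d (Gamma_N d N) `` {cochain (hat d g ** matrix_inv g)}))"
proof -
  interpret real_points d N
    by (rule real_points.intro) (fact assms)+
  obtain \<Phi> where \<Phi>: "bij_betw \<Phi> (GammaTilde d N // dc_rel d N) (Z1 d (Gamma_N d N) // cohom_rel d (Gamma_N d N))"
    "\<And>g. g \<in> GammaTilde d N \<Longrightarrow> \<Phi> (dc_rel d N `` {g})
        = cohom_rel d (Gamma_N d N) `` {cochain (hat d g ** matrix_inv g)}"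
    using bij_betw_quotient[OF dc_equiv cohom_equiv coboundary_image dc_rel_iff_cohom] by blast
  have bij: "bij_betw \<Phi> (double_cosets d N) (H1 d (Gamma_N d N))"
    using \<Phi>(1) unfolding double_cosets_def H1_def .
  show ?thesis
  proof (intro conjI allI impI exI[of _ \<Phi>] ballI)
    fix R assume R: "R \<subseteq> GammaTilde d N \<and> bij_betw (\<lambda>g. dc_rel d N `` {g}) R (double_cosets d N)"
    then show "X_real d N = (\<Union>g\<in>R. gphi d N g ` W_space d N)"
      and "disjoint_family_on (\<lambda>g. gphi d N g ` W_space d N) R"
      using decomposition by blast+
    show "inj_on (gphi d N g) (W_space d N)" if "g \<in> R" for g
      using R that gphi_inj by blast
  qed (use finite_double_cosets bij \<Phi>(2) coboundary_Z1 in blast)+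
qed

end
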